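(* Let $\beta\in(0,1)$ and $\sigma>0$ be fixed numbers, and let $d=d_\varepsilon\to\infty$ and $s=s_\varepsilon\to\infty$ be such that $s=o(d)$, $\log\log d=o(s)$ and $\log\binom ds=o(\log\varepsilon^{-1})$ as $\varepsilon\to0$. Let the family of collections $r_\varepsilon=\{r_{\varepsilon,k},1\le k\le s\}$, $r_{\varepsilon,k}>0$, be such that $$\limsup_{\varepsilon\to0}\min_{1\le k\le s}\frac{a_{\varepsilon,u_k}(r_{\varepsilon,k})}{\sqrt{\log\binom dk}}<\sqrt2\,\bigl(1+\sqrt{1-\beta}\bigr),$$ where $u_k$ is an arbitrary element of $\mathcal U_{k,d}$. Then $$\liminf_{\varepsilon\to0}\ \inf_{\tilde{\boldsymbol\eta}}\ \sup_{\boldsymbol\eta\in\mathcal H^s_{\beta,d}}\ \sup_{\boldsymbol\theta\in\Theta^\sigma_{s,d}(r_\varepsilon)}\ \mathrm E_{\boldsymbol\theta,\boldsymbol\eta}\sum_{k=1}^s\sum_{u_k\in\mathcal U_{k,d}}|\tilde\eta_{u_k}-\eta_{u_k}|>0,$$ where the infimum is taken over all selectors $\tilde{\boldsymbol\eta}$ of $\boldsymbol\eta\in\mathcal H^s_{\beta,d}$ in the model below.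
   Context: Setting. $\varepsilon>0$ is a noise level tending to $0$. For $1\le k\le d$, $\mathcal U_{k,d}$ is the set of subsets $u_k\subseteq\{1,\ldots,d\}$ with $k$ elements, and $\mathring{\mathbb Z}_{u_k}=\{\boldsymbol\ell=(l_1,\ldots,l_d)\in\mathbb Z^d: l_j=0 \text{ for } j\notin u_k,\ l_j\neq0 \text{ for } j\in u_k\}$. For $\boldsymbol\ell\in\mathbb Z^d$ put $c_{\boldsymbol\ell}^2=\bigl(\sum_{j=1}^d(2\pi l_j)^2\bigr)^{\sigma}$. For $r>0$ let $$\mathring\Theta_{\mathbf c_{u_k}}(r)=\Bigl\{\boldsymbol\theta_{u_k}=(\theta_{\boldsymbol\ell}(u_k))_{\boldsymbol\ell\in\mathring{\mathbb Z}_{u_k}}: \sum_{\boldsymbol\ell\in\mathring{\mathbb Z}_{u_k}}\theta_{\boldsymbol\ell}^2(u_k)c_{\boldsymbol\ell}^2\le1,\ \sum_{\boldsymbol\ell\in\mathring{\mathbb Z}_{u_k}}\theta_{\boldsymbol\ell}^2(u_k)\ge r^2\Bigr\}.$$ Given $r_\varepsilon=\{r_{\varepsilon,k}\}$, $\Theta^\sigma_{s,d}(r_\varepsilon)$ is the set of all collections $\boldsymbol\theta=(\boldsymbol\theta_{u_k},u_k\in\mathcal U_{k,d},1\le k\le s)$ with $\boldsymbol\theta_{u_k}\in\mathring\Theta_{\mathbf c_{u_k}}(r_{\varepsilon,k})$ for every $u_k$ and $k$. For $1\le k\le s$, $H^k_{\beta,d}$ is the set of $\boldsymbol\eta_k=(\eta_{u_k})_{u_k\in\mathcal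 U_{k,d}}\in\{0,1\}^{\mathcal U_{k,d}}$ with $\sum_{u_k\in\mathcal U_{k,d}}\eta_{u_k}=\binom{d}{k}^{1-\beta}(1+o(1))$ as $\varepsilon\to0$, and $\mathcal H^s_{\beta,d}=\{\boldsymbol\eta=(\boldsymbol\eta_1,\ldots,\boldsymbol\eta_s):\boldsymbol\eta_k\in H^k_{\beta,d}\}$. Observations (sequence space model): $X_{\boldsymbol\ell}=\eta_{u_k}\theta_{\boldsymbol\ell}(u_k)+\varepsilon\xi_{\boldsymbol\ell}$, $\boldsymbol\ell\in\mathring{\mathbb Z}_{u_k}$, $u_k\in\mathcal U_{k,d}$, $1\le k\le s$, where the $\xi_{\boldsymbol\ell}$ are i.i.d. $N(0,1)$; $\mathrm E_{\boldsymbol\theta,\boldsymbol\eta}$ denotes expectation under this model. A selector is any estimator $\tilde{\boldsymbol\eta}=(\tilde\eta_{u_k},u_k\in\mathcal U_{k,d},1\le k\le s)$ with $\tilde\eta_{u_k}\in\{0,1\}$ measurable with respect to the observations. For $r>0$, $$a^2_{\varepsilon,u_k}(r)=\frac{1}{2\varepsilon^4}\inf_{\boldsymbol\theta_{u_k}\in\mathring\Theta_{\mathbf c_{u_k}}(r)}\sum_{\boldsymbol\ell\in\mathring{\mathbb Z}_{u_k}}\theta_{\boldsymbol\ell}^4(u_k),\qquad a_{\varepsilon,u_k}(r)\ge0.$$ *)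

theory Defs
  imports "HOL-Probability.Probability"
begin

text \<open>Multi-indices l in Z^d are functions nat => int; coordinates are indexed
 0..d-1 (instead of 1..d).  The support of l is the set u of coordinates with l j \<noteq> 0.\<close>

definition supp :: "(nat \<Rightarrow> int) \<Rightarrow> nat set" where
  "supp l = {j. l j \<noteq> 0}"

definition Zring :: "nat set \<Rightarrow> (nat \<Rightarrow> int) set" where
  "Zring u = {l. \<forall>j. (l j \<noteq> 0 \<longleftrightarrow> j \<in> u)}"

definition Usets :: "nat \<Rightarrow> nat \<Rightarrow> nat set set" where
  "Usets d k = {u. u \<subseteq> {..<d} \<and> card u = k}"

definition Uall :: "nat \<Rightarrow> nat \<Rightarrow> nat set set" where
  "Uall d s = (\<Union>k\<in>{1..s}. Usets d k)"

definition Idx :: "nat \<Rightarrow> nat \<Rightarrow> (nat \<Rightarrow> int) set" where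
  "Idx d s = (\<Union>u\<in>Uall d s. Zring u)"

definition csq :: "real \<Rightarrow> (nat \<Rightarrow> int) \<Rightarrow> real" where
  "csq \<sigma> l = (\<Sum>j\<in>supp l. (2 * pi * real_of_int (l j))\<^sup>2) powr \<sigma>"

text \<open>The class Theta_ring_{c_u}(r); theta is given as a function on all indices,
 only its values on Zring u matter.\<close>
definition Theta_ring :: "real \<Rightarrow> nat set \<Rightarrow> real \<Rightarrow> ((nat \<Rightarrow> int) \<Rightarrow> real) set" where
  "Theta_ring \<sigma> u r = {\<theta>.
     (\<lambda>l. (\<theta> l)\<^sup>2 * csq \<sigma> l) summable_on Zring u \<and>
     (\<Sum>\<^sub>\<infinity>l\<in>Zring u. (\<theta> l)\<^sup>2 * csq \<sigma> l) \<le> 1 \<and>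
     (\<lambda>l. (\<theta> l)\<^sup>2) summable_on Zring u \<and>
     (\<Sum>\<^sub>\<infinity>l\<in>Zring u. (\<theta> l)\<^sup>2) \<ge> r\<^sup>2}"

definition Theta_sd :: "real \<Rightarrow> nat \<Rightarrow> nat \<Rightarrow> (nat \<Rightarrow> real) \<Rightarrow> ((nat \<Rightarrow> int) \<Rightarrow> real) set" where
  "Theta_sd \<sigma> s d r = {\<theta>. \<forall>u\<in>Uall d s. \<theta> \<in> Theta_ring \<sigma> u (r (card u))}"

text \<open>a^2_{eps,u}(r) as an extended real (= +infinity if the class is empty), and
 a_{eps,u}(r) = its nonnegative square root.\<close>
definition a_sq :: "real \<Rightarrow> real \<Rightarrow> nat set \<Rightarrow> real \<Rightarrow> ereal" where
  "a_sq \<sigma> \<epsilon> u r = (INF \<theta>\<in>Theta_ring \<sigma> u r.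
      ereal ((\<Sum>\<^sub>\<infinity>l\<in>Zring u. (\<theta> l) ^ 4) / (2 * \<epsilon> ^ 4)))"

definition a_eps :: "real \<Rightarrow> real \<Rightarrow> nat set \<Rightarrow> real \<Rightarrow> ereal" where
  "a_eps \<sigma> \<epsilon> u r = (case a_sq \<sigma> \<epsilon> u r of ereal x \<Rightarrow> ereal (sqrt x) | PInfty \<Rightarrow> PInfty | MInfty \<Rightarrow> 0)"

text \<open>The class H^s_{beta,d}; the (1+o(1)) factor is made explicit by a tolerance del
 (a function of eps tending to 0 in the theorem).\<close>
definition Hclass :: "real \<Rightarrow> real \<Rightarrow> nat \<Rightarrow> nat \<Rightarrow> (nat set \<Rightarrow> bool) set" where
  "Hclass \<beta> del d s = {\<eta>. \<forall>k\<in>{1..s}.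
      \<bar>real (card {u\<in>Usets d k. \<eta> u}) - real (d choose k) powr (1 - \<beta>)\<bar>
        \<le> del * real (d choose k) powr (1 - \<beta>)}"

text \<open>Law of the observations X_l = eta_{u} theta_l + eps xi_l, l in Idx d s,
 with u = supp l: independent normals.\<close>
definition model :: "real \<Rightarrow> nat \<Rightarrow> nat \<Rightarrow> ((nat \<Rightarrow> int) \<Rightarrow> real) \<Rightarrow> (nat set \<Rightarrow> bool)
     \<Rightarrow> ((nat \<Rightarrow> int) \<Rightarrow> real) measure" where
  "model \<epsilon> d s \<theta> \<eta> = (\<Pi>\<^sub>M l\<in>Idx d s.
      density lborel (normal_density (of_bool (\<eta> (supp l)) * \<theta> l) \<epsilon>))"

definition selectors :: "nat \<Rightarrow> nat \<Rightarrow> (((nat \<Rightarrow> int) \<Rightarrow> real) \<Rightarrow> nat set \<Rightarrow> bool) set" where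
  "selectors d s = {\<eta>t. \<forall>u\<in>Uall d s.
      (\<lambda>X. \<eta>t X u) \<in> (\<Pi>\<^sub>M l\<in>Idx d s. (borel :: real measure)) \<rightarrow>\<^sub>M count_space UNIV}"

definition minimax_risk :: "real \<Rightarrow> real \<Rightarrow> real \<Rightarrow> real \<Rightarrow> nat \<Rightarrow> nat \<Rightarrow> (nat \<Rightarrow> real) \<Rightarrow> ennreal" where
  "minimax_risk \<sigma> \<beta> del \<epsilon> d s r =
     (INF \<eta>t\<in>selectors d s. SUP \<eta>\<in>Hclass \<beta> del d s. SUP \<theta>\<in>Theta_sd \<sigma> s d r.
        \<integral>\<^sup>+ X. ennreal (\<Sum>k\<in>{1..s}. \<Sum>u\<in>Usets d k.
            \<bar>real (of_bool (\<eta>t X u)) - real (of_bool (\<eta> u))\<bar>) \<partial>(model \<epsilon> d s \<theta> \<eta>))"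

end

theory Submission
  imports Defs "HOL-Real_Asymp.Real_Asymp"
begin

text \<open>Fix a small noise level and a size k attaining the minimum.  The least favourable prior puts the
  active components on a uniformly random subset of fixed size of the k-subsets and gives each
  coordinate of an active component an independent random sign, with squares
  q = A max(0, D - c^2) solving the quadratic programme behind a_sq.  Averaging over the signs turns
  the likelihood ratio of a component into a product of terms
  exp (- t / 2) * cosh (sqrt t * x) with t = q / epsilon^2, which tends to 0 uniformly because L = log (d choose k)
  is much smaller than log (1 / epsilon); hence log moments of the ratio agree with those of a
  Gaussian shift of size a up to o(L).  Exponential tilting with parameter
  rho = 1 / (1 + sqrt (1 - beta)) yields one cut-off that some inactive component exceeds and
  some active component misses, each with probability bounded below, as soon as
  a < sqrt (2 L) (1 + sqrt (1 - beta)).  Swapping two such components does not decrease the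
  likelihood, so no selector recovers the active set with high probability.\<close>

section \<open>Moments of the symmetrised likelihood ratio\<close>


text \<open>Probabilities of size exp (- L) matter, so a central limit approximation of the
  log-likelihood ratio is too weak. Its power moments, however, multiply over coordinates, and their
  exponents add up to a multiple of T, the sum of t^2, which is 2 a^2 at the optimum. A cut-off in
  the middle of the law tilted by rho is exceeded under noise with probability about exp (- rho^2
  a^2 / 2), and missed by an active component with probability about exp (- (1 - rho)^2 a^2 / 2).
  With about exp L inactive and exp ((1 - beta) L) active components, both events occur somewhere if
  rho a < sqrt (2 L) and (1 - rho) a < sqrt (2 (1 - beta) L). The two conditions coincide when (1 -
  rho) / rho = sqrt (1 - beta); this is the origin of rho and of the threshold. The obstacle is that
  k may grow, so t must be small uniformly in k. A large t would be shared by the 2^k corners where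
  the profile peaks; this forces k = O (log L) and a support of at most exp (O (log^2 L)) points,
  too few to carry the energy when epsilon <= exp (- L).\<close>

lemma powr_second_order:
  fixes u \<eta> :: real
  assumes u: "0 < u" "u < 1" and \<eta>: "0 < \<eta>"
  obtains K where "0 \<le> K" "\<And>y. 0 \<le> y \<Longrightarrow>
    \<bar>y powr u - 1 - u * (y - 1) - u * (u - 1) / 2 * (y - 1)\<^sup>2\<bar> \<le> \<eta> * (y - 1)\<^sup>2 + K * (y - 1) ^ 4"
proof -
  let ?R = "\<lambda>y. y powr u - 1 - u * (y - 1) - u * (u - 1) / 2 * (y - 1)\<^sup>2"
  have "((\<lambda>y. ?R y / (y - 1)\<^sup>2) \<longlongrightarrow> 0) (at 1)"
  proof (rule filterlim_split_at)
    show "((\<lambda>y. ?R y / (y - 1)\<^sup>2) \<longlongrightarrow> 0) (at_left 1)" by real_asymp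
    show "((\<lambda>y. ?R y / (y - 1)\<^sup>2) \<longlongrightarrow> 0) (at_right 1)" by real_asymp
  qed
  then have "eventually (\<lambda>y. \<bar>?R y / (y - 1)\<^sup>2\<bar> < \<eta>) (at 1)"
    unfolding tendsto_iff dist_real_def using \<eta> by fastforce
  then obtain \<kappa> where \<kappa>: "0 < \<kappa>" "\<And>y. y \<noteq> 1 \<Longrightarrow> \<bar>y - 1\<bar> < \<kappa> \<Longrightarrow> \<bar>?R y / (y - 1)\<^sup>2\<bar> < \<eta>"
    unfolding eventually_at by (auto simp: dist_real_def)
  \<comment> \<open>Away from 1 the remainder is at most 3 + 2 z + z^2 with z = |y - 1|. Each
    summand is raised to degree 4 by powers of z / \<open>\<kappa>\<close> >= 1, which gives the
    three terms of \<open>K\<close>.\<close>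
  define K where "K = 3 / \<kappa> ^ 4 + 2 / \<kappa> ^ 3 + 1 / \<kappa>\<^sup>2"
  have K: "0 \<le> K" using \<kappa> by (simp add: K_def)
  have "\<bar>?R y\<bar> \<le> \<eta> * (y - 1)\<^sup>2 + K * (y - 1) ^ 4" if y: "0 \<le> y" for y
  proof (cases "\<bar>y - 1\<bar> < \<kappa>")
    case True
    have "\<bar>?R y\<bar> \<le> \<eta> * (y - 1)\<^sup>2"
    proof (cases "y = 1")
      case False
      then have "\<bar>?R y\<bar> / (y - 1)\<^sup>2 < \<eta>" using \<kappa>(2)[OF False True] by (simp add: abs_divide)
      then show ?thesis using False by (simp add: pos_divide_less_eq)
    qed simp
    moreover have "0 \<le> K * (y - 1) ^ 4" using K by simp
    ultimately show ?thesis by linarith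
  next
    case False
    define z where "z = \<bar>y - 1\<bar>"
    have z: "\<kappa> \<le> z" using False by (simp add: z_def)
    have yz: "y \<le> 1 + z" unfolding z_def by linarith
    have "y powr u \<le> (1 + y) powr 1"
    proof -
      have "y powr u \<le> (1 + y) powr u" using y u by (intro powr_mono2) auto
      also have "\<dots> \<le> (1 + y) powr 1" using y u by (intro powr_mono) auto
      finally show ?thesis .
    qed
    then have pu: "y powr u \<le> 2 + z" using y yz by simp
    have "\<bar>u * (y - 1)\<bar> \<le> z" using u by (simp add: abs_mult z_def mult_left_le_one_le)
    moreover have "\<bar>u * (u - 1) / 2 * (y - 1)\<^sup>2\<bar> \<le> z\<^sup>2"
    proof -
      have "\<bar>u * (u - 1) / 2\<bar> \<le> 1"
        using mult_mono[of u 1 "1 - u" 1] u by (simp add: abs_mult)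
      then have "\<bar>u * (u - 1) / 2\<bar> * (y - 1)\<^sup>2 \<le> 1 * (y - 1)\<^sup>2" by (intro mult_right_mono) auto
      then show ?thesis by (simp add: abs_mult z_def)
    qed
    ultimately have "\<bar>?R y\<bar> \<le> 3 + 2 * z + z\<^sup>2" using pu powr_ge_zero[of y u] by linarith
    also have "\<dots> \<le> 3 * (z / \<kappa>) ^ 4 + 2 * z * (z / \<kappa>) ^ 3 + z\<^sup>2 * (z / \<kappa>)\<^sup>2"
    proof -
      have 1: "1 \<le> z / \<kappa>" using z \<kappa> by simp
      have "1 \<le> (z / \<kappa>) ^ n" for n using one_le_power[OF 1] .
      note this[of 4] this[of 3] this[of 2]
      then show ?thesis using z \<kappa>
        by (intro add_mono) (auto intro!: mult_left_mono[of 1, simplified])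
    qed
    also have "\<dots> = K * z ^ 4" using \<kappa> by (simp add: K_def field_simps power2_eq_square power3_eq_cube power4_eq_xxxx)
    also have "\<dots> \<le> \<eta> * (y - 1)\<^sup>2 + K * (y - 1) ^ 4" using \<eta> by (simp add: z_def)
    finally show ?thesis .
  qed
  then show thesis using K that by blast
qed

abbreviation std_normal :: "real measure" where
  "std_normal \<equiv> density lborel std_normal_density"

text \<open>Likelihood ratio of the equal mixture of N(sqrt t, 1) and N(-sqrt t, 1) against N(0, 1).\<close>
definition cosh_lr :: "real \<Rightarrow> real \<Rightarrow> real" where
  "cosh_lr t x = exp (- t / 2) * cosh (sqrt t * x)"

lemma cosh_lr_pos: "0 < cosh_lr t x"
  by (simp add: cosh_lr_def cosh_real_pos)

lemma cosh_lr_0 [simp]: "cosh_lr 0 x = 1"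
  by (simp add: cosh_lr_def)

lemma measurable_cosh_lr [measurable]: "cosh_lr t \<in> borel_measurable borel"
  unfolding cosh_lr_def cosh_def by measurable

interpretation std_normal: prob_space std_normal
  by (rule prob_space_normal_density) simp

lemma has_bochner_integral_exp_std_normal:
  "has_bochner_integral std_normal (\<lambda>x. exp (a * x)) (exp (a\<^sup>2 / 2))"
proof -
  have "has_bochner_integral lborel (\<lambda>x. exp (a\<^sup>2 / 2) * normal_density a 1 x) (exp (a\<^sup>2 / 2) * 1)"
    by (intro has_bochner_integral_mult_right) (simp add: has_bochner_integral_iff)
  moreover have "exp (a\<^sup>2 / 2) * normal_density a 1 x = std_normal_density x * exp (a * x)" for x
    by (simp add: normal_density_def mult_exp_exp power2_eq_square field_simps)
  ultimately have "has_bochner_integral lborel (\<lambda>x. std_normal_density x * exp (a * x)) (exp (a\<^sup>2 / 2))"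
    by simp
  then show ?thesis
    by (intro has_bochner_integral_density) auto
qed

lemma has_bochner_integral_cosh_std_normal:
  "has_bochner_integral std_normal (\<lambda>x. cosh (a * x)) (exp (a\<^sup>2 / 2))"
proof -
  have "has_bochner_integral std_normal (\<lambda>x. (exp (a * x) + exp (- a * x)) / 2) ((exp (a\<^sup>2 / 2) + exp ((- a)\<^sup>2 / 2)) / 2)"
    by (intro has_bochner_integral_divide_zero has_bochner_integral_add has_bochner_integral_exp_std_normal)
  then show ?thesis by (simp add: cosh_def)
qed

text \<open>Linearising the powers of cosh reduces every moment of \<open>cosh_lr\<close> to means
  of cosh (n sqrt t x), which are exp (n^2 t / 2).\<close>

lemma
  fixes x :: real
  shows cosh_square: "cosh x ^ 2 = (cosh (2 * x) + 1) / 2"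
  and cosh_cube: "cosh x ^ 3 = (cosh (3 * x) + 3 * cosh x) / 4"
  and cosh_fourth: "cosh x ^ 4 = (cosh (4 * x) + 4 * cosh (2 * x) + 3) / 8"
proof -
  have e: "exp (n * x) = exp x ^ n" "exp (- (n * x)) = 1 / exp x ^ n" for n :: nat
    by (auto simp: exp_of_nat_mult[symmetric] exp_minus inverse_eq_divide mult.commute)
  note e = e[of 2] e[of 3] e[of 4]
  show "cosh x ^ 2 = (cosh (2 * x) + 1) / 2" "cosh x ^ 3 = (cosh (3 * x) + 3 * cosh x) / 4"
    "cosh x ^ 4 = (cosh (4 * x) + 4 * cosh (2 * x) + 3) / 8"
    using e by (simp_all add: cosh_def exp_minus field_simps power2_eq_square power3_eq_cube power4_eq_xxxx)
qed

text \<open>To first order in t the ratio minus 1 is (t / 2) (x^2 - 1). Accordingly the variance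
  starts at t^2 / 2, and the opaque fourth central moment is of order t^4: its terms up to t^3
  cancel.\<close>

lemma has_bochner_integral_cosh_lr:
  assumes "0 \<le> t"
  shows "has_bochner_integral std_normal (cosh_lr t) 1"
    and "has_bochner_integral std_normal (\<lambda>x. (cosh_lr t x - 1)\<^sup>2) (cosh t - 1)"
    and "has_bochner_integral std_normal (\<lambda>x. (cosh_lr t x - 1) ^ 4)
      ((exp (6 * t) + 4 + 3 * exp (- 2 * t)) / 8 - (exp (3 * t) + 3 * exp (- t)) + 6 * cosh t - 3)"
proof -
  let ?C = "\<lambda>n x. cosh (n * sqrt t * x)"
  have C: "has_bochner_integral std_normal (?C n) (exp (n\<^sup>2 * t / 2))" for n
    using has_bochner_integral_cosh_std_normal[of "n * sqrt t"] assms by (simp add: power_mult_distrib)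
  have one: "has_bochner_integral std_normal (\<lambda>x. c) c" for c :: real
    using C[of 0] has_bochner_integral_mult_right[OF C[of 0], of c] by simp
  have sq: "cosh_lr t x ^ 2 = exp (- t) * ((?C 2 x + 1) / 2)" for x
    by (simp add: cosh_lr_def power_mult_distrib cosh_square mult.assoc flip: exp_of_nat_mult)
  have cu: "cosh_lr t x ^ 3 = exp (- 3 * t / 2) * ((?C 3 x + 3 * ?C 1 x) / 4)" for x
    by (simp add: cosh_lr_def power_mult_distrib cosh_cube mult.assoc flip: exp_of_nat_mult)
  have fo: "cosh_lr t x ^ 4 = exp (- 2 * t) * ((?C 4 x + 4 * ?C 2 x + 3) / 8)" for x
    by (simp add: cosh_lr_def power_mult_distrib cosh_fourth mult.assoc flip: exp_of_nat_mult)
  have "has_bochner_integral std_normal (\<lambda>x. exp (- t / 2) * ?C 1 x) (exp (- t / 2) * exp (1\<^sup>2 * t / 2))"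
    by (intro has_bochner_integral_mult_right C)
  then show 1: "has_bochner_integral std_normal (cosh_lr t) 1"
    by (simp add: cosh_lr_def[abs_def] mult_exp_exp)
  have 2: "has_bochner_integral std_normal (\<lambda>x. cosh_lr t x ^ 2) (cosh t)"
  proof -
    have "has_bochner_integral std_normal (\<lambda>x. cosh_lr t x ^ 2) (exp (- t) * ((exp (2\<^sup>2 * t / 2) + 1) / 2))"
      unfolding sq by (intro has_bochner_integral_mult_right has_bochner_integral_add has_bochner_integral_divide_zero C one)
    then show ?thesis by (simp add: cosh_def field_simps mult_exp_exp)
  qed
  have 3: "has_bochner_integral std_normal (\<lambda>x. cosh_lr t x ^ 3) ((exp (3 * t) + 3 * exp (- t)) / 4)"
  proof -
    have "has_bochner_integral std_normal (\<lambda>x. cosh_lr t x ^ 3) (exp (- 3 * t / 2) * ((exp (3\<^sup>2 * t / 2) + 3 * exp (1\<^sup>2 * t / 2)) / 4))"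
      unfolding cu by (intro has_bochner_integral_mult_right has_bochner_integral_add has_bochner_integral_divide_zero C one)
    then show ?thesis by (simp add: field_simps mult_exp_exp)
  qed
  have 4: "has_bochner_integral std_normal (\<lambda>x. cosh_lr t x ^ 4) ((exp (6 * t) + 4 + 3 * exp (- 2 * t)) / 8)"
  proof -
    have "has_bochner_integral std_normal (\<lambda>x. cosh_lr t x ^ 4) (exp (- 2 * t) * ((exp (4\<^sup>2 * t / 2) + 4 * exp (2\<^sup>2 * t / 2) + 3) / 8))"
      unfolding fo by (intro has_bochner_integral_mult_right has_bochner_integral_add has_bochner_integral_divide_zero C one)
    then show ?thesis by (simp add: field_simps mult_exp_exp)
  qed
  have "has_bochner_integral std_normal (\<lambda>x. cosh_lr t x ^ 2 - 2 * cosh_lr t x + 1) (cosh t - 2 * 1 + 1)"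
    by (intro has_bochner_integral_mult_right has_bochner_integral_add has_bochner_integral_diff 1 2 one)
  then show "has_bochner_integral std_normal (\<lambda>x. (cosh_lr t x - 1)\<^sup>2) (cosh t - 1)"
    by (simp add: power2_eq_square algebra_simps)
  have *: "has_bochner_integral std_normal (\<lambda>x. cosh_lr t x ^ 4 - 4 * cosh_lr t x ^ 3 + 6 * cosh_lr t x ^ 2 - 4 * cosh_lr t x + 1)
     ((exp (6 * t) + 4 + 3 * exp (- 2 * t)) / 8 - 4 * ((exp (3 * t) + 3 * exp (- t)) / 4) + 6 * cosh t - 4 * 1 + 1)"
    by (intro has_bochner_integral_mult_right has_bochner_integral_add has_bochner_integral_diff 1 2 3 4 one)
  have fourth: "(y - 1) ^ 4 = y ^ 4 - 4 * y ^ 3 + 6 * y ^ 2 - 4 * y + 1" for y :: real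
    by (simp add: power2_eq_square power3_eq_cube power4_eq_xxxx algebra_simps)
  have val: "(exp (6 * t) + 4 + 3 * exp (- 2 * t)) / 8 - (exp (3 * t) + 3 * exp (- t)) + 6 * cosh t - 3
    = (exp (6 * t) + 4 + 3 * exp (- 2 * t)) / 8 - 4 * ((exp (3 * t) + 3 * exp (- t)) / 4) + 6 * cosh t - 4 * 1 + 1"
    by (simp add: add_divide_distrib)
  show "has_bochner_integral std_normal (\<lambda>x. (cosh_lr t x - 1) ^ 4)
      ((exp (6 * t) + 4 + 3 * exp (- 2 * t)) / 8 - (exp (3 * t) + 3 * exp (- t)) + 6 * cosh t - 3)"
    unfolding fourth val by (rule *)
qed

lemma integrable_cosh_lr_powr:
  assumes "0 \<le> t" "0 < u" "u < 1"
  shows "integrable std_normal (\<lambda>x. cosh_lr t x powr u)"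
proof (rule Bochner_Integration.integrable_bound[where f = "\<lambda>x. 1 + cosh_lr t x"])
  show "integrable std_normal (\<lambda>x. 1 + cosh_lr t x)"
    using has_bochner_integral_cosh_lr(1)[OF assms(1)] by (simp add: has_bochner_integral_iff)
  have "y powr u \<le> 1 + y" if "0 \<le> y" for y :: real
  proof -
    have "y powr u \<le> (1 + y) powr u" using that assms by (intro powr_mono2) auto
    also have "\<dots> \<le> (1 + y) powr 1" using that assms by (intro powr_mono) auto
    finally show ?thesis using that by simp
  qed
  then show "AE x in std_normal. norm (cosh_lr t x powr u) \<le> norm (1 + cosh_lr t x)"
    using cosh_lr_pos[of t] by (intro AE_I2) (simp add: less_imp_le add_nonneg_nonneg)
qed simp

text \<open>Since the ratio has mean 1, the linear term of the expansion at 1 vanishes, and the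
  variance cosh t - 1 ~ t^2 / 2 yields the coefficient u (u - 1) / 4. The quartic remainder
  contributes O (t^4), which is negligible however large its constant is. The result is the u-th
  moment of the likelihood ratio of a Gaussian shift with squared size t^2 / 2.\<close>

lemma cosh_lr_powr_expectation:
  fixes u \<eta> :: real
  assumes u: "0 < u" "u < 1" and \<eta>: "0 < \<eta>"
  shows "eventually (\<lambda>t. exp ((u * (u - 1) / 4 - \<eta>) * t\<^sup>2) \<le> (\<integral>x. cosh_lr t x powr u \<partial>std_normal) \<and>
     (\<integral>x. cosh_lr t x powr u \<partial>std_normal) \<le> exp ((u * (u - 1) / 4 + \<eta>) * t\<^sup>2)) (at_right 0)"
proof -
  define v where "v = u * (u - 1) / 4"
  obtain K where K: "0 \<le> K" "\<And>y. 0 \<le> y \<Longrightarrow>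
    \<bar>y powr u - 1 - u * (y - 1) - u * (u - 1) / 2 * (y - 1)\<^sup>2\<bar> \<le> \<eta>/4 * (y - 1)\<^sup>2 + K * (y - 1) ^ 4"
    using powr_second_order[OF u, of "\<eta>/4"] \<eta> by auto
  define m2 where "m2 = (\<lambda>t::real. cosh t - 1)"
  define m4 where "m4 = (\<lambda>t::real. (exp (6 * t) + 4 + 3 * exp (- 2 * t)) / 8 - (exp (3 * t) + 3 * exp (- t)) + 6 * cosh t - 3)"
  have bound: "\<bar>(\<integral>x. cosh_lr t x powr u \<partial>std_normal) - 1 - 2 * v * m2 t\<bar> \<le> \<eta>/4 * m2 t + K * m4 t" if t: "0 < t" for t
  proof -
    note H0 = has_bochner_integral_cosh_lr[OF less_imp_le[OF t]]
    have H: "has_bochner_integral std_normal (\<lambda>x. cosh_lr t x) 1"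
      "has_bochner_integral std_normal (\<lambda>x. (cosh_lr t x - 1)\<^sup>2) (m2 t)"
      "has_bochner_integral std_normal (\<lambda>x. (cosh_lr t x - 1) ^ 4) (m4 t)"
      unfolding m2_def m4_def by (fact H0)+
    let ?L = "cosh_lr t"
    have pw: "has_bochner_integral std_normal (\<lambda>x. ?L x powr u) (\<integral>x. ?L x powr u \<partial>std_normal)"
      using integrable_cosh_lr_powr[of t u] t u by (simp add: has_bochner_integral_iff)
    have one: "has_bochner_integral std_normal (\<lambda>x. 1) (1::real)"
      by (simp add: has_bochner_integral_iff std_normal.prob_space[simplified])
    have "has_bochner_integral std_normal (\<lambda>x. ?L x powr u - 1 - u * (?L x - 1) - u * (u - 1) / 2 * (?L x - 1)\<^sup>2)
       ((\<integral>x. ?L x powr u \<partial>std_normal) - 1 - u * (1 - 1) - u * (u - 1) / 2 * m2 t)"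
      by (intro has_bochner_integral_mult_right has_bochner_integral_diff pw one H(1,2))
    then have R: "has_bochner_integral std_normal (\<lambda>x. ?L x powr u - 1 - u * (?L x - 1) - u * (u - 1) / 2 * (?L x - 1)\<^sup>2)
       ((\<integral>x. ?L x powr u \<partial>std_normal) - 1 - 2 * v * m2 t)" (is "has_bochner_integral _ ?R ?r") by (simp add: v_def)
    have B: "has_bochner_integral std_normal (\<lambda>x. \<eta>/4 * (?L x - 1)\<^sup>2 + K * (?L x - 1) ^ 4) (\<eta>/4 * m2 t + K * m4 t)"
      by (intro has_bochner_integral_mult_right has_bochner_integral_add H(2,3))
    have "\<bar>?r\<bar> = \<bar>integral\<^sup>L std_normal ?R\<bar>" using R by (simp add: has_bochner_integral_iff)
    also have "\<dots> \<le> (\<integral>x. \<bar>?R x\<bar> \<partial>std_normal)" by (rule integral_abs_bound)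
    also have "\<dots> \<le> (\<integral>x. \<eta>/4 * (?L x - 1)\<^sup>2 + K * (?L x - 1) ^ 4 \<partial>std_normal)"
      using R B K(2)[OF less_imp_le[OF cosh_lr_pos]]
      by (intro integral_mono) (auto simp: has_bochner_integral_iff)
    also have "\<dots> = \<eta>/4 * m2 t + K * m4 t" using B by (simp add: has_bochner_integral_iff)
    finally show ?thesis .
  qed
  have "((\<lambda>t. (2 * v * m2 t + \<eta>/4 * m2 t + K * m4 t) / t\<^sup>2) \<longlongrightarrow> v + \<eta>/8) (at_right 0)"
    unfolding m2_def m4_def cosh_field_def by (real_asymp simp: field_simps)
  then have up: "eventually (\<lambda>t. (2 * v * m2 t + \<eta>/4 * m2 t + K * m4 t) / t\<^sup>2 < v + \<eta>) (at_right 0)"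
    using \<eta> by (intro order_tendstoD(2)) auto
  have "((\<lambda>t. (2 * v * m2 t - \<eta>/4 * m2 t - K * m4 t) / t\<^sup>2) \<longlongrightarrow> v - \<eta>/8) (at_right 0)"
    unfolding m2_def m4_def cosh_field_def by (real_asymp simp: field_simps)
  then have lo: "eventually (\<lambda>t. (2 * v * m2 t - \<eta>/4 * m2 t - K * m4 t) / t\<^sup>2 > v - \<eta>/2) (at_right 0)"
    using \<eta> by (intro order_tendstoD(1)) auto
  \<comment> \<open>exp lies above its tangent, so the lower bound aims only at
    \<open>v - \<eta>\<close>: the gap to \<open>v - \<eta>/2\<close> pays for the higher terms of
    exp, the gap from there to \<open>v - \<eta>/8\<close> for the remainder.\<close>
  have "((\<lambda>t. (exp ((v - \<eta>) * t\<^sup>2) - 1) / t\<^sup>2) \<longlongrightarrow> v - \<eta>) (at_right 0)"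
    by real_asymp
  then have ex: "eventually (\<lambda>t. (exp ((v - \<eta>) * t\<^sup>2) - 1) / t\<^sup>2 < v - \<eta>/2) (at_right 0)"
    using \<eta> by (intro order_tendstoD(2)) auto
  show ?thesis unfolding v_def[symmetric]
    using up lo ex eventually_at_right_less[of 0]
  proof eventually_elim
    case (elim t)
    have t2: "0 < t\<^sup>2" using elim by simp
    have "(\<integral>x. cosh_lr t x powr u \<partial>std_normal) \<le> 1 + (v + \<eta>) * t\<^sup>2"
      using bound[of t] elim t2 by (simp add: pos_divide_less_eq)
    also have "\<dots> \<le> exp ((v + \<eta>) * t\<^sup>2)" by (rule exp_ge_add_one_self)
    finally have 1: "(\<integral>x. cosh_lr t x powr u \<partial>std_normal) \<le> exp ((v + \<eta>) * t\<^sup>2)" .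
    have "exp ((v - \<eta>) * t\<^sup>2) \<le> 1 + (v - \<eta>/2) * t\<^sup>2"
      using elim t2 by (simp add: pos_divide_less_eq)
    also have "\<dots> \<le> (\<integral>x. cosh_lr t x powr u \<partial>std_normal)"
      using bound[of t] elim t2 by (simp add: pos_less_divide_eq)
    finally show ?case using 1 by simp
  qed
qed

section \<open>Tilting and the median cut-off\<close>


lemma (in prob_space) expectation_of_bool:
  "expectation (\<lambda>x. of_bool (P x)) = prob {x \<in> space M. P x}"
proof -
  have "expectation (\<lambda>x. of_bool (P x)) = expectation (\<lambda>x. indicator {x \<in> space M. P x} x)"
    by (intro Bochner_Integration.integral_cong) (auto split: split_indicator)
  also have "\<dots> = prob ({x \<in> space M. P x} \<inter> space M)"
    by (rule Bochner_Integration.integral_indicator)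
  also have "{x \<in> space M. P x} \<inter> space M = {x \<in> space M. P x}" by auto
  finally show ?thesis .
qed

text \<open>Both inequalities are closed because the median may carry an atom. With h the lower
  1/2-quantile, right continuity of the cdf gives the first and its left limit at h the
  second.\<close>

lemma (in prob_space) median_exists:
  fixes X :: "'a \<Rightarrow> real"
  assumes X [measurable]: "random_variable borel X"
  obtains h where "1 / 2 \<le> prob {x \<in> space M. X x \<le> h}" "1 / 2 \<le> prob {x \<in> space M. h \<le> X x}"
proof -
  interpret D: real_distribution "distr M borel X" by (rule real_distribution_distr) fact
  let ?F = "cdf (distr M borel X)"
  have "eventually (\<lambda>x. 1 / 2 < ?F x) at_top"
    using D.cdf_lim_at_top_prob by (rule order_tendstoD) simp
  then obtain b where b: "1 / 2 < ?F b" by (auto simp: eventually_at_top_linorder)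
  have "eventually (\<lambda>x. ?F x < 1 / 2) at_bot"
    using D.cdf_lim_at_bot by (rule order_tendstoD) simp
  then obtain a where a: "\<And>x. x \<le> a \<Longrightarrow> ?F x < 1 / 2" by (auto simp: eventually_at_bot_linorder)
  define h where "h = Inf {x. 1 / 2 \<le> ?F x}"
  have bdd: "bdd_below {x. 1 / 2 \<le> ?F x}"
    using a by (intro bdd_belowI[of _ a]) (metis linorder_not_less mem_Collect_eq nle_le)
  have low: "?F x < 1 / 2" if "x < h" for x
    using that cInf_lower[OF _ bdd, of x] unfolding h_def by fastforce
  have high: "1 / 2 \<le> ?F x" if "h < x" for x
  proof -
    have "\<exists>y\<in>{x. 1 / 2 \<le> ?F x}. y < x"
      using that less_imp_le[OF b] unfolding h_def by (intro cInf_lessD) auto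
    then obtain y where "y < x" "1 / 2 \<le> ?F y" by auto
    then show ?thesis using D.cdf_nondecreasing[of y x] by simp
  qed
  have "1 / 2 \<le> ?F h"
  proof (rule tendsto_lowerbound)
    show "(?F \<longlongrightarrow> ?F h) (at_right h)" using D.cdf_is_right_cont[of h] by (simp add: continuous_within)
    show "eventually (\<lambda>x. 1 / 2 \<le> ?F x) (at_right h)"
      using high by (auto simp: eventually_at_filter)
  qed simp
  also have "?F h = prob {x \<in> space M. X x \<le> h}"
    by (simp add: cdf_def measure_distr) (auto intro!: arg_cong[where f = prob])
  finally have 1: "1 / 2 \<le> prob {x \<in> space M. X x \<le> h}" .
  have "measure (distr M borel X) {..<h} \<le> 1 / 2"
  proof (rule tendsto_upperbound)
    show "(?F \<longlongrightarrow> measure (distr M borel X) {..<h}) (at_left h)" by (rule D.cdf_at_left)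
    show "eventually (\<lambda>x. ?F x \<le> 1 / 2) (at_left h)"
      using low by (auto simp: eventually_at_filter less_imp_le)
  qed simp
  also have "measure (distr M borel X) {..<h} = prob {x \<in> space M. X x < h}"
    by (simp add: measure_distr) (auto intro!: arg_cong[where f = prob])
  also have "\<dots> = 1 - prob {x \<in> space M. h \<le> X x}"
    by (subst prob_compl[symmetric]) (auto intro!: arg_cong[where f = prob])
  finally show thesis using 1 by (intro that[of h]) auto
qed

text \<open>The cut-off h is a median of the likelihood ratio L under the tilted law with density
  proportional to L powr rho; that law is then compared with P and with the law of density L.\<close>
lemma (in prob_space) tilted_median:
  fixes L :: "'a \<Rightarrow> real" and \<rho> s T :: real
  assumes L [measurable]: "random_variable borel L" and pos: "\<And>x. 0 < L x"
    and s: "0 < s" "s < \<rho>" "\<rho> + s < 1" and T: "0 \<le> T"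
    and int: "\<And>u. u \<in> {\<rho> - s, \<rho>, \<rho> + s} \<Longrightarrow> integrable M (\<lambda>x. L x powr u)"
    and low: "exp ((\<rho> * (\<rho> - 1) / 4 - s\<^sup>2) * T) \<le> expectation (\<lambda>x. L x powr \<rho>)"
    and up: "\<And>u. u \<in> {\<rho> - s, \<rho> + s} \<Longrightarrow> expectation (\<lambda>x. L x powr u) \<le> exp ((u * (u - 1) / 4 + s\<^sup>2) * T)"
  obtains h where
    "exp (- (\<rho>\<^sup>2 * T / 4) - 4 * s * T - 2 / s) / 4 \<le> prob {x \<in> space M. h \<le> L x}"
    "exp (- ((1 - \<rho>)\<^sup>2 * T / 4) - 4 * s * T - 2 / s) / 4 \<le> expectation (\<lambda>x. L x * of_bool (L x \<le> h))"
proof -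
  define Z where "Z = expectation (\<lambda>x. L x powr \<rho>)"
  have intl: "integrable M (\<lambda>x. L x powr \<rho>)" using int by simp
  have Z: "0 < Z" using low exp_gt_zero unfolding Z_def by (rule less_le_trans[rotated])
  define Q where "Q = density M (\<lambda>x. ennreal (L x powr \<rho> / Z))"
  have pQ: "prob_space Q"
  proof
    have "emeasure Q (space Q) = (\<integral>\<^sup>+x. ennreal (L x powr \<rho> / Z) \<partial>M)"
      by (simp add: Q_def emeasure_density cong: nn_integral_cong)
    also have "\<dots> = ennreal (\<integral>x. L x powr \<rho> / Z \<partial>M)"
      using intl Z by (intro nn_integral_eq_integral) auto
    also have "(\<integral>x. L x powr \<rho> / Z \<partial>M) = 1" using Z by (simp add: Z_def)
    finally show "emeasure Q (space Q) = 1" by simp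
  qed
  interpret Q: prob_space Q by fact
  have ib: "integrable M (\<lambda>x. L x powr \<rho> * of_bool (P x))" if [measurable]: "Measurable.pred M P" for P
    by (rule Bochner_Integration.integrable_bound[OF intl]) auto
  have Qm: "Q.prob {x \<in> space M. P x} = expectation (\<lambda>x. L x powr \<rho> * of_bool (P x)) / Z"
    if [measurable]: "Measurable.pred M P" for P
  proof -
    have "emeasure Q {x \<in> space M. P x} = (\<integral>\<^sup>+x. ennreal (L x powr \<rho> * of_bool (P x) / Z) \<partial>M)"
      unfolding Q_def by (subst emeasure_density) (auto intro!: nn_integral_cong split: split_indicator)
    also have "\<dots> = ennreal (\<integral>x. L x powr \<rho> * of_bool (P x) / Z \<partial>M)"
      using Z by (intro nn_integral_eq_integral) (auto intro!: ib divide_nonneg_pos)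
    finally show ?thesis using Z
      by (simp add: Q.emeasure_eq_measure)
  qed
  obtain h where h: "1 / 2 \<le> Q.prob {x \<in> space Q. L x \<le> h}" "1 / 2 \<le> Q.prob {x \<in> space Q. h \<le> L x}"
    by (rule Q.median_exists[of L]) (auto simp: Q_def)
  have h1: "Z / 2 \<le> expectation (\<lambda>x. L x powr \<rho> * of_bool (L x \<le> h))"
    using h(1) Qm[of "\<lambda>x. L x \<le> h"] Z by (simp add: Q_def pos_le_divide_eq)
  have h2: "Z / 2 \<le> expectation (\<lambda>x. L x powr \<rho> * of_bool (h \<le> L x))"
    using h(2) Qm[of "\<lambda>x. h \<le> L x"] Z by (simp add: Q_def pos_le_divide_eq)
  \<comment> \<open>(2 \<open>\<rho>\<close> - 1) T / 4 is the derivative of u (u - 1) T / 4 at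
    \<open>\<rho>\<close>, that is, the centre of ln L under the tilted law. Around it, s T / 4 is
    the second-order term of a Chernoff bound with exponent s, 2 s T pays for the two moment errors
    s^2 T, and 2 / s produces a factor exp (- 2) <= 1 / 4. \<open>b\<close> is the mirror
    image.\<close>
  define a where "a = (2 * \<rho> - 1) * T / 4 + s * T / 4 + 2 * s * T + 2 / s"
  define b where "b = (2 * \<rho> - 1) * T / 4 - s * T / 4 - 2 * s * T - 2 / s"
  have ln4: "exp (- 2 :: real) \<le> 1 / 4"
  proof -
    have "(2::real) ^ 2 \<le> exp 1 ^ 2" using exp_ge_add_one_self[of 1] by (intro power_mono) auto
    also have "exp (1::real) ^ 2 = exp 2" by (simp flip: exp_of_nat_mult)
    finally show ?thesis by (simp add: exp_minus field_simps)
  qed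
  have small: "exp (x - 2) \<le> Z / 4" if "x \<le> (\<rho> * (\<rho> - 1) / 4 - s\<^sup>2) * T" for x
  proof -
    have "exp (x - 2) = exp x * exp (- 2)" by (simp add: mult_exp_exp)
    also have "\<dots> \<le> Z * (1 / 4)" using that low Z ln4 unfolding Z_def
      by (intro mult_mono) (auto intro: order_trans[rotated])
    finally show ?thesis by simp
  qed
  \<comment> \<open>Markov's inequality for L^s under the tilted law: at most a quarter of the
    tilted mass lies above exp a. As half of it lies above the median, a quarter is left in
    between.\<close>
  have Ta: "expectation (\<lambda>x. L x powr \<rho> * of_bool (exp a < L x)) \<le> Z / 4"
  proof -
    have "expectation (\<lambda>x. L x powr \<rho> * of_bool (exp a < L x)) \<le> expectation (\<lambda>x. exp (- s * a) * L x powr (\<rho> + s))"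
    proof (intro integral_mono ib)
      fix x
      have "L x powr \<rho> \<le> exp (- s * a) * L x powr (\<rho> + s)" if "exp a < L x"
      proof -
        have "exp a powr s \<le> L x powr s" using that s by (intro powr_mono2) auto
        then have "1 \<le> exp (- s * a) * L x powr s"
          using s by (simp add: powr_def exp_minus field_simps)
        then have "L x powr \<rho> * 1 \<le> L x powr \<rho> * (exp (- s * a) * L x powr s)"
          by (intro mult_left_mono) auto
        then show ?thesis by (simp add: powr_add mult_ac)
      qed
      then show "L x powr \<rho> * of_bool (exp a < L x) \<le> exp (- s * a) * L x powr (\<rho> + s)" by auto
    qed (use int in auto)
    also have "\<dots> \<le> exp (- s * a) * exp (((\<rho> + s) * ((\<rho> + s) - 1) / 4 + s\<^sup>2) * T)"
      using up[of "\<rho> + s"] by simp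
    also have "\<dots> = exp ((\<rho> * (\<rho> - 1) / 4 - s\<^sup>2) * T - 2)"
      using s by (simp add: mult_exp_exp a_def field_simps power2_eq_square)
    also have "\<dots> \<le> Z / 4" by (rule small) simp
    finally show ?thesis .
  qed
  have Tb: "expectation (\<lambda>x. L x powr \<rho> * of_bool (L x < exp b)) \<le> Z / 4"
  proof -
    have "expectation (\<lambda>x. L x powr \<rho> * of_bool (L x < exp b)) \<le> expectation (\<lambda>x. exp (s * b) * L x powr (\<rho> - s))"
    proof (intro integral_mono ib)
      fix x
      have "L x powr \<rho> \<le> exp (s * b) * L x powr (\<rho> - s)" if "L x < exp b"
      proof -
        have "L x powr s \<le> exp b powr s" using that s pos[of x] by (intro powr_mono2) auto
        then have "L x powr (\<rho> - s) * L x powr s \<le> L x powr (\<rho> - s) * exp (s * b)"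
          by (intro mult_left_mono) (auto simp: powr_def)
        then show ?thesis using pos[of x] by (simp add: mult_ac flip: powr_add)
      qed
      then show "L x powr \<rho> * of_bool (L x < exp b) \<le> exp (s * b) * L x powr (\<rho> - s)" by auto
    qed (use int in auto)
    also have "\<dots> \<le> exp (s * b) * exp (((\<rho> - s) * ((\<rho> - s) - 1) / 4 + s\<^sup>2) * T)"
      using up[of "\<rho> - s"] by simp
    also have "\<dots> = exp ((\<rho> * (\<rho> - 1) / 4 - s\<^sup>2) * T - 2)"
      using s by (simp add: mult_exp_exp b_def field_simps power2_eq_square)
    also have "\<dots> \<le> Z / 4" by (rule small) simp
    finally show ?thesis .
  qed
  have sl: "s\<^sup>2 * T \<le> s * T"
    using s T mult_right_mono[of "s * s" s T] mult_left_le[of s s] by (simp add: power2_eq_square)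
  have lT: "\<rho> * x \<le> x" "(1 - \<rho>) * x \<le> x" if "0 \<le> x" for x
    using that s mult_right_mono[of \<rho> 1 x] mult_right_mono[of "1 - \<rho>" 1 x] by auto
  have err: "0 \<le> s * T / 4 + 2 * s * T + 2 / s" using s T by simp
  \<comment> \<open>The mass between h and exp a is converted back to the original law at the price
    L^\<open>\<rho>\<close> <= exp (\<open>\<rho>\<close> a). The leading terms combine as -
    \<open>\<rho>\<close> (2 \<open>\<rho>\<close> - 1) + \<open>\<rho>\<close>
    (\<open>\<rho>\<close> - 1) = - \<open>\<rho>\<close>^2, over 4.\<close>
  have "exp (- (\<rho>\<^sup>2 * T / 4) - 4 * s * T - 2 / s) / 4 \<le> exp (- \<rho> * a) * (exp ((\<rho> * (\<rho> - 1) / 4 - s\<^sup>2) * T) / 4)"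
  proof -
    have "- \<rho> * a + (\<rho> * (\<rho> - 1) / 4 - s\<^sup>2) * T = - (\<rho>\<^sup>2 * T / 4) - \<rho> * (s * T / 4 + 2 * s * T + 2 / s) - s\<^sup>2 * T"
      by (simp add: a_def field_simps power2_eq_square)
    also have "\<dots> \<ge> - (\<rho>\<^sup>2 * T / 4) - 4 * s * T - 2 / s"
      using lT(1)[OF err] sl T s mult_nonneg_nonneg[of s T] by linarith
    finally show ?thesis by (simp add: mult_exp_exp)
  qed
  also have "\<dots> \<le> exp (- \<rho> * a) * (Z / 4)" using low unfolding Z_def by (intro mult_left_mono) auto
  also have "\<dots> \<le> exp (- \<rho> * a) * expectation (\<lambda>x. L x powr \<rho> * of_bool (h \<le> L x) - L x powr \<rho> * of_bool (exp a < L x))"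
    using h2 Ta by (subst Bochner_Integration.integral_diff) (auto intro!: ib)
  also have "\<dots> = expectation (\<lambda>x. exp (- \<rho> * a) * (L x powr \<rho> * of_bool (h \<le> L x) - L x powr \<rho> * of_bool (exp a < L x)))"
    by simp
  also have "\<dots> \<le> expectation (\<lambda>x. of_bool (h \<le> L x))"
  proof (intro integral_mono)
    fix x
    have "exp (- \<rho> * a) * L x powr \<rho> \<le> 1" if "L x \<le> exp a"
    proof -
      have "L x powr \<rho> \<le> exp a powr \<rho>" using that s pos[of x] by (intro powr_mono2) auto
      then show ?thesis by (simp add: powr_def exp_minus field_simps)
    qed
    then show "exp (- \<rho> * a) * (L x powr \<rho> * of_bool (h \<le> L x) - L x powr \<rho> * of_bool (exp a < L x)) \<le> of_bool (h \<le> L x)"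
      by (cases "exp a < L x") (auto simp: not_less)
  next
    show "integrable M (\<lambda>x. of_bool (h \<le> L x) :: real)"
      by (rule integrable_const_bound[where B = 1]) auto
  qed (auto intro!: ib)
  also have "\<dots> = prob {x \<in> space M. h \<le> L x}"
    by (rule expectation_of_bool)
  finally have 1: "exp (- (\<rho>\<^sup>2 * T / 4) - 4 * s * T - 2 / s) / 4 \<le> prob {x \<in> space M. h \<le> L x}" .
  \<comment> \<open>The same on the other side of h: where exp b <= L, the law of density L
    dominates exp ((1 - \<open>\<rho>\<close>) b) times the density L^\<open>\<rho>\<close>, and the
    leading terms combine to - (1 - \<open>\<rho>\<close>)^2 / 4.\<close>
  have "exp (- ((1 - \<rho>)\<^sup>2 * T / 4) - 4 * s * T - 2 / s) / 4 \<le> exp ((1 - \<rho>) * b) * (exp ((\<rho> * (\<rho> - 1) / 4 - s\<^sup>2) * T) / 4)"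
  proof -
    have "(1 - \<rho>) * b + (\<rho> * (\<rho> - 1) / 4 - s\<^sup>2) * T = - ((1 - \<rho>)\<^sup>2 * T / 4) - (1 - \<rho>) * (s * T / 4 + 2 * s * T + 2 / s) - s\<^sup>2 * T"
      by (simp add: b_def field_simps power2_eq_square)
    also have "\<dots> \<ge> - ((1 - \<rho>)\<^sup>2 * T / 4) - 4 * s * T - 2 / s"
      using lT(2)[OF err] sl T s mult_nonneg_nonneg[of s T] by linarith
    finally show ?thesis by (simp add: mult_exp_exp)
  qed
  also have "\<dots> \<le> exp ((1 - \<rho>) * b) * (Z / 4)" using low unfolding Z_def by (intro mult_left_mono) auto
  also have "\<dots> \<le> exp ((1 - \<rho>) * b) * expectation (\<lambda>x. L x powr \<rho> * of_bool (L x \<le> h) - L x powr \<rho> * of_bool (L x < exp b))"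
    using h1 Tb by (subst Bochner_Integration.integral_diff) (auto intro!: ib)
  also have "\<dots> = expectation (\<lambda>x. exp ((1 - \<rho>) * b) * (L x powr \<rho> * of_bool (L x \<le> h) - L x powr \<rho> * of_bool (L x < exp b)))"
    by simp
  also have "\<dots> \<le> expectation (\<lambda>x. L x * of_bool (L x \<le> h))"
  proof (intro integral_mono)
    fix x
    have "exp ((1 - \<rho>) * b) * L x powr \<rho> \<le> L x" if "exp b \<le> L x"
    proof -
      have "exp b powr (1 - \<rho>) \<le> L x powr (1 - \<rho>)" using that s by (intro powr_mono2) auto
      then have "exp ((1 - \<rho>) * b) * L x powr \<rho> \<le> L x powr (1 - \<rho>) * L x powr \<rho>"
        by (intro mult_right_mono) (auto simp: powr_def)
      also have "\<dots> = L x" using pos[of x] by (simp flip: powr_add)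
      finally show ?thesis .
    qed
    then show "exp ((1 - \<rho>) * b) * (L x powr \<rho> * of_bool (L x \<le> h) - L x powr \<rho> * of_bool (L x < exp b)) \<le> L x * of_bool (L x \<le> h)"
      using pos[of x] by (cases "L x < exp b") (auto simp: not_less)
  next
    show "integrable M (\<lambda>x. L x * of_bool (L x \<le> h))"
      using pos by (intro integrable_const_bound[where B = "\<bar>h\<bar>"]) (auto simp: less_imp_le intro: order_trans[OF _ abs_ge_self])
  qed (auto intro!: ib)
  finally show thesis using 1 that by blast
qed

text \<open>Power moments of a product over independent coordinates are products, so the
  one-coordinate bounds add up in the exponent. The threshold \<open>t0\<close> depends on
  \<open>\<rho>\<close> and \<open>s\<close> alone, not on how many coordinates there are; this
  uniformity is what allows k and the support to grow.\<close>

lemma prod_cosh_lr_cutoff: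
  fixes \<rho> s :: real
  assumes s: "0 < s" "s < \<rho>" "\<rho> + s < 1"
  obtains t0 where "0 < t0"
    "\<And>F :: 'i set. \<And>t. finite F \<Longrightarrow> (\<And>l. l \<in> F \<Longrightarrow> 0 \<le> t l \<and> t l < t0) \<Longrightarrow> \<exists>h.
       exp (- (\<rho>\<^sup>2 * (\<Sum>l\<in>F. (t l)\<^sup>2) / 4) - 4 * s * (\<Sum>l\<in>F. (t l)\<^sup>2) - 2 / s) / 4
         \<le> measure (PiM F (\<lambda>_. std_normal)) {y \<in> space (PiM F (\<lambda>_. std_normal)). h \<le> (\<Prod>l\<in>F. cosh_lr (t l) (y l))} \<and>
       exp (- ((1 - \<rho>)\<^sup>2 * (\<Sum>l\<in>F. (t l)\<^sup>2) / 4) - 4 * s * (\<Sum>l\<in>F. (t l)\<^sup>2) - 2 / s) / 4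
         \<le> (\<integral>y. (\<Prod>l\<in>F. cosh_lr (t l) (y l)) * of_bool ((\<Prod>l\<in>F. cosh_lr (t l) (y l)) \<le> h) \<partial>PiM F (\<lambda>_. std_normal))"
proof -
  let ?E = "\<lambda>u t. (\<integral>x. cosh_lr t x powr u \<partial>std_normal)"
  let ?G = "\<lambda>u t. exp ((u * (u - 1) / 4 - s\<^sup>2) * t\<^sup>2) \<le> ?E u t \<and> ?E u t \<le> exp ((u * (u - 1) / 4 + s\<^sup>2) * t\<^sup>2)"
  have "eventually (\<lambda>t. ?G (\<rho> - s) t \<and> ?G \<rho> t \<and> ?G (\<rho> + s) t) (at_right 0)"
    using s by (intro eventually_conj cosh_lr_powr_expectation) auto
  then obtain t0 where t0: "0 < t0" "\<And>t. 0 < t \<Longrightarrow> t < t0 \<Longrightarrow> ?G (\<rho> - s) t \<and> ?G \<rho> t \<and> ?G (\<rho> + s) t"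
    unfolding eventually_at_right_field by auto
  \<comment> \<open>The one-sided limit says nothing at t = 0, where the ratio is constantly
    1.\<close>
  have G: "?G u t" if "0 \<le> t" "t < t0" "u \<in> {\<rho> - s, \<rho>, \<rho> + s}" for u t
  proof (cases "t = 0")
    case True then show ?thesis by (simp add: std_normal.prob_space[simplified])
  next
    case False then show ?thesis using t0(2)[of t] that by auto
  qed
  show thesis
  proof (rule that[OF t0(1)])
    fix F :: "'i set" and t assume F: "finite F" and t: "\<And>l. l \<in> F \<Longrightarrow> 0 \<le> t l \<and> t l < t0"
    interpret product_prob_space "\<lambda>_. std_normal" F by unfold_locales
    interpret P: prob_space "PiM F (\<lambda>_. std_normal)" by (rule prob_space_PiM) (rule std_normal.prob_space_axioms)
    let ?L = "\<lambda>y. \<Prod>l\<in>F. cosh_lr (t l) (y l)"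
    have pw: "?L y powr u = (\<Prod>l\<in>F. cosh_lr (t l) (y l) powr u)" for y u
      by (simp add: prod_powr_distrib cosh_lr_pos less_imp_le)
    have int: "integrable (PiM F (\<lambda>_. std_normal)) (\<lambda>y. ?L y powr u)" if "u \<in> {\<rho> - s, \<rho>, \<rho> + s}" for u
      unfolding pw using that s t by (intro product_integrable_prod F integrable_cosh_lr_powr) auto
    have E: "P.expectation (\<lambda>y. ?L y powr u) = (\<Prod>l\<in>F. ?E u (t l))" if "u \<in> {\<rho> - s, \<rho>, \<rho> + s}" for u
      unfolding pw using that s t by (intro product_integral_prod F integrable_cosh_lr_powr) auto
    have ex: "exp (c * (\<Sum>l\<in>F. (t l)\<^sup>2)) = (\<Prod>l\<in>F. exp (c * (t l)\<^sup>2))" for c :: real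
      using F by (simp add: sum_distrib_left exp_sum)
    show "\<exists>h. exp (- (\<rho>\<^sup>2 * (\<Sum>l\<in>F. (t l)\<^sup>2) / 4) - 4 * s * (\<Sum>l\<in>F. (t l)\<^sup>2) - 2 / s) / 4
         \<le> P.prob {y \<in> space (PiM F (\<lambda>_. std_normal)). h \<le> ?L y} \<and>
       exp (- ((1 - \<rho>)\<^sup>2 * (\<Sum>l\<in>F. (t l)\<^sup>2) / 4) - 4 * s * (\<Sum>l\<in>F. (t l)\<^sup>2) - 2 / s) / 4
         \<le> P.expectation (\<lambda>y. ?L y * of_bool (?L y \<le> h))"
    proof (rule P.tilted_median[of ?L s \<rho> "\<Sum>l\<in>F. (t l)\<^sup>2"])
      show "?L \<in> borel_measurable (PiM F (\<lambda>_. std_normal))" using F by measurable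
      show "exp ((\<rho> * (\<rho> - 1) / 4 - s\<^sup>2) * (\<Sum>l\<in>F. (t l)\<^sup>2)) \<le> P.expectation (\<lambda>y. ?L y powr \<rho>)"
        using G t by (simp only: E ex insert_iff simp_thms) (intro prod_mono, auto)
      show "P.expectation (\<lambda>y. ?L y powr u) \<le> exp ((u * (u - 1) / 4 + s\<^sup>2) * (\<Sum>l\<in>F. (t l)\<^sup>2))"
        if "u \<in> {\<rho> - s, \<rho> + s}" for u
        using G[of _ u] t that by (subst E, force, subst ex, intro prod_mono) (auto intro: order_trans[OF less_imp_le[OF exp_gt_zero]])
    qed (use s int in \<open>auto intro!: prod_pos sum_nonneg simp: cosh_lr_pos\<close>)
  qed
qed

section \<open>Exact recovery of a random subset\<close>


text \<open>For a fixed observation with estimate \<open>S'\<close>, the error sum contains the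
  weight of every support except possibly \<open>S'\<close> itself. If \<open>S'\<close> is
  swappable, the support obtained by exchanging i for j is a different one of at least the same
  weight, so the missing term costs at most a factor 2.\<close>

lemma error_sum_ge_half_swappable:
  fixes L :: "'u \<Rightarrow> real" and m :: nat
  assumes U: "finite U" and nonneg: "\<And>u. u \<in> U \<Longrightarrow> 0 \<le> L u"
  defines "\<S> \<equiv> {S. S \<subseteq> U \<and> card S = m}"
  shows "(\<Sum>S\<in>\<S>. of_bool ((\<exists>i\<in>S. L i \<le> h) \<and> (\<exists>j\<in>U - S. h \<le> L j)) * (\<Prod>u\<in>S. L u)) / 2
    \<le> (\<Sum>S\<in>\<S>. of_bool (S' \<noteq> S) * (\<Prod>u\<in>S. L u))"
proof -
  let ?p = "\<lambda>S. \<Prod>u\<in>S. L u"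
  let ?E = "\<lambda>S. (\<exists>i\<in>S. L i \<le> h) \<and> (\<exists>j\<in>U - S. h \<le> L j)"
  have fin: "finite \<S>" using U by (simp add: \<S>_def)
  have p0: "0 \<le> ?p S" if "S \<in> \<S>" for S using that nonneg by (intro prod_nonneg) (auto simp: \<S>_def)
  show ?thesis
  proof (cases "S' \<in> \<S>")
    case False
    then have "(\<Sum>S\<in>\<S>. of_bool (S' \<noteq> S) * ?p S) = (\<Sum>S\<in>\<S>. ?p S)" by (intro sum.cong) auto
    moreover have "(\<Sum>S\<in>\<S>. of_bool (?E S) * ?p S) \<le> (\<Sum>S\<in>\<S>. ?p S)" using p0 by (intro sum_mono) auto
    moreover have "0 \<le> (\<Sum>S\<in>\<S>. ?p S)" using p0 by (intro sum_nonneg) auto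
    ultimately show ?thesis by linarith
  next
    case True
    have l: "(\<Sum>S\<in>\<S>. of_bool (S' \<noteq> S) * ?p S) = (\<Sum>S\<in>\<S> - {S'}. ?p S)"
      using fin True by (subst sum.remove[of _ S']) (auto intro!: sum.cong)
    have "(\<Sum>S\<in>\<S>. of_bool (?E S) * ?p S) = of_bool (?E S') * ?p S' + (\<Sum>S\<in>\<S> - {S'}. of_bool (?E S) * ?p S)"
      using fin True by (rule sum.remove)
    also have "(\<Sum>S\<in>\<S> - {S'}. of_bool (?E S) * ?p S) \<le> (\<Sum>S\<in>\<S> - {S'}. ?p S)" using p0 by (intro sum_mono) auto
    also have "of_bool (?E S') * ?p S' \<le> (\<Sum>S\<in>\<S> - {S'}. ?p S)"
    proof (cases "?E S'")
      case False
      moreover have "0 \<le> (\<Sum>S\<in>\<S> - {S'}. ?p S)" using p0 by (intro sum_nonneg) auto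
      ultimately show ?thesis by (simp only: of_bool_eq mult_zero_left)
    next
      case E: True
      then obtain i j where ij: "i \<in> S'" "L i \<le> h" "j \<in> U" "j \<notin> S'" "h \<le> L j" by auto
      have S': "S' \<subseteq> U" "card S' = m" "finite S'" using True U by (auto simp: \<S>_def intro: finite_subset)
      let ?T = "insert j (S' - {i})"
      have T: "?T \<in> \<S>" using S' ij card_Suc_Diff1[of S' i] by (auto simp: \<S>_def simp del: card_Diff_insert)
      have "?p S' = L i * (\<Prod>u\<in>S' - {i}. L u)" using S' ij by (intro prod.remove) auto
      also have "\<dots> \<le> L j * (\<Prod>u\<in>S' - {i}. L u)"
        using ij S' nonneg by (intro mult_right_mono prod_nonneg) auto
      also have "\<dots> = ?p ?T" using S' ij by simp
      also have "\<dots> \<le> (\<Sum>S\<in>\<S> - {S'}. ?p S)"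
        using fin T ij p0 by (intro member_le_sum) auto
      finally show ?thesis using E by simp
    qed
    finally show ?thesis unfolding l by simp
  qed
qed

lemma power_one_minus_le_half:
  fixes x :: real
  assumes "0 \<le> x" "x \<le> 1" "1 \<le> x * real n"
  shows "(1 - x) ^ n \<le> 1 / 2"
proof -
  have "(1 - x) ^ n \<le> exp (- x) ^ n"
    using assms exp_ge_add_one_self[of "- x"] by (intro power_mono) auto
  also have "\<dots> = exp (- (x * real n))" by (simp add: exp_of_nat_mult[symmetric] mult.commute)
  also have "\<dots> \<le> exp (- 1)" using assms by simp
  also have "\<dots> \<le> 1 / 2" using exp_ge_add_one_self[of 1] by (simp add: exp_minus field_simps)
  finally show ?thesis .
qed

lemma (in prob_space) indep_vars_expectation_prod:
  fixes L :: "'u \<Rightarrow> 'a \<Rightarrow> real" and f :: "'u \<Rightarrow> real \<Rightarrow> real"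
  assumes U: "finite U" and ind: "indep_vars (\<lambda>_. borel) L U"
    and f: "\<And>u. u \<in> U \<Longrightarrow> f u \<in> borel_measurable borel"
    and int: "\<And>u. u \<in> U \<Longrightarrow> integrable M (\<lambda>x. f u (L u x))"
  shows "integrable M (\<lambda>x. \<Prod>u\<in>U. f u (L u x))"
    and "expectation (\<lambda>x. \<Prod>u\<in>U. f u (L u x)) = (\<Prod>u\<in>U. expectation (\<lambda>x. f u (L u x)))"
proof -
  have "indep_vars (\<lambda>_. borel) (\<lambda>u x. f u (L u x)) U"
    by (rule indep_vars_compose2[OF ind]) (use f in auto)
  then show "integrable M (\<lambda>x. \<Prod>u\<in>U. f u (L u x))"
    "expectation (\<lambda>x. \<Prod>u\<in>U. f u (L u x)) = (\<Prod>u\<in>U. expectation (\<lambda>x. f u (L u x)))"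
    using U int by (auto intro: indep_vars_integrable indep_vars_lebesgue_integral)
qed

text \<open>Weighting by the product over S changes the law of the active components only and
  preserves independence. The event fails if all active ratios exceed h or all inactive ones stay
  below it, so its probability factors as (1 - \<open>\<alpha>\<close>) (1 -
  \<open>\<gamma>\<close>), where \<open>\<alpha>\<close> and \<open>\<gamma>\<close> are
  powers-type products of at most 1 / 2.\<close>

lemma (in prob_space) swappable_probability:
  fixes L :: "'u \<Rightarrow> 'a \<Rightarrow> real"
  assumes U: "finite U" and S: "S \<subseteq> U" "card S = m" and ind: "indep_vars (\<lambda>_. borel) L U"
    and nonneg: "\<And>u x. 0 \<le> L u x"
    and int: "\<And>u. u \<in> U \<Longrightarrow> integrable M (L u)" and one: "\<And>u. u \<in> U \<Longrightarrow> expectation (L u) = 1"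
    and p: "0 \<le> p" "\<And>u. u \<in> U \<Longrightarrow> p \<le> prob {x \<in> space M. h \<le> L u x}" "1 \<le> p * real (card U - m)"
    and q: "0 \<le> q" "\<And>u. u \<in> U \<Longrightarrow> q \<le> expectation (\<lambda>x. L u x * of_bool (L u x \<le> h))" "1 \<le> q * real m"
  shows "integrable M (\<lambda>x. of_bool ((\<exists>i\<in>S. L i x \<le> h) \<and> (\<exists>j\<in>U - S. h \<le> L j x)) * (\<Prod>u\<in>S. L u x))"
    and "1 / 4 \<le> expectation (\<lambda>x. of_bool ((\<exists>i\<in>S. L i x \<le> h) \<and> (\<exists>j\<in>U - S. h \<le> L j x)) * (\<Prod>u\<in>S. L u x))"
proof -
  have meas: "random_variable borel (L u)" if "u \<in> U" for u
    using ind that by (simp add: indep_vars_def)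
  have finS: "finite S" using U S by (auto intro: finite_subset)
  \<comment> \<open>The switches a and b select the terms of the inclusion-exclusion formula, so
    that each term is a product of functions of single components and independence applies to
    it.\<close>
  define g where "g a b u y = (if u \<in> S then y * (if a then of_bool (h < y) else 1) else if b then of_bool (y < h) else 1 :: real)"
    for a b u and y :: real
  have gm: "g a b u \<in> borel_measurable borel" for a b u
    unfolding g_def by (cases "u \<in> S"; cases a; cases b) auto
  have gi: "integrable M (\<lambda>x. g a b u (L u x))" if "u \<in> U" for a b u
  proof (rule Bochner_Integration.integrable_bound)
    show "integrable M (\<lambda>x. 1 + L u x)" using int[OF that] by simp
    show "(\<lambda>x. g a b u (L u x)) \<in> borel_measurable M" by (rule measurable_compose[OF meas[OF that] gm])
    show "AE x in M. norm (g a b u (L u x)) \<le> norm (1 + L u x)"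
      using nonneg by (intro AE_I2) (auto simp: g_def)
  qed
  let ?G = "\<lambda>a b x. \<Prod>u\<in>U. g a b u (L u x)"
  note G = indep_vars_expectation_prod[OF U ind gm gi]
  define \<alpha> where "\<alpha> = (\<Prod>u\<in>S. expectation (\<lambda>x. L u x * of_bool (h < L u x)))"
  define \<gamma> where "\<gamma> = (\<Prod>u\<in>U - S. expectation (\<lambda>x. of_bool (L u x < h) :: real))"
  have split: "prod f U = prod f S * prod f (U - S)" for f :: "'u \<Rightarrow> real"
    using U S(1) by (metis prod.subset_diff mult.commute)
  have EG: "expectation (?G a b) = (if a then \<alpha> else 1) * (if b then \<gamma> else 1)" for a b
  proof -
    have "(\<Prod>u\<in>S. expectation (\<lambda>x. g a b u (L u x))) = (if a then \<alpha> else 1)"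
      using S one unfolding \<alpha>_def by (auto simp: g_def intro!: prod.cong prod.neutral)
    moreover have "(\<Prod>u\<in>U - S. expectation (\<lambda>x. g a b u (L u x))) = (if b then \<gamma> else 1)"
      unfolding \<gamma>_def by (auto simp: g_def prob_space intro!: prod.cong prod.neutral)
    moreover have "expectation (?G a b) = (\<Prod>u\<in>U. expectation (\<lambda>x. g a b u (L u x)))" by (rule G(2))
    ultimately show ?thesis by (simp only: split)
  qed
  have eq: "of_bool ((\<exists>i\<in>S. L i x \<le> h) \<and> (\<exists>j\<in>U - S. h \<le> L j x)) * (\<Prod>u\<in>S. L u x)
     = ?G False False x - ?G True False x - ?G False True x + ?G True True x" for x
  proof -
    have s: "(\<Prod>u\<in>S. g a b u (L u x)) = (\<Prod>u\<in>S. L u x) * (if a then of_bool (\<forall>u\<in>S. h < L u x) else 1)" for a b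
      using finS by (simp add: g_def prod.distrib)
    have c: "(\<Prod>u\<in>U - S. g a b u (L u x)) = (if b then of_bool (\<forall>u\<in>U - S. L u x < h) else 1)" for a b
      using U by (simp add: g_def)
    have r: "of_bool (\<forall>u\<in>S. h < L u x) = 1 - (of_bool (\<exists>i\<in>S. L i x \<le> h) :: real)"
      "of_bool (\<forall>u\<in>U - S. L u x < h) = 1 - (of_bool (\<exists>j\<in>U - S. h \<le> L j x) :: real)"
      by (force simp: not_le of_bool_def)+
    show ?thesis unfolding split s c r of_bool_conj by (simp add: algebra_simps)
  qed
  show "integrable M (\<lambda>x. of_bool ((\<exists>i\<in>S. L i x \<le> h) \<and> (\<exists>j\<in>U - S. h \<le> L j x)) * (\<Prod>u\<in>S. L u x))"
    unfolding eq by (intro Bochner_Integration.integrable_add Bochner_Integration.integrable_diff G(1))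
  have "expectation (\<lambda>x. of_bool ((\<exists>i\<in>S. L i x \<le> h) \<and> (\<exists>j\<in>U - S. h \<le> L j x)) * (\<Prod>u\<in>S. L u x))
    = expectation (?G False False) - expectation (?G True False) - expectation (?G False True) + expectation (?G True True)"
    unfolding eq by (simp add: G(1))
  also have "\<dots> = (1 - \<alpha>) * (1 - \<gamma>)" unfolding EG by (simp add: algebra_simps)
  finally have E: "expectation (\<lambda>x. of_bool ((\<exists>i\<in>S. L i x \<le> h) \<and> (\<exists>j\<in>U - S. h \<le> L j x)) * (\<Prod>u\<in>S. L u x)) = (1 - \<alpha>) * (1 - \<gamma>)" .
  have ib: "integrable M (\<lambda>x. L u x * of_bool (h < L u x))" "integrable M (\<lambda>x. L u x * of_bool (L u x \<le> h))" if "u \<in> U" for u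
    using meas[OF that] by (auto intro!: Bochner_Integration.integrable_bound[OF int[OF that]])
  have a: "expectation (\<lambda>x. L u x * of_bool (h < L u x)) = 1 - expectation (\<lambda>x. L u x * of_bool (L u x \<le> h))" if "u \<in> U" for u
  proof -
    have "expectation (\<lambda>x. L u x * of_bool (h < L u x)) = expectation (\<lambda>x. L u x - L u x * of_bool (L u x \<le> h))"
      by (intro Bochner_Integration.integral_cong) auto
    then show ?thesis using one[OF that] int[OF that] ib[OF that] by simp
  qed
  have q1: "q \<le> 1"
  proof -
    obtain u where "u \<in> U" using q(3) S by (cases "S = {}") auto
    then show ?thesis using q(2)[of u] a[of u] nonneg integral_nonneg_AE[of "\<lambda>x. L u x * of_bool (h < L u x)" M] by auto
  qed
  have "\<alpha> \<le> (\<Prod>u\<in>S. 1 - q)"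
    unfolding \<alpha>_def using S a q nonneg by (intro prod_mono) (auto intro!: integral_nonneg_AE)
  also have "\<dots> \<le> 1 / 2" using power_one_minus_le_half[of q m] q q1 S by simp
  finally have \<alpha>: "\<alpha> \<le> 1 / 2" .
  have c: "expectation (\<lambda>x. of_bool (L u x < h)) = 1 - prob {x \<in> space M. h \<le> L u x}" if "u \<in> U" for u
  proof -
    note meas[OF that, measurable]
    have "1 - prob {x \<in> space M. h \<le> L u x} = prob {x \<in> space M. L u x < h}"
      by (subst prob_compl[symmetric]) (auto intro!: arg_cong[where f = prob])
    then show ?thesis by (simp add: expectation_of_bool)
  qed
  have p1: "p \<le> 1"
  proof -
    have "U \<noteq> {}" using p(3) by auto
    then show ?thesis using p(2) prob_le_1 by (meson all_not_in_conv order_trans)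
  qed
  have "\<gamma> \<le> (\<Prod>u\<in>U - S. 1 - p)"
    unfolding \<gamma>_def using S c p by (intro prod_mono) (auto intro!: integral_nonneg_AE)
  also have "\<dots> \<le> 1 / 2" using power_one_minus_le_half[OF p(1) p1 p(3)] S finS by (simp add: card_Diff_subset)
  finally have \<gamma>: "\<gamma> \<le> 1 / 2" .
  have "1 / 2 * (1 / 2) \<le> (1 - \<alpha>) * (1 - \<gamma>)" using \<alpha> \<gamma> by (intro mult_mono) auto
  then show "1 / 4 \<le> expectation (\<lambda>x. of_bool ((\<exists>i\<in>S. L i x \<le> h) \<and> (\<exists>j\<in>U - S. h \<le> L j x)) * (\<Prod>u\<in>S. L u x))"
    unfolding E by simp
qed

text \<open>The maximum likelihood estimate errs as soon as some active component has a likelihood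
  ratio below that of an inactive one; swapping the two shows that every estimator then fails
  on at least half of the total mass.\<close>
lemma (in prob_space) support_recovery_lower_bound:
  fixes L :: "'u \<Rightarrow> 'a \<Rightarrow> real"
  assumes U: "finite U" and ind: "indep_vars (\<lambda>_. borel) L U"
    and nonneg: "\<And>u x. 0 \<le> L u x"
    and int: "\<And>u. u \<in> U \<Longrightarrow> integrable M (L u)" and one: "\<And>u. u \<in> U \<Longrightarrow> expectation (L u) = 1"
    and p: "0 \<le> p" "\<And>u. u \<in> U \<Longrightarrow> p \<le> prob {x \<in> space M. h \<le> L u x}" "1 \<le> p * real (card U - m)"
    and q: "0 \<le> q" "\<And>u. u \<in> U \<Longrightarrow> q \<le> expectation (\<lambda>x. L u x * of_bool (L u x \<le> h))" "1 \<le> q * real m"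
    and R [measurable]: "\<And>u. u \<in> U \<Longrightarrow> Measurable.pred M (\<lambda>x. R x u)"
  defines "\<S> \<equiv> {S. S \<subseteq> U \<and> card S = m}"
  shows "ennreal (real (card \<S>) / 8)
    \<le> (\<Sum>S\<in>\<S>. \<integral>\<^sup>+x. ennreal (of_bool ({u \<in> U. R x u} \<noteq> S)) * ennreal (\<Prod>u\<in>S. L u x) \<partial>M)"
proof -
  have meas [measurable]: "random_variable borel (L u)" if "u \<in> U" for u
    using ind that by (simp add: indep_vars_def)
  have fin: "finite \<S>" using U by (simp add: \<S>_def)
  let ?E = "\<lambda>S x. of_bool ((\<exists>i\<in>S. L i x \<le> h) \<and> (\<exists>j\<in>U - S. h \<le> L j x)) * (\<Prod>u\<in>S. L u x)"
  have sw: "integrable M (?E S)" "1 / 4 \<le> expectation (?E S)" if "S \<in> \<S>" for S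
    using that swappable_probability[OF U _ _ ind nonneg int one p q, of S] by (auto simp: \<S>_def)
  have p0: "0 \<le> (\<Prod>u\<in>S. L u x)" for S x using nonneg by (intro prod_nonneg) auto
  \<comment> \<open>As a finite conjunction over U the error event is visibly measurable.\<close>
  have eqs: "{u \<in> U. R x u} \<noteq> S \<longleftrightarrow> \<not> (\<forall>u\<in>U. R x u \<longleftrightarrow> u \<in> S)" if "S \<in> \<S>" for S x
    using that by (auto simp: \<S>_def)
  have "real (card \<S>) / 8 \<le> (\<Sum>S\<in>\<S>. expectation (?E S)) / 2"
    using sum_mono[of \<S> "\<lambda>_. 1 / 4" "\<lambda>S. expectation (?E S)"] sw by simp
  also have "\<dots> = expectation (\<lambda>x. (\<Sum>S\<in>\<S>. ?E S x) / 2)"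
    using sw by (simp add: Bochner_Integration.integral_sum)
  finally have "ennreal (real (card \<S>) / 8) \<le> ennreal (expectation (\<lambda>x. (\<Sum>S\<in>\<S>. ?E S x) / 2))"
    by (rule ennreal_leI)
  also have "\<dots> = (\<integral>\<^sup>+x. ennreal ((\<Sum>S\<in>\<S>. ?E S x) / 2) \<partial>M)"
    using sw p0 by (intro nn_integral_eq_integral[symmetric]) (auto intro!: sum_nonneg)
  also have "\<dots> \<le> (\<integral>\<^sup>+x. ennreal (\<Sum>S\<in>\<S>. of_bool ({u \<in> U. R x u} \<noteq> S) * (\<Prod>u\<in>S. L u x)) \<partial>M)"
    unfolding \<S>_def using U nonneg by (intro nn_integral_mono ennreal_leI error_sum_ge_half_swappable)
  also have "\<dots> = (\<integral>\<^sup>+x. (\<Sum>S\<in>\<S>. ennreal (of_bool ({u \<in> U. R x u} \<noteq> S)) * ennreal (\<Prod>u\<in>S. L u x)) \<partial>M)"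
    using p0 by (intro nn_integral_cong) (simp add: sum_ennreal[symmetric] ennreal_mult' del: of_bool_eq)
  also have "\<dots> = (\<Sum>S\<in>\<S>. \<integral>\<^sup>+x. ennreal (of_bool ({u \<in> U. R x u} \<noteq> S)) * ennreal (\<Prod>u\<in>S. L u x) \<partial>M)"
  proof (intro nn_integral_sum)
    fix S assume S: "S \<in> \<S>"
    have [measurable]: "(\<lambda>x. \<Prod>u\<in>S. L u x) \<in> borel_measurable M"
      using S by (intro borel_measurable_prod) (auto simp: \<S>_def)
    show "(\<lambda>x. ennreal (of_bool ({u \<in> U. R x u} \<noteq> S)) * ennreal (\<Prod>u\<in>S. L u x)) \<in> borel_measurable M"
      unfolding eqs[OF S] using U by measurable
  qed
  finally show ?thesis .
qed

section \<open>Finite modifications of Gaussian product measures\<close>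


text \<open>Two measures on an infinite product are compared on cylinders. Enlarging the base J of a
  cylinder by F turns the integral into one over a finite product, where it factors; coordinates of
  F outside J contribute 1 because the new marginals are probabilities. Finiteness of F makes the
  product density meaningful, since infinite modifications may be singular.\<close>

lemma (in product_prob_space) PiM_density_finite:
  assumes F: "finite F" "F \<subseteq> I"
    and f [measurable]: "\<And>i. i \<in> F \<Longrightarrow> f i \<in> borel_measurable (M i)"
    and prob: "\<And>i. i \<in> F \<Longrightarrow> prob_space (density (M i) (f i))"
  shows "PiM I (\<lambda>i. if i \<in> F then density (M i) (f i) else M i) = density (PiM I M) (\<lambda>x. \<Prod>i\<in>F. f i (x i))"
    (is "PiM I ?N = ?D")
proof (rule measure_eqI_PiM_infinite[where I = I and M = ?N, symmetric])
  have sN: "sets (PiM I ?N) = sets (PiM I M)" by (intro sets_PiM_cong) auto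
  have pN: "prob_space (?N i)" for i using prob prob_space by auto
  have mP [measurable]: "(\<lambda>x. \<Prod>i\<in>F. f i (x i)) \<in> borel_measurable (PiM I M)"
    using F by (intro borel_measurable_prod_ennreal) (auto intro!: measurable_PiM_component_rev)
  show "sets ?D = sets (PiM I ?N)" using sN by simp
  show "sets (PiM I ?N) = sets (PiM I ?N)" ..
  have eq: "emeasure ?D (prod_emb I ?N J (Pi\<^sub>E J A)) = emeasure (PiM I ?N) (prod_emb I ?N J (Pi\<^sub>E J A))"
    if J: "finite J" "J \<subseteq> I" and A: "\<And>i. i \<in> J \<Longrightarrow> A i \<in> sets (?N i)" for A J
  proof -
    let ?K = "J \<union> F"
    have K: "finite ?K" "?K \<subseteq> I" using J F by auto
    have A' [measurable]: "A i \<in> sets (M i)" if "i \<in> J" for i using A[OF that] by (auto split: if_splits)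
    let ?X = "prod_emb I M J (Pi\<^sub>E J A)"
    have X: "prod_emb I ?N J (Pi\<^sub>E J A) = ?X"
    proof -
      have "(\<Pi>\<^sub>E i\<in>I. space (?N i)) = (\<Pi>\<^sub>E i\<in>I. space (M i))" by (intro PiE_cong) auto
      then show ?thesis by (simp only: prod_emb_def)
    qed
    have Xs [measurable]: "?X \<in> sets (PiM I M)" using J A' by (intro sets_PiM_I) auto
    define g where "g i y = (if i \<in> F then f i y else 1) * (if i \<in> J then indicator (A i) y else 1)" for i y
    have gm [measurable]: "g i \<in> borel_measurable (M i)" if "i \<in> ?K" for i
      using f[of i] A'[of i] unfolding g_def by (cases "i \<in> F"; cases "i \<in> J") (auto simp: g_def)
    have "emeasure ?D ?X = (\<integral>\<^sup>+x. (\<Prod>i\<in>F. f i (x i)) * indicator ?X x \<partial>PiM I M)"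
      by (intro emeasure_density) auto
    also have "\<dots> = (\<integral>\<^sup>+x. (\<Prod>i\<in>?K. g i (restrict x ?K i)) \<partial>PiM I M)"
    proof (intro nn_integral_cong)
      fix x assume x: "x \<in> space (PiM I M)"
      have "indicator ?X x = (\<Prod>i\<in>J. indicator (A i) (x i) :: ennreal)"
      proof (cases "\<forall>i\<in>J. x i \<in> A i")
        case True
        then show ?thesis using x J by (auto simp: indicator_def prod_emb_def space_PiM restrict_PiE_iff)
      next
        case False
        then show ?thesis using x J by (auto simp: indicator_def prod_emb_def space_PiM restrict_PiE_iff)
      qed
      moreover have "(\<Prod>i\<in>F. f i (x i)) = (\<Prod>i\<in>?K. if i \<in> F then f i (x i) else 1)"
        using K by (intro prod.mono_neutral_cong_left) auto
      moreover have "(\<Prod>i\<in>J. indicator (A i) (x i) :: ennreal) = (\<Prod>i\<in>?K. if i \<in> J then indicator (A i) (x i) else 1)"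
        using K by (intro prod.mono_neutral_cong_left) auto
      ultimately show "(\<Prod>i\<in>F. f i (x i)) * indicator ?X x = (\<Prod>i\<in>?K. g i (restrict x ?K i))"
        by (simp add: g_def prod.distrib)
    qed
    also have "\<dots> = (\<integral>\<^sup>+x. (\<Prod>i\<in>?K. g i (x i)) \<partial>distr (PiM I M) (PiM ?K M) (\<lambda>x. restrict x ?K))"
      using K by (intro nn_integral_distr[symmetric] measurable_restrict_subset borel_measurable_prod_ennreal)
        (auto intro!: measurable_PiM_component_rev)
    also have "\<dots> = (\<integral>\<^sup>+x. (\<Prod>i\<in>?K. g i (x i)) \<partial>PiM ?K M)"
      by (subst distr_PiM_restrict_finite[OF K]) simp
    also have "\<dots> = (\<Prod>i\<in>?K. \<integral>\<^sup>+y. g i y \<partial>M i)"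
      using K by (intro product_nn_integral_prod) auto
    also have "\<dots> = (\<Prod>i\<in>?K. if i \<in> J then emeasure (?N i) (A i) else 1)"
    proof (intro prod.cong refl)
      fix i assume i: "i \<in> ?K"
      show "(\<integral>\<^sup>+y. g i y \<partial>M i) = (if i \<in> J then emeasure (?N i) (A i) else 1)"
      proof (cases "i \<in> J")
        case True
        then show ?thesis using A'[OF True] f[of i] by (auto simp: g_def emeasure_density)
      next
        case False
        then have "i \<in> F" using i by auto
        then interpret Di: prob_space "density (M i) (f i)" by (rule prob)
        show ?thesis using False \<open>i \<in> F\<close> Di.emeasure_space_1 f[of i]
          by (auto simp: g_def emeasure_density cong: nn_integral_cong)
      qed
    qed
    also have "\<dots> = (\<Prod>i\<in>J. emeasure (?N i) (A i))"
      using K by (intro prod.mono_neutral_cong_right) auto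
    also have "\<dots> = emeasure (PiM I ?N) (prod_emb I ?N J (Pi\<^sub>E J A))"
      using J A pN by (intro Infinite_Product_Measure.emeasure_PiM_emb[symmetric]) auto
    finally show ?thesis unfolding X .
  qed
  show "emeasure ?D (prod_emb I ?N J (Pi\<^sub>E J A)) = emeasure (PiM I ?N) (prod_emb I ?N J (Pi\<^sub>E J A))"
    if "finite J" "J \<subseteq> I" "\<And>i. i \<in> J \<Longrightarrow> A i \<in> sets (?N i)" for A J
    using that by (rule eq)
  show "finite_measure ?D"
  proof
    have "emeasure ?D (space ?D) = emeasure (PiM I ?N) (prod_emb I ?N {} (Pi\<^sub>E {} (\<lambda>_. {})))"
    proof -
      have "prod_emb I ?N {} (Pi\<^sub>E {} (\<lambda>_. {})) = space (PiM I ?N)"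
        by (auto simp: prod_emb_def space_PiM restrict_def)
      then show ?thesis using eq[of "{}" "\<lambda>_. {}"] sets_eq_imp_space_eq[OF sN] by simp
    qed
    also have "\<dots> = 1" using pN by (subst Infinite_Product_Measure.emeasure_PiM_emb) auto
    finally show "emeasure ?D (space ?D) \<noteq> \<infinity>" by simp
  qed
qed

abbreviation gauss_shift :: "real \<Rightarrow> ('i \<Rightarrow> real) \<Rightarrow> 'i \<Rightarrow> real measure" where
  "gauss_shift \<epsilon> \<mu> l \<equiv> density lborel (normal_density (\<mu> l) \<epsilon>)"

text \<open>The Cameron-Martin density of a finitely supported shift. The base mean vanishes on F,
  so no cross term appears; elsewhere it is arbitrary, to leave room for the signals of the other
  levels.\<close>

lemma PiM_normal_shift_density:
  fixes \<mu> v :: "'i \<Rightarrow> real"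
  assumes \<epsilon>: "0 < \<epsilon>" and F: "finite F" "F \<subseteq> I" and \<mu>: "\<And>l. l \<in> F \<Longrightarrow> \<mu> l = 0"
  shows "PiM I (gauss_shift \<epsilon> (\<lambda>l. if l \<in> F then v l else \<mu> l))
    = density (PiM I (gauss_shift \<epsilon> \<mu>)) (\<lambda>x. ennreal (\<Prod>l\<in>F. exp (v l * x l / \<epsilon>\<^sup>2 - (v l)\<^sup>2 / (2 * \<epsilon>\<^sup>2))))"
proof -
  interpret product_prob_space "gauss_shift \<epsilon> \<mu>" I
    by (intro product_prob_spaceI prob_space_normal_density \<epsilon>)
  let ?f = "\<lambda>l x. ennreal (exp (v l * x / \<epsilon>\<^sup>2 - (v l)\<^sup>2 / (2 * \<epsilon>\<^sup>2)))"
  have d: "density (gauss_shift \<epsilon> \<mu> l) (?f l) = density lborel (normal_density (v l) \<epsilon>)" if "l \<in> F" for l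
  proof -
    have "normal_density 0 \<epsilon> x * exp (v l * x / \<epsilon>\<^sup>2 - (v l)\<^sup>2 / (2 * \<epsilon>\<^sup>2)) = normal_density (v l) \<epsilon> x" for x
      using \<epsilon> by (simp add: normal_density_def mult_exp_exp power2_eq_square field_simps)
    then have "(\<lambda>x. ennreal (normal_density 0 \<epsilon> x) * ?f l x) = (\<lambda>x. ennreal (normal_density (v l) \<epsilon> x))"
      by (auto simp: fun_eq_iff ennreal_mult'[symmetric])
    then show ?thesis using \<mu>[OF that] by (subst density_density_eq) auto
  qed
  have "PiM I (gauss_shift \<epsilon> (\<lambda>l. if l \<in> F then v l else \<mu> l)) = PiM I (\<lambda>l. if l \<in> F then density (gauss_shift \<epsilon> \<mu> l) (?f l) else gauss_shift \<epsilon> \<mu> l)"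
    by (intro PiM_cong) (auto simp: d)
  also have "\<dots> = density (PiM I (gauss_shift \<epsilon> \<mu>)) (\<lambda>x. \<Prod>l\<in>F. ?f l (x l))"
    using d prob_space_normal_density[OF \<epsilon>] by (intro PiM_density_finite F) auto
  also have "\<dots> = density (PiM I (gauss_shift \<epsilon> \<mu>)) (\<lambda>x. ennreal (\<Prod>l\<in>F. exp (v l * x l / \<epsilon>\<^sup>2 - (v l)\<^sup>2 / (2 * \<epsilon>\<^sup>2))))"
    by (simp add: prod_ennreal)
  finally show ?thesis .
qed

lemma distr_normal_scale:
  assumes "0 < \<epsilon>"
  shows "distr (density lborel (normal_density 0 \<epsilon>)) std_normal (\<lambda>y. y / \<epsilon>) = std_normal"
proof -
  let ?N = "density lborel (normal_density 0 \<epsilon>)"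
  interpret prob_space ?N by (rule prob_space_normal_density) fact
  have "distr ?N lborel (\<lambda>x. x) = ?N" by (rule distr_id2) simp
  then have "distributed ?N lborel (\<lambda>x. x) (normal_density 0 \<epsilon>)"
    by (auto simp: distributed_def)
  then have "distributed ?N lborel (\<lambda>y. y / \<epsilon>) std_normal_density"
    using normal_standard_normal_convert[OF assms, of "\<lambda>x. x" 0] by simp
  then have "distr ?N lborel (\<lambda>y. y / \<epsilon>) = std_normal" by (simp add: distributed_def)
  moreover have "distr ?N std_normal (\<lambda>y. y / \<epsilon>) = distr ?N lborel (\<lambda>y. y / \<epsilon>)"
    by (rule distr_cong) auto
  ultimately show ?thesis by simp
qed

text \<open>All components of a level are carried to one block \<open>F0\<close> of standard
  normals. Their likelihood ratios thus share one law, and a single cut-off serves every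
  component.\<close>

lemma distr_block_std_normal:
  assumes \<epsilon>: "0 < \<epsilon>" and F0: "finite F0" and \<pi>: "inj_on \<pi> F0" "\<pi> ` F0 \<subseteq> I"
    and \<mu>: "\<And>l. l \<in> F0 \<Longrightarrow> \<mu> (\<pi> l) = 0"
  shows "distr (PiM I (gauss_shift \<epsilon> \<mu>)) (PiM F0 (\<lambda>_. std_normal)) (\<lambda>x. \<lambda>l\<in>F0. x (\<pi> l) / \<epsilon>)
    = PiM F0 (\<lambda>_. std_normal)"
proof -
  let ?M = "PiM I (gauss_shift \<epsilon> \<mu>)"
  let ?N = "PiM F0 (\<lambda>_. density lborel (normal_density 0 \<epsilon>))"
  note pn = prob_space_normal_density[OF \<epsilon>]
  have N: "PiM F0 (\<lambda>l. gauss_shift \<epsilon> \<mu> (\<pi> l)) = ?N" using \<mu> by (intro PiM_cong) auto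
  have r: "distr ?M ?N (\<lambda>x. \<lambda>l\<in>F0. x (\<pi> l)) = ?N"
    using distr_PiM_reindex[OF pn \<pi>(1), of I "\<lambda>l. \<mu> l"] \<pi>(2) unfolding N by auto
  have rm: "(\<lambda>x. \<lambda>l\<in>F0. x (\<pi> l)) \<in> measurable ?M ?N"
    using \<pi> by (intro measurable_restrict) (auto intro!: measurable_component_singleton)
  have cm: "compose F0 (\<lambda>y. y / \<epsilon>) \<in> measurable ?N (PiM F0 (\<lambda>_. std_normal))"
    unfolding compose_def by (intro measurable_restrict) (auto intro!: borel_measurable_divide measurable_component_singleton)
  have "PiM F0 (\<lambda>_. std_normal) = PiM F0 (\<lambda>_. distr (density lborel (normal_density 0 \<epsilon>)) std_normal (\<lambda>y. y / \<epsilon>))"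
    using distr_normal_scale[OF \<epsilon>] by simp
  also have "\<dots> = distr ?N (PiM F0 (\<lambda>_. std_normal)) (compose F0 (\<lambda>y. y / \<epsilon>))"
    using pn std_normal.prob_space_axioms F0 by (intro distr_PiM_finite_prob_space'[symmetric]) auto
  also have "\<dots> = distr (distr ?M ?N (\<lambda>x. \<lambda>l\<in>F0. x (\<pi> l))) (PiM F0 (\<lambda>_. std_normal)) (compose F0 (\<lambda>y. y / \<epsilon>))"
    unfolding r ..
  also have "\<dots> = distr ?M (PiM F0 (\<lambda>_. std_normal)) (compose F0 (\<lambda>y. y / \<epsilon>) \<circ> (\<lambda>x. \<lambda>l\<in>F0. x (\<pi> l)))"
    by (rule distr_distr[OF cm rm])
  also have "compose F0 (\<lambda>y. y / \<epsilon>) \<circ> (\<lambda>x. \<lambda>l\<in>F0. x (\<pi> l)) = (\<lambda>x. \<lambda>l\<in>F0. x (\<pi> l) / \<epsilon>)"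
    by (auto simp: compose_def fun_eq_iff)
  finally show ?thesis ..
qed

lemma indep_vars_PiM_blocks:
  fixes G :: "'u \<Rightarrow> ('i \<Rightarrow> 'b) \<Rightarrow> 'c"
  assumes M: "\<And>i. i \<in> I \<Longrightarrow> prob_space (M i)"
    and F: "\<And>u. u \<in> U \<Longrightarrow> F u \<subseteq> I" "disjoint_family_on F U"
    and G: "\<And>u. u \<in> U \<Longrightarrow> G u \<in> measurable (PiM (F u) M) (N u)"
  shows "prob_space.indep_vars (PiM I M) N (\<lambda>u x. G u (restrict x (F u))) U"
proof -
  interpret prob_space "PiM I M" by (rule prob_space_PiM) fact
  show ?thesis
  proof (cases "I = {}")
    \<comment> \<open>The characterisation of independence by the joint law, used in the other case,
      assumes a nonempty index set.\<close>
    case True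
    have "indep_vars M (\<lambda>i x. x i) I" unfolding indep_vars_def2 indep_sets_def using True by simp
    then have "indep_vars (\<lambda>u. PiM (F u) M) (\<lambda>u x. restrict (\<lambda>i. x i) (F u)) U"
      using F by (rule indep_vars_restrict)
    then show ?thesis by (rule indep_vars_compose2) (rule G)
  next
    case False
    have "distr (PiM I M) (PiM I M) (\<lambda>x. \<lambda>i\<in>I. x i) = PiM I (\<lambda>i. distr (PiM I M) (M i) (\<lambda>x. x i))"
    proof -
      have "distr (PiM I M) (PiM I M) (\<lambda>x. \<lambda>i\<in>I. x i) = distr (PiM I M) (PiM I M) (\<lambda>x. x)"
        by (intro distr_cong) (auto simp: space_PiM)
      also have "\<dots> = PiM I M" by (rule distr_id)
      also have "\<dots> = PiM I (\<lambda>i. distr (PiM I M) (M i) (\<lambda>x. x i))"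
        by (intro PiM_cong refl distr_PiM_component[symmetric] M)
      finally show ?thesis .
    qed
    then have "indep_vars M (\<lambda>i x. x i) I"
      by (subst indep_vars_iff_distr_eq_PiM'[OF False]) auto
    then have "indep_vars (\<lambda>u. PiM (F u) M) (\<lambda>u x. restrict (\<lambda>i. x i) (F u)) U"
      using F by (rule indep_vars_restrict)
    then show ?thesis by (rule indep_vars_compose2) (rule G)
  qed
qed

text \<open>The sum over sign vectors factors over coordinates. A coordinate outside G merely
  contributes 2, so the normalisation is the same for every G: one sign prior on all of F works for
  all supports at once.\<close>

lemma sum_signs_prod_exp:
  fixes t y :: "'i \<Rightarrow> real"
  assumes F: "finite F" "G \<subseteq> F" and t: "\<And>l. l \<in> F \<Longrightarrow> 0 \<le> t l"
  shows "(\<Sum>w\<in>PiE F (\<lambda>_. {-1, 1}). \<Prod>l\<in>G. exp (w l * sqrt (t l) * y l - t l / 2))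
    = 2 ^ card F * (\<Prod>l\<in>G. cosh_lr (t l) (y l))"
proof -
  let ?e = "\<lambda>l w. exp (w * sqrt (t l) * y l - t l / 2)"
  have "(\<Prod>l\<in>G. ?e l (w l)) = (\<Prod>l\<in>F. if l \<in> G then ?e l (w l) else 1)" for w
    using F by (intro prod.mono_neutral_cong_left) auto
  then have "(\<Sum>w\<in>PiE F (\<lambda>_. {-1, 1}). \<Prod>l\<in>G. ?e l (w l)) = (\<Prod>l\<in>F. \<Sum>w\<in>{-1, 1}. if l \<in> G then ?e l w else 1)"
    using F by (subst prod_sum_PiE) auto
  also have "\<dots> = (\<Prod>l\<in>F. 2 * (if l \<in> G then cosh_lr (t l) (y l) else 1))"
  proof (intro prod.cong refl)
    have "exp (a - b / 2) = exp (- b / 2) * exp a" for a b :: real by (simp add: mult_exp_exp)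
    then show "(\<Sum>w\<in>{-1, 1}. if l \<in> G then ?e l w else 1) = 2 * (if l \<in> G then cosh_lr (t l) (y l) else 1)" for l
      by (simp add: cosh_lr_def cosh_field_def distrib_left)
  qed
  also have "\<dots> = 2 ^ card F * (\<Prod>l\<in>F. if l \<in> G then cosh_lr (t l) (y l) else 1)"
    by (simp add: prod.distrib)
  also have "(\<Prod>l\<in>F. if l \<in> G then cosh_lr (t l) (y l) else 1) = (\<Prod>l\<in>G. cosh_lr (t l) (y l))"
    using F by (intro prod.mono_neutral_cong_right) auto
  finally show ?thesis .
qed

section \<open>Reduction of the minimax risk to one level\<close>


lemma Zring_iff_supp: "l \<in> Zring u \<longleftrightarrow> supp l = u"
  by (auto simp: Zring_def supp_def)

lemma finite_Usets: "finite (Usets d k)"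
  by (rule finite_subset[of _ "Pow {..<d}"]) (auto simp: Usets_def)

lemma card_Usets: "card (Usets d k) = d choose k"
  unfolding Usets_def using n_subsets[of "{..<d}" k] by simp

text \<open>The reduction of the risk to two numbers: a chance p that an inactive ratio reaches h
  and a chance q that an active one does not exceed it. The other levels are frozen at
  \<open>\<eta>0\<close> and \<open>\<theta>0\<close>, and level k keeps its number m of active
  components. The constant is 1 / 4 for swappability times 1 / 2 for the estimator's error.\<close>

lemma minimax_risk_ge_eighth:
  fixes t :: "(nat \<Rightarrow> int) \<Rightarrow> real" and t0 :: "'i \<Rightarrow> real" and p q h :: real
    and F :: "nat set \<Rightarrow> (nat \<Rightarrow> int) set" and \<pi> :: "nat set \<Rightarrow> 'i \<Rightarrow> nat \<Rightarrow> int"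
  assumes \<epsilon>: "0 < \<epsilon>" and k: "k \<in> {1..s}"
    and H: "\<eta>0 \<in> Hclass \<beta> del d s" and \<Theta>: "\<theta>0 \<in> Theta_sd \<sigma> s d r"
  defines "m \<equiv> card {u \<in> Usets d k. \<eta>0 u}"
  assumes F: "\<And>u. u \<in> Usets d k \<Longrightarrow> F u \<subseteq> Zring u" and F0: "finite F0"
    and \<pi>: "\<And>u. u \<in> Usets d k \<Longrightarrow> bij_betw (\<pi> u) F0 (F u)"
    and t\<pi>: "\<And>u l. u \<in> Usets d k \<Longrightarrow> l \<in> F0 \<Longrightarrow> t (\<pi> u l) = t0 l"
    and t0: "\<And>l. l \<in> F0 \<Longrightarrow> 0 \<le> t0 l"
    and cost: "\<And>u. u \<in> Usets d k \<Longrightarrow> (\<Sum>l\<in>F u. \<epsilon>\<^sup>2 * t l * csq \<sigma> l) \<le> 1"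
    and energy: "\<And>u. u \<in> Usets d k \<Longrightarrow> (r k)\<^sup>2 \<le> (\<Sum>l\<in>F u. \<epsilon>\<^sup>2 * t l)"
  defines "N \<equiv> PiM F0 (\<lambda>_. std_normal)" and "\<Lambda> \<equiv> \<lambda>y. \<Prod>l\<in>F0. cosh_lr (t0 l) (y l)"
  assumes p: "0 \<le> p" "p \<le> measure N {y \<in> space N. h \<le> \<Lambda> y}" "1 \<le> p * real ((d choose k) - m)"
    and q: "0 \<le> q" "q \<le> (\<integral>y. \<Lambda> y * of_bool (\<Lambda> y \<le> h) \<partial>N)" "1 \<le> q * real m"
  shows "ennreal (1 / 8) \<le> minimax_risk \<sigma> \<beta> del \<epsilon> d s r"
proof -
  define U where "U = Usets d k"
  define FF where "FF = (\<Union>u\<in>U. F u)"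
  define W where "W = PiE FF (\<lambda>_. {-1, 1 :: real})"
  define \<S> where "\<S> = {S. S \<subseteq> U \<and> card S = m}"
  define \<mu> where "\<mu> l = (if supp l \<in> U then 0 else of_bool (\<eta>0 (supp l)) * \<theta>0 l)" for l
  define v where "v w l = w l * (\<epsilon> * sqrt (t l))" for w l
  define \<eta> where "\<eta> S u = (if u \<in> U then u \<in> S else \<eta>0 u)" for S u
  \<comment> \<open>Signs are drawn for all components of level k, active or not, so the parameter
    does not depend on S. The value 0 outside \<open>FF\<close> keeps every change of measure
    finite.\<close>
  define \<theta> where "\<theta> w l = (if supp l \<in> U then (if l \<in> FF then v w l else 0) else \<theta>0 l)" for w l
  define M where "M = PiM (Idx d s) (gauss_shift \<epsilon> \<mu>)"
  define L where "L u x = (\<Prod>l\<in>F u. cosh_lr (t l) (x l / \<epsilon>))" for u and x :: "(nat \<Rightarrow> int) \<Rightarrow> real"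
  have finU: "finite U" by (simp add: U_def finite_Usets)
  have cardU: "card U = d choose k" by (simp add: U_def card_Usets)
  have UA: "U \<subseteq> Uall d s" using k by (auto simp: U_def Uall_def)
  have finF: "finite (F u)" if "u \<in> U" for u
    using \<pi>[of u] that F0 bij_betw_finite by (auto simp: U_def)
  have Fs: "supp l = u" if "u \<in> U" "l \<in> F u" for u l
    using F[of u] that by (auto simp: U_def Zring_iff_supp)
  have finFF: "finite FF" using finU finF by (simp add: FF_def)
  have FI: "F u \<subseteq> Idx d s" if "u \<in> U" for u
    using that UA Fs[OF that] by (auto simp: Idx_def Zring_iff_supp)
  have FFI: "FF \<subseteq> Idx d s" using FI by (auto simp: FF_def)
  have disj: "disjoint_family_on F U" unfolding disjoint_family_on_def using Fs by blast
  have t: "0 \<le> t l" if "l \<in> FF" for l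
  proof -
    obtain u where "u \<in> U" "l \<in> F u" using \<open>l \<in> FF\<close> by (auto simp: FF_def)
    then obtain l' where "l' \<in> F0" "l = \<pi> u l'" using \<pi>[of u] by (auto simp: U_def bij_betw_def)
    then show ?thesis using t\<pi>[of u l'] t0[of l'] \<open>u \<in> U\<close> by (simp add: U_def)
  qed
  have v2: "(v w l)\<^sup>2 = \<epsilon>\<^sup>2 * t l" if "w \<in> W" "l \<in> FF" for w l
  proof -
    have "w l \<in> {-1, 1}" using that by (auto simp: W_def)
    then have "(w l)\<^sup>2 = 1" by auto
    then show ?thesis using t[OF that(2)] by (simp add: v_def power_mult_distrib)
  qed
  have mU: "m \<le> card U" unfolding m_def U_def[symmetric] using finU by (intro card_mono) auto
  have finS: "finite \<S>" using finU by (simp add: \<S>_def)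
  have "\<S> \<noteq> {}" using obtain_subset_with_card_n[OF mU] by (auto simp: \<S>_def)
  then have cS: "0 < card \<S>" using finS by (simp add: card_gt_0_iff)

  \<comment> \<open>\<open>Hclass\<close> sees only the cardinality on each level, so any m-subset
    may replace the active set of level k.\<close>
  have \<eta>H: "\<eta> S \<in> Hclass \<beta> del d s" if S: "S \<in> \<S>" for S
  proof -
    have "card {u \<in> Usets d k'. \<eta> S u} = card {u \<in> Usets d k'. \<eta>0 u}" for k'
    proof (cases "k' = k")
      case True
      have "{u \<in> Usets d k'. \<eta> S u} = S" using S True by (auto simp: \<S>_def \<eta>_def U_def)
      then show ?thesis using S True by (simp add: \<S>_def m_def)
    next
      case False
      then have "\<eta> S u = \<eta>0 u" if "u \<in> Usets d k'" for u using that by (auto simp: \<eta>_def U_def Usets_def)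
      then show ?thesis by (intro arg_cong[where f = card]) auto
    qed
    then show ?thesis using H by (simp add: Hclass_def)
  qed

  have \<theta>\<Theta>: "\<theta> w \<in> Theta_sd \<sigma> s d r" if w: "w \<in> W" for w
    unfolding Theta_sd_def
  proof (safe)
    fix u assume u: "u \<in> Uall d s"
    show "\<theta> w \<in> Theta_ring \<sigma> u (r (card u))"
    proof (cases "u \<in> U")
      case False
      have "\<theta> w l = \<theta>0 l" if "l \<in> Zring u" for l using that False by (simp add: \<theta>_def Zring_iff_supp)
      then have "(\<lambda>l. (\<theta> w l)\<^sup>2 * csq \<sigma> l) summable_on Zring u \<longleftrightarrow> (\<lambda>l. (\<theta>0 l)\<^sup>2 * csq \<sigma> l) summable_on Zring u"
        "(\<lambda>l. (\<theta> w l)\<^sup>2) summable_on Zring u \<longleftrightarrow> (\<lambda>l. (\<theta>0 l)\<^sup>2) summable_on Zring u"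
        "(\<Sum>\<^sub>\<infinity>l\<in>Zring u. (\<theta> w l)\<^sup>2 * csq \<sigma> l) = (\<Sum>\<^sub>\<infinity>l\<in>Zring u. (\<theta>0 l)\<^sup>2 * csq \<sigma> l)"
        "(\<Sum>\<^sub>\<infinity>l\<in>Zring u. (\<theta> w l)\<^sup>2) = (\<Sum>\<^sub>\<infinity>l\<in>Zring u. (\<theta>0 l)\<^sup>2)"
        by (auto intro!: summable_on_cong infsum_cong)
      moreover have "\<theta>0 \<in> Theta_ring \<sigma> u (r (card u))" using \<Theta> u by (auto simp: Theta_sd_def)
      ultimately show ?thesis by (simp add: Theta_ring_def)
    next
      case True
      have ck: "card u = k" using True by (auto simp: U_def Usets_def)
      have z: "\<theta> w l = 0" if "l \<in> Zring u - F u" for l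
      proof -
        have "supp l = u" using that by (simp add: Zring_iff_supp)
        moreover have "l \<notin> FF" using that Fs calculation by (auto simp: FF_def)
        ultimately show ?thesis using True by (simp add: \<theta>_def)
      qed
      have nz: "(\<theta> w l)\<^sup>2 = \<epsilon>\<^sup>2 * t l" if "l \<in> F u" for l
      proof -
        have "l \<in> FF" "supp l \<in> U" using that True Fs[OF True that] by (auto simp: FF_def)
        then show ?thesis using v2[OF w] by (simp add: \<theta>_def)
      qed
      \<comment> \<open>A general weight g covers both constraints: g = \<open>csq \<sigma>\<close>
        is the cost and g = 1 the energy.\<close>
      have hs: "((\<lambda>l. (\<theta> w l)\<^sup>2 * g l) has_sum (\<Sum>l\<in>F u. \<epsilon>\<^sup>2 * t l * g l)) (Zring u)" for g
      proof -
        have "((\<lambda>l. \<epsilon>\<^sup>2 * t l * g l) has_sum (\<Sum>l\<in>F u. \<epsilon>\<^sup>2 * t l * g l)) (F u)"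
          by (intro has_sum_finite finF True)
        also have "?this \<longleftrightarrow> ?thesis"
          using F[of u] True z nz by (intro has_sum_cong_neutral) (auto simp: U_def)
        finally show ?thesis .
      qed
      show ?thesis unfolding Theta_ring_def ck
        using hs[of "csq \<sigma>"] hs[of "\<lambda>_. 1"] cost[of u] energy[of u] True
        by (auto simp: U_def has_sum_imp_summable infsumI)
    qed
  qed

  have prodG: "(\<Prod>l\<in>(\<Union>u\<in>S. F u). g l) = (\<Prod>u\<in>S. \<Prod>l\<in>F u. g l)" if "S \<subseteq> U" for S and g :: "_ \<Rightarrow> real"
  proof (rule prod.UNION_disjoint)
    show "finite S" using that finU by (rule finite_subset)
    show "\<forall>u\<in>S. finite (F u)" using that finF by blast
    show "\<forall>u\<in>S. \<forall>u'\<in>S. u \<noteq> u' \<longrightarrow> F u \<inter> F u' = {}"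
      using that disj unfolding disjoint_family_on_def by blast
  qed

  have model: "model \<epsilon> d s (\<theta> w) (\<eta> S) = density M (\<lambda>x. ennreal (\<Prod>l\<in>(\<Union>u\<in>S. F u). exp (w l * sqrt (t l) * (x l / \<epsilon>) - t l / 2)))"
    if w: "w \<in> W" and S: "S \<in> \<S>" for w S
  proof -
    let ?G = "\<Union>u\<in>S. F u"
    have SU: "S \<subseteq> U" using S by (auto simp: \<S>_def)
    then have GF: "?G \<subseteq> FF" by (auto simp: FF_def)
    note G = finite_subset[OF GF finFF] GF
    have "model \<epsilon> d s (\<theta> w) (\<eta> S) = PiM (Idx d s) (gauss_shift \<epsilon> (\<lambda>l. if l \<in> ?G then v w l else \<mu> l))"
      unfolding model_def
    proof (rule PiM_cong[OF refl])
      fix l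
      have "of_bool (\<eta> S (supp l)) * \<theta> w l = (if l \<in> ?G then v w l else \<mu> l)"
      proof (cases "supp l \<in> U")
        case True
        have "l \<in> ?G \<longleftrightarrow> supp l \<in> S \<and> l \<in> F (supp l)" using SU Fs by blast
        moreover have "l \<in> FF \<longleftrightarrow> l \<in> F (supp l)" unfolding FF_def using True Fs by blast
        ultimately show ?thesis using True by (simp add: \<eta>_def \<theta>_def \<mu>_def)
      next
        case False
        then have "l \<notin> ?G" using SU Fs by blast
        then show ?thesis using False by (simp add: \<eta>_def \<theta>_def \<mu>_def)
      qed
      then show "density lborel (\<lambda>x. ennreal (normal_density (of_bool (\<eta> S (supp l)) * \<theta> w l) \<epsilon> x)) = gauss_shift \<epsilon> (\<lambda>l. if l \<in> ?G then v w l else \<mu> l) l"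
        by (simp only:)
    qed
    also have "\<dots> = density M (\<lambda>x. ennreal (\<Prod>l\<in>?G. exp (v w l * x l / \<epsilon>\<^sup>2 - (v w l)\<^sup>2 / (2 * \<epsilon>\<^sup>2))))"
      unfolding M_def
    proof (rule PiM_normal_shift_density[OF \<epsilon> G(1)])
      show "?G \<subseteq> Idx d s" using G(2) FFI by blast
      fix l assume "l \<in> ?G"
      then have "supp l \<in> U" using SU Fs by blast
      then show "\<mu> l = 0" by (simp add: \<mu>_def)
    qed
    also have "\<dots> = density M (\<lambda>x. ennreal (\<Prod>l\<in>?G. exp (w l * sqrt (t l) * (x l / \<epsilon>) - t l / 2)))"
    proof -
      have "v w l * x / \<epsilon>\<^sup>2 - (v w l)\<^sup>2 / (2 * \<epsilon>\<^sup>2) = w l * sqrt (t l) * (x / \<epsilon>) - t l / 2" if "l \<in> ?G" for l x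
        using v2[OF w, of l] G that \<epsilon> by (auto simp: v_def power2_eq_square)
      then show ?thesis by simp
    qed
    finally show ?thesis .
  qed

  interpret M: prob_space M
    unfolding M_def by (intro prob_space_PiM prob_space_normal_density \<epsilon>)
  have pN: "prob_space N" unfolding N_def by (intro prob_space_PiM std_normal.prob_space_axioms)
  interpret N: prob_space N by (rule pN)
  have Lm: "(\<lambda>y. \<Prod>l\<in>F u. cosh_lr (t l) (y l / \<epsilon>)) \<in> borel_measurable (PiM (F u) (gauss_shift \<epsilon> \<mu>))" if "u \<in> U" for u
    by (intro borel_measurable_prod measurable_compose[OF _ measurable_cosh_lr] borel_measurable_divide)
       (auto intro!: measurable_PiM_component_rev)
  have "M.indep_vars (\<lambda>_. borel) (\<lambda>u x. \<Prod>l\<in>F u. cosh_lr (t l) (restrict x (F u) l / \<epsilon>)) U"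
    unfolding M_def using prob_space_normal_density[OF \<epsilon>] FI disj Lm
    by (intro indep_vars_PiM_blocks[where G = "\<lambda>u y. \<Prod>l\<in>F u. cosh_lr (t l) (y l / \<epsilon>)"]) auto
  then have ind: "M.indep_vars (\<lambda>_. borel) L U"
    unfolding L_def[abs_def] by (simp cong: prod.cong)
  have \<Lambda>m [measurable]: "\<Lambda> \<in> borel_measurable N"
    unfolding N_def \<Lambda>_def by (intro borel_measurable_prod measurable_compose[OF _ measurable_cosh_lr])
       (auto intro!: measurable_PiM_component_rev)
  have law: "integrable M (\<lambda>x. g (L u x)) = integrable N (\<lambda>y. g (\<Lambda> y))"
    "M.expectation (\<lambda>x. g (L u x)) = N.expectation (\<lambda>y. g (\<Lambda> y))"
    if u: "u \<in> U" and g [measurable]: "g \<in> borel_measurable borel" for u and g :: "real \<Rightarrow> real"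
  proof -
    let ?T = "\<lambda>x. \<lambda>l\<in>F0. x (\<pi> u l) / \<epsilon>"
    have bij: "bij_betw (\<pi> u) F0 (F u)" using \<pi> u by (simp add: U_def)
    have im: "\<pi> u ` F0 = F u" using bij by (simp add: bij_betw_def)
    have \<mu>0: "\<mu> (\<pi> u l) = 0" if "l \<in> F0" for l
    proof -
      have "\<pi> u l \<in> F u" using im that by auto
      then have "supp (\<pi> u l) = u" by (rule Fs[OF u])
      then show ?thesis using u by (simp add: \<mu>_def)
    qed
    have d: "distr M N ?T = N"
      unfolding M_def N_def using bij im FI[OF u] \<mu>0
      by (intro distr_block_std_normal \<epsilon> F0) (auto simp: bij_betw_def)
    have LT: "L u x = \<Lambda> (?T x)" for x
    proof -
      have "L u x = (\<Prod>l\<in>F0. cosh_lr (t (\<pi> u l)) (x (\<pi> u l) / \<epsilon>))"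
        unfolding L_def by (rule prod.reindex_bij_betw[OF bij, symmetric])
      also have "\<dots> = \<Lambda> (?T x)" unfolding \<Lambda>_def using t\<pi> u by (intro prod.cong) (auto simp: U_def)
      finally show ?thesis .
    qed
    have Tm: "?T \<in> measurable M N"
      unfolding M_def N_def using im FI[OF u]
      by (intro measurable_restrict) (auto intro!: borel_measurable_divide measurable_PiM_component_rev)
    have gm: "(\<lambda>y. g (\<Lambda> y)) \<in> borel_measurable N" by measurable
    show "integrable M (\<lambda>x. g (L u x)) = integrable N (\<lambda>y. g (\<Lambda> y))"
      unfolding LT using integrable_distr_eq[OF Tm gm] unfolding d by simp
    show "M.expectation (\<lambda>x. g (L u x)) = N.expectation (\<lambda>y. g (\<Lambda> y))"
      unfolding LT using integral_distr[OF Tm gm] unfolding d by simp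
  qed
  interpret P: product_prob_space "\<lambda>_. std_normal" F0 by unfold_locales
  note cl = has_bochner_integral_cosh_lr(1)[OF t0, unfolded has_bochner_integral_iff]
  have \<Lambda>1: "integrable N \<Lambda>"
    unfolding N_def \<Lambda>_def using cl by (intro P.product_integrable_prod F0) auto
  have "N.expectation \<Lambda> = (\<Prod>l\<in>F0. \<integral>y. cosh_lr (t0 l) y \<partial>std_normal)"
    unfolding N_def \<Lambda>_def using cl by (intro P.product_integral_prod F0) auto
  also have "\<dots> = 1" using cl by (intro prod.neutral) auto
  finally have \<Lambda>2: "N.expectation \<Lambda> = 1" .
  have lower: "ennreal (real (card \<S>) / 8) \<le> (\<Sum>S\<in>\<S>. \<integral>\<^sup>+x. ennreal (of_bool ({u \<in> U. \<eta>t x u} \<noteq> S)) * ennreal (\<Prod>u\<in>S. L u x) \<partial>M)"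
    if sel: "\<And>u. u \<in> U \<Longrightarrow> Measurable.pred M (\<lambda>x. \<eta>t x u)" for \<eta>t
    unfolding \<S>_def
  proof (rule M.support_recovery_lower_bound[OF finU ind])
    show "0 \<le> L u x" for u x unfolding L_def by (intro prod_nonneg) (simp add: cosh_lr_pos less_imp_le)
    show "integrable M (L u)" "M.expectation (L u) = 1" if "u \<in> U" for u
      using law[OF that, of "\<lambda>y. y"] \<Lambda>1 \<Lambda>2 by auto
    show "p \<le> M.prob {x \<in> space M. h \<le> L u x}" if "u \<in> U" for u
      using law(2)[OF that, of "\<lambda>y. of_bool (h \<le> y)"] p(2)
      by (simp add: M.expectation_of_bool N.expectation_of_bool)
    show "q \<le> M.expectation (\<lambda>x. L u x * of_bool (L u x \<le> h))" if "u \<in> U" for u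
      using law(2)[OF that, of "\<lambda>y. y * of_bool (y \<le> h)"] q(2) by simp
    show "1 \<le> p * real (card U - m)" using p(3) unfolding cardU .
  qed (fact p(1) q(1) q(3) sel)+

  \<comment> \<open>A wrong active set on level k misclassifies at least one component, so the 0-1
    loss is below the Hamming loss summed over all levels.\<close>
  have loss: "ennreal (of_bool ({u \<in> U. \<eta>t x u} \<noteq> S))
    \<le> ennreal (\<Sum>k\<in>{1..s}. \<Sum>u\<in>Usets d k. \<bar>real (of_bool (\<eta>t x u)) - real (of_bool (\<eta> S u))\<bar>)"
    (is "_ \<le> ennreal (\<Sum>k\<in>_. \<Sum>u\<in>_. ?l u)") if S: "S \<in> \<S>" for \<eta>t :: "((nat \<Rightarrow> int) \<Rightarrow> real) \<Rightarrow> nat set \<Rightarrow> bool" and x S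
  proof (cases "{u \<in> U. \<eta>t x u} = S")
    case False
    then have "\<exists>u\<in>U. \<eta>t x u \<noteq> (u \<in> S)" using S unfolding \<S>_def by blast
    then obtain u where u: "u \<in> U" "\<eta>t x u \<noteq> \<eta> S u" unfolding \<eta>_def by auto
    have "1 = ?l u" using u(2) by auto
    also have "\<dots> \<le> (\<Sum>u\<in>Usets d k. ?l u)" using u(1) finU by (intro member_le_sum) (auto simp: U_def)
    also have "\<dots> \<le> (\<Sum>k\<in>{1..s}. \<Sum>u\<in>Usets d k. ?l u)"
      using k by (intro member_le_sum[of k _ "\<lambda>k. \<Sum>u\<in>Usets d k. ?l u"]) (auto intro!: sum_nonneg)
    finally show ?thesis using False by (simp add: ennreal_leI flip: ennreal_1)
  qed simp

  show ?thesis unfolding minimax_risk_def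
  proof (rule INF_greatest)
    fix \<eta>t assume sel: "\<eta>t \<in> selectors d s"
    let ?I = "\<lambda>\<eta> \<theta>. \<integral>\<^sup>+ X. ennreal (\<Sum>k\<in>{1..s}. \<Sum>u\<in>Usets d k.
            \<bar>real (of_bool (\<eta>t X u)) - real (of_bool (\<eta> u))\<bar>) \<partial>(model \<epsilon> d s \<theta> \<eta>)"
    define R where "R = (SUP \<eta>\<in>Hclass \<beta> del d s. SUP \<theta>\<in>Theta_sd \<sigma> s d r. ?I \<eta> \<theta>)"
    have sM: "sets M = sets (\<Pi>\<^sub>M l\<in>Idx d s. (borel :: real measure))"
      unfolding M_def by (intro sets_PiM_cong) auto
    have pm [measurable]: "Measurable.pred M (\<lambda>x. \<eta>t x u)" if "u \<in> U" for u
    proof -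
      have "(\<lambda>x. \<eta>t x u) \<in> measurable (\<Pi>\<^sub>M l\<in>Idx d s. (borel :: real measure)) (count_space UNIV)"
        using sel that UA by (auto simp: selectors_def)
      then show ?thesis by (simp only: measurable_cong_sets[OF sM refl])
    qed
    have em [measurable]: "(\<lambda>x. ennreal (of_bool ({u \<in> U. \<eta>t x u} \<noteq> S))) \<in> borel_measurable M" if "S \<in> \<S>" for S
    proof -
      have "{u \<in> U. \<eta>t x u} \<noteq> S \<longleftrightarrow> \<not> (\<forall>u\<in>U. \<eta>t x u \<longleftrightarrow> u \<in> S)" for x
        using that by (auto simp: \<S>_def)
      then show ?thesis using finU by simp
    qed
    let ?D = "\<lambda>w S x. \<Prod>l\<in>(\<Union>u\<in>S. F u). exp (w l * sqrt (t l) * (x l / \<epsilon>) - t l / 2)"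
    have Dm [measurable]: "?D w S \<in> borel_measurable M" if "S \<in> \<S>" for w S
    proof -
      have "l \<in> Idx d s" if "l \<in> (\<Union>u\<in>S. F u)" for l using \<open>S \<in> \<S>\<close> that FI by (auto simp: \<S>_def)
      then show ?thesis unfolding M_def by (intro borel_measurable_prod) (auto intro!: measurable_PiM_component_rev)
    qed
    have single: "(\<integral>\<^sup>+x. ennreal (of_bool ({u \<in> U. \<eta>t x u} \<noteq> S)) * ennreal (?D w S x) \<partial>M) \<le> R" if w: "w \<in> W" and S: "S \<in> \<S>" for w S
    proof -
      have "(\<integral>\<^sup>+x. ennreal (of_bool ({u \<in> U. \<eta>t x u} \<noteq> S)) * ennreal (?D w S x) \<partial>M)
        = (\<integral>\<^sup>+x. ennreal (of_bool ({u \<in> U. \<eta>t x u} \<noteq> S)) \<partial>model \<epsilon> d s (\<theta> w) (\<eta> S))"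
        unfolding model[OF w S] using Dm[OF S, of w] em[OF S] by (subst nn_integral_density) (auto simp: mult.commute)
      also have "\<dots> \<le> ?I (\<eta> S) (\<theta> w)" by (intro nn_integral_mono loss S)
      also have "\<dots> \<le> R" unfolding R_def
        by (intro SUP_upper2[OF \<eta>H[OF S]] SUP_upper2[OF \<theta>\<Theta>[OF w]]) simp
      finally show ?thesis .
    qed
    have finW: "finite W" using finFF by (auto simp: W_def intro!: finite_PiE)
    have cW: "real (card W) = 2 ^ card FF" using finFF by (simp add: W_def card_PiE numeral_2_eq_2)
    \<comment> \<open>Averaging the exponential densities over the signs gives the cosh products,
      whose factors for different components are independent under M.\<close>
    have avg: "(\<Sum>w\<in>W. \<integral>\<^sup>+x. ennreal (of_bool ({u \<in> U. \<eta>t x u} \<noteq> S)) * ennreal (?D w S x) \<partial>M)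
      = ennreal (2 ^ card FF) * (\<integral>\<^sup>+x. ennreal (of_bool ({u \<in> U. \<eta>t x u} \<noteq> S)) * ennreal (\<Prod>u\<in>S. L u x) \<partial>M)" if S: "S \<in> \<S>" for S
    proof -
      have SU: "S \<subseteq> U" using S by (simp add: \<S>_def)
      have Lp: "0 \<le> (\<Prod>u\<in>S. L u x)" for x
        unfolding L_def by (intro prod_nonneg) (simp add: cosh_lr_pos less_imp_le)
      have Dp: "0 \<le> ?D w S x" for w x by (intro prod_nonneg) simp
      have pt: "(\<Sum>w\<in>W. ennreal (?D w S x)) = ennreal (2 ^ card FF) * ennreal (\<Prod>u\<in>S. L u x)" for x
      proof -
        have "(\<Sum>w\<in>W. ennreal (?D w S x)) = ennreal (\<Sum>w\<in>W. ?D w S x)"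
          using Dp by (simp add: sum_ennreal)
        also have "(\<Sum>w\<in>W. ?D w S x) = 2 ^ card FF * (\<Prod>l\<in>(\<Union>u\<in>S. F u). cosh_lr (t l) (x l / \<epsilon>))"
          unfolding W_def using SU t by (intro sum_signs_prod_exp finFF) (auto simp: FF_def)
        also have "(\<Prod>l\<in>(\<Union>u\<in>S. F u). cosh_lr (t l) (x l / \<epsilon>)) = (\<Prod>u\<in>S. L u x)"
          unfolding L_def by (rule prodG[OF SU])
        finally show ?thesis using Lp by (simp add: ennreal_mult')
      qed
      have Lmeas: "(\<lambda>x. \<Prod>u\<in>S. L u x) \<in> borel_measurable M"
        using ind SU by (intro borel_measurable_prod) (auto simp: M.indep_vars_def)
      have "(\<Sum>w\<in>W. \<integral>\<^sup>+x. ennreal (of_bool ({u \<in> U. \<eta>t x u} \<noteq> S)) * ennreal (?D w S x) \<partial>M)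
        = (\<integral>\<^sup>+x. (\<Sum>w\<in>W. ennreal (of_bool ({u \<in> U. \<eta>t x u} \<noteq> S)) * ennreal (?D w S x)) \<partial>M)"
        using Dm[OF S] em[OF S] by (intro nn_integral_sum[symmetric]) auto
      also have "\<dots> = (\<integral>\<^sup>+x. ennreal (2 ^ card FF) * (ennreal (of_bool ({u \<in> U. \<eta>t x u} \<noteq> S)) * ennreal (\<Prod>u\<in>S. L u x)) \<partial>M)"
        unfolding sum_distrib_left[symmetric] pt by (simp add: mult_ac)
      also have "\<dots> = ennreal (2 ^ card FF) * (\<integral>\<^sup>+x. ennreal (of_bool ({u \<in> U. \<eta>t x u} \<noteq> S)) * ennreal (\<Prod>u\<in>S. L u x) \<partial>M)"
        using Lmeas em[OF S] by (intro nn_integral_cmult) auto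
      finally show ?thesis .
    qed
    \<comment> \<open>Bayes bound: each pair of a sign vector and a support is an admissible
      parameter, so the sum over all pairs is at most their number times the supremum R. This number
      cancels.\<close>
    have "ennreal (2 ^ card FF) * ennreal (real (card \<S>) / 8)
      \<le> ennreal (2 ^ card FF) * (\<Sum>S\<in>\<S>. \<integral>\<^sup>+x. ennreal (of_bool ({u \<in> U. \<eta>t x u} \<noteq> S)) * ennreal (\<Prod>u\<in>S. L u x) \<partial>M)"
      by (intro mult_left_mono lower pm) auto
    also have "\<dots> = (\<Sum>S\<in>\<S>. \<Sum>w\<in>W. \<integral>\<^sup>+x. ennreal (of_bool ({u \<in> U. \<eta>t x u} \<noteq> S)) * ennreal (?D w S x) \<partial>M)"
      by (simp only: avg sum_distrib_left cong: sum.cong)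
    also have "\<dots> \<le> (\<Sum>S\<in>\<S>. \<Sum>w\<in>W. R)" by (intro sum_mono single)
    also have "\<dots> = ennreal (2 ^ card FF * real (card \<S>)) * R"
      by (simp add: cW[symmetric] ennreal_mult' ennreal_of_nat_eq_real_of_nat mult_ac)
    finally have *: "ennreal (2 ^ card FF * real (card \<S>)) * ennreal (1 / 8) \<le> ennreal (2 ^ card FF * real (card \<S>)) * R"
      by (simp flip: ennreal_mult'')
    define K where "K = 2 ^ card FF * real (card \<S>)"
    have "0 < K" using cS by (simp add: K_def)
    then show "ennreal (1 / 8) \<le> R"
      using * unfolding K_def[symmetric] by (subst (asm) ennreal_mult_le_mult_iff) auto
  qed
qed

section \<open>The extremal profile\<close>


lemma csq_Zring: "l \<in> Zring u \<Longrightarrow> csq \<sigma> l = (\<Sum>j\<in>u. (2 * pi * real_of_int (l j))\<^sup>2) powr \<sigma>"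
  by (simp add: csq_def Zring_iff_supp)

lemma csq_ge_coordinate:
  assumes "finite u" "0 < \<sigma>" "l \<in> Zring u" "j \<in> u"
  shows "((2 * pi * real_of_int (l j))\<^sup>2) powr \<sigma> \<le> csq \<sigma> l"
  unfolding csq_Zring[OF assms(3)] using assms
  by (intro powr_mono2 member_le_sum) (auto intro!: sum_nonneg)

lemma Zring_le_box:
  assumes u: "finite u" and \<sigma>: "0 < \<sigma>" and D: "D \<le> ((2 * pi * real R)\<^sup>2) powr \<sigma>"
  shows "{l \<in> Zring u. csq \<sigma> l \<le> D} \<subseteq> PiE_dflt u 0 (\<lambda>_. {- int R..int R})"
proof
  fix l assume l: "l \<in> {l \<in> Zring u. csq \<sigma> l \<le> D}"
  have "\<bar>l j\<bar> \<le> int R" if j: "j \<in> u" for j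
  proof (rule ccontr)
    assume "\<not> \<bar>l j\<bar> \<le> int R"
    then have "real R < \<bar>real_of_int (l j)\<bar>" by linarith
    then have "(real R)\<^sup>2 < (real_of_int (l j))\<^sup>2"
      using power_strict_mono[of "real R" "\<bar>real_of_int (l j)\<bar>" 2] by simp
    then have "(2 * pi * real R)\<^sup>2 < (2 * pi * real_of_int (l j))\<^sup>2" by (simp add: power_mult_distrib)
    then have "((2 * pi * real R)\<^sup>2) powr \<sigma> < ((2 * pi * real_of_int (l j))\<^sup>2) powr \<sigma>"
      using \<sigma> by (intro powr_less_mono2) auto
    then show False using csq_ge_coordinate[OF u \<sigma>, of l j] l j D by simp
  qed
  then have "l j \<in> {- int R..int R}" if "j \<in> u" for j using that by fastforce
  moreover have "l j = 0" if "j \<notin> u" for j using l that by (auto simp: Zring_def)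
  ultimately show "l \<in> PiE_dflt u 0 (\<lambda>_. {- int R..int R})" by (simp add: PiE_dflt_def)
qed

text \<open>The sublevel set lies in a box of half side the ceiling of D^(1 / (2
  \<open>\<sigma>\<close>)); dropping the factor 2 pi loses only constants. Such a crude count
  suffices because it is later used with card u logarithmic in L.\<close>

lemma card_Zring_le:
  assumes u: "finite u" and \<sigma>: "0 < \<sigma>" and D: "0 < D"
  shows "finite {l \<in> Zring u. csq \<sigma> l \<le> D}"
    and "real (card {l \<in> Zring u. csq \<sigma> l \<le> D}) \<le> (2 * (D powr (1 / (2 * \<sigma>)) + 1) + 1) ^ card u"
proof -
  define y where "y = D powr (1 / (2 * \<sigma>))"
  define R where "R = nat \<lceil>y\<rceil>"
  have y: "0 \<le> y" by (simp add: y_def)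
  have R: "y \<le> real R" "real R \<le> y + 1" using y unfolding R_def by linarith+
  have "D = (y\<^sup>2) powr \<sigma>"
    using D \<sigma> by (simp add: y_def powr_powr flip: powr_realpow)
  also have "y \<le> 2 * pi * real R"
    using R(1) y pi_gt3 mult_mono[of 1 "2 * pi" y "real R"] by simp
  then have "(y\<^sup>2) powr \<sigma> \<le> ((2 * pi * real R)\<^sup>2) powr \<sigma>"
    using y \<sigma> by (intro powr_mono2 power_mono) auto
  finally have sub: "{l \<in> Zring u. csq \<sigma> l \<le> D} \<subseteq> PiE_dflt u 0 (\<lambda>_. {- int R..int R})"
    by (intro Zring_le_box u \<sigma>)
  have fin: "finite (PiE_dflt u (0::int) (\<lambda>_. {- int R..int R}))" using u by (intro finite_PiE_dflt) auto
  show "finite {l \<in> Zring u. csq \<sigma> l \<le> D}" using sub fin by (rule finite_subset)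
  have "card {l \<in> Zring u. csq \<sigma> l \<le> D} \<le> card (PiE_dflt u (0::int) (\<lambda>_. {- int R..int R}))"
    using fin sub by (rule card_mono)
  also have "\<dots> = (2 * R + 1) ^ card u" using u by (simp add: card_PiE_dflt nat_add_distrib nat_mult_distrib)
  finally have "real (card {l \<in> Zring u. csq \<sigma> l \<le> D}) \<le> (2 * real R + 1) ^ card u"
    using of_nat_mono[of _ "(2 * R + 1) ^ card u", where 'a = real] by (simp add: add.commute)
  also have "\<dots> \<le> (2 * (y + 1) + 1) ^ card u" using R by (intro power_mono) auto
  finally show "real (card {l \<in> Zring u. csq \<sigma> l \<le> D}) \<le> (2 * (D powr (1 / (2 * \<sigma>)) + 1) + 1) ^ card u"
    unfolding y_def .
qed

text \<open>The minimum of \<open>csq \<sigma>\<close> over \<open>Zring u\<close> for nonempty u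
  with k elements, attained exactly at the 2^k corners, whose coordinates on u are 1 or -1.\<close>

definition cmin :: "real \<Rightarrow> nat \<Rightarrow> real" where
  "cmin \<sigma> k = (4 * pi\<^sup>2 * real k) powr \<sigma>"

lemma cmin_le_csq:
  assumes u: "finite u" and \<sigma>: "0 < \<sigma>" and l: "l \<in> Zring u"
  shows "cmin \<sigma> (card u) \<le> csq \<sigma> l"
    and "csq \<sigma> l \<le> cmin \<sigma> (card u) \<Longrightarrow> l \<in> PiE_dflt u 0 (\<lambda>_. {-1, 1})"
proof -
  have sq: "(2 * pi * real_of_int (l j))\<^sup>2 = 4 * pi\<^sup>2 * real_of_int ((l j)\<^sup>2)" for j
    by (simp add: power_mult_distrib)
  have s: "(\<Sum>j\<in>u. (2 * pi * real_of_int (l j))\<^sup>2) = 4 * pi\<^sup>2 * real_of_int (\<Sum>j\<in>u. (l j)\<^sup>2)"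
    unfolding sq by (simp add: sum_distrib_left)
  have one: "1 \<le> (l j)\<^sup>2" if "j \<in> u" for j
  proof -
    have "l j \<noteq> 0" using l that by (simp add: Zring_def)
    then have "0 < (l j)\<^sup>2" by (metis zero_less_power2)
    then show ?thesis by linarith
  qed
  have "(\<Sum>j\<in>u. 1) \<le> (\<Sum>j\<in>u. (l j)\<^sup>2)" using one by (intro sum_mono)
  then have ge: "int (card u) \<le> (\<Sum>j\<in>u. (l j)\<^sup>2)" by simp
  then have "real (card u) \<le> real_of_int (\<Sum>j\<in>u. (l j)\<^sup>2)" 
    using of_int_le_iff[where 'a = real, THEN iffD2, OF ge] by simp
  then show "cmin \<sigma> (card u) \<le> csq \<sigma> l"
    unfolding cmin_def csq_Zring[OF l] s using \<sigma> by (intro powr_mono2 mult_left_mono) auto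
  assume le: "csq \<sigma> l \<le> cmin \<sigma> (card u)"
  have "(\<Sum>j\<in>u. (l j)\<^sup>2) \<le> int (card u)"
  proof (rule ccontr)
    assume "\<not> ?thesis"
    then have "real (card u) < real_of_int (\<Sum>j\<in>u. (l j)\<^sup>2)" by linarith
    then have "cmin \<sigma> (card u) < csq \<sigma> l"
      unfolding cmin_def csq_Zring[OF l] s using \<sigma> by (intro powr_less_mono2 mult_strict_left_mono) auto
    then show False using le by simp
  qed
  then have "(\<Sum>j\<in>u. (l j)\<^sup>2 - 1) \<le> 0" by (simp add: sum_subtractf)
  moreover have nn: "0 \<le> (l j)\<^sup>2 - 1" if "j \<in> u" for j using one[OF that] by linarith
  ultimately have "(\<Sum>j\<in>u. (l j)\<^sup>2 - 1) = 0" using sum_nonneg[of u "\<lambda>j. (l j)\<^sup>2 - 1"] by force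
  then have "(l j)\<^sup>2 - 1 = 0" if "j \<in> u" for j using that nn u by (subst (asm) sum_nonneg_eq_0_iff) auto
  then have "l j = -1 \<or> l j = 1" if "j \<in> u" for j using that power2_eq_1_iff[of "l j"] by auto
  then show "l \<in> PiE_dflt u 0 (\<lambda>_. {-1, 1})" using l by (auto simp: PiE_dflt_def Zring_def)
qed

lemma corner_points:
  assumes u: "finite u" and l: "l \<in> PiE_dflt u 0 (\<lambda>_. {-1, 1})"
  shows "l \<in> Zring u" "csq \<sigma> l = cmin \<sigma> (card u)"
proof -
  show z: "l \<in> Zring u" using l by (force simp: PiE_dflt_def Zring_def)
  have "(2 * pi * real_of_int (l j))\<^sup>2 = 4 * pi\<^sup>2" if "j \<in> u" for j
    using l that by (auto simp: PiE_dflt_def power_mult_distrib)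
  then show "csq \<sigma> l = cmin \<sigma> (card u)" unfolding csq_Zring[OF z] cmin_def by (simp add: mult_ac)
qed

lemma card_corners:
  assumes "finite u"
  shows "finite (PiE_dflt u (0::int) (\<lambda>_. {-1, 1}))" "card (PiE_dflt u (0::int) (\<lambda>_. {-1, 1})) = 2 ^ card u"
  using assms by (auto intro!: finite_PiE_dflt simp: card_PiE_dflt numeral_2_eq_2)

text \<open>A ray of lattice points: coordinate j runs while the others stay at 1. It supplies
  arbitrarily many distinct indices along which \<open>csq\<close> grows at a known rate, whatever
  the dimension.\<close>

definition line_pt :: "nat set \<Rightarrow> nat \<Rightarrow> nat \<Rightarrow> nat \<Rightarrow> int" where
  "line_pt u j i = (\<lambda>x. if x = j then int i else if x \<in> u then 1 else 0)"

lemma line_pt: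
  assumes u: "finite u" and j: "j \<in> u" and i: "1 \<le> i"
  shows "line_pt u j i \<in> Zring u"
    and "csq \<sigma> (line_pt u j i) = (4 * pi\<^sup>2 * (real i ^ 2 + (real (card u) - 1))) powr \<sigma>"
proof -
  show z: "line_pt u j i \<in> Zring u" using j i by (auto simp: line_pt_def Zring_def)
  have "(\<Sum>x\<in>u. (2 * pi * real_of_int (line_pt u j i x))\<^sup>2) = 4 * pi\<^sup>2 * real i ^ 2 + (\<Sum>x\<in>u - {j}. 4 * pi\<^sup>2)"
    using u j by (subst sum.remove[of _ j]) (auto simp: line_pt_def power_mult_distrib intro!: sum.cong)
  also have "\<dots> = 4 * pi\<^sup>2 * (real i ^ 2 + (real (card u) - 1))"
    using u j card_gt_0_iff[of u] by (auto simp: card_Diff_singleton of_nat_diff algebra_simps Suc_le_eq)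
  finally show "csq \<sigma> (line_pt u j i) = (4 * pi\<^sup>2 * (real i ^ 2 + (real (card u) - 1))) powr \<sigma>"
    unfolding csq_Zring[OF z] by simp
qed

lemma inj_line_pt: "inj (line_pt u j)"
proof (rule injI)
  fix i i' assume "line_pt u j i = line_pt u j i'"
  then have "line_pt u j i j = line_pt u j i' j" by simp
  then show "i = i'" by (simp add: line_pt_def)
qed

lemma infinite_Zring:
  assumes "finite u" "u \<noteq> {}"
  shows "infinite (Zring u)"
proof -
  obtain j where j: "j \<in> u" using assms by auto
  have "infinite (line_pt u j ` {1..})"
    using finite_imageD[of "line_pt u j" "{1..}"] inj_on_subset[OF inj_line_pt subset_UNIV] infinite_Ici by blast
  moreover have "line_pt u j ` {1..} \<subseteq> Zring u" using line_pt(1)[OF assms(1) j] by auto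
  ultimately show ?thesis using finite_subset by blast
qed

section \<open>The quadratic programme and its solution\<close>

lemma Theta_ring_fourth_summable:
  assumes "\<theta> \<in> Theta_ring \<sigma> u r"
  shows "(\<lambda>l. \<theta> l ^ 4) summable_on Zring u"
proof -
  have s: "(\<lambda>l. (\<theta> l)\<^sup>2) summable_on Zring u" using assms by (simp add: Theta_ring_def)
  define B where "B = (\<Sum>\<^sub>\<infinity>l\<in>Zring u. (\<theta> l)\<^sup>2)"
  have B: "(\<theta> l)\<^sup>2 \<le> B" if "l \<in> Zring u" for l
    using finite_sum_le_infsum[OF s, of "{l}"] that by (simp add: B_def)
  show ?thesis
  proof (rule summable_on_comparison_test)
    show "(\<lambda>l. B * (\<theta> l)\<^sup>2) summable_on Zring u" using s by (rule summable_on_cmult_right)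
    fix l assume "l \<in> Zring u"
    then show "\<theta> l ^ 4 \<le> B * (\<theta> l)\<^sup>2"
      using mult_right_mono[OF B, of l "(\<theta> l)\<^sup>2"] by (simp add: power2_eq_square power4_eq_xxxx mult_ac)
  qed auto
qed

text \<open>The profile q = A max(0, D - c^2) is the Lagrangian (water-filling) solution of the quadratic
  programme defining a_sq; the level D is found by the intermediate value theorem.\<close>
lemma water_filling:
  assumes u: "finite u" "u \<noteq> {}" and \<sigma>: "0 < \<sigma>" and r: "0 < r"
    and nd: "r\<^sup>2 * cmin \<sigma> (card u) < 1"
    and \<theta>: "\<theta> \<in> Theta_ring \<sigma> u r"
  obtains A D where "0 < A" "1 / r\<^sup>2 < D"
    "(\<Sum>l\<in>{l \<in> Zring u. csq \<sigma> l < D}. A * (D - csq \<sigma> l)) = r\<^sup>2"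
    "(\<Sum>l\<in>{l \<in> Zring u. csq \<sigma> l < D}. A * (D - csq \<sigma> l) * csq \<sigma> l) = 1"
    "(\<Sum>l\<in>{l \<in> Zring u. csq \<sigma> l < D}. (A * (D - csq \<sigma> l))\<^sup>2) \<le> (\<Sum>\<^sub>\<infinity>l\<in>Zring u. \<theta> l ^ 4)"
proof -
  let ?c = "csq \<sigma>"
  define D1 where "D1 = 1 / r\<^sup>2"
  have D1: "0 < D1" "r\<^sup>2 * D1 = 1" using r by (auto simp: D1_def)
  have c0: "0 \<le> ?c l" for l by (simp add: csq_def)
  have fin: "finite {l \<in> Zring u. ?c l \<le> D}" if "0 < D" for D
    using card_Zring_le(1)[OF u(1) \<sigma> that] .
  define P where "P = {l \<in> Zring u. ?c l \<le> D1}"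
  have finP: "finite P" unfolding P_def using D1 by (intro fin)
  have "infinite (Zring u - {l \<in> Zring u. ?c l \<le> 2 * D1})"
    using infinite_Zring[OF u] fin[of "2 * D1"] D1 by (intro Diff_infinite_finite) auto
  \<comment> \<open>A point of P adds at most D2 to g D2 below, and a point of Q subtracts at least
    D2 / 2; hence the count 2 card P + 1. Levels beyond 2 D1 give r^2 c - 1 >= 1, and D2, twice the
    largest level in Q, leaves D2 - c >= D2 / 2.\<close>
  then have "\<exists>Q. finite Q \<and> card Q = 2 * card P + 1 \<and> Q \<subseteq> Zring u - {l \<in> Zring u. ?c l \<le> 2 * D1}"
    by (rule infinite_arbitrarily_large)
  then obtain Q where Q: "finite Q" "card Q = 2 * card P + 1" "Q \<subseteq> Zring u - {l \<in> Zring u. ?c l \<le> 2 * D1}"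
    by blast
  have Qne: "Q \<noteq> {}" using Q(2) by auto
  define D2 where "D2 = 2 * Max (?c ` Q)"
  have Qc: "2 * D1 < ?c l" "?c l \<le> D2 / 2" if "l \<in> Q" for l
    using Q that by (auto simp: D2_def)
  have D12: "D1 < D2" "0 < D2" using Qne Qc D1 by force+
  define W where "W = {l \<in> Zring u. ?c l \<le> D2}"
  have finW: "finite W" unfolding W_def using D12 by (intro fin)
  \<comment> \<open>Up to the factor A, g D is the energy of the profile with level D minus r^2
    times its cost. At a zero of g a single choice of A therefore makes the energy r^2 and the cost
    1. The fixed set W covers all levels up to D2, so g is a finite sum and continuous.\<close>
  define g where "g D = (\<Sum>l\<in>W. max 0 (D - ?c l) * (1 - r\<^sup>2 * ?c l))" for D
  obtain l0 where l0: "l0 \<in> PiE_dflt u (0::int) (\<lambda>_. {-1, 1})"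
    by (metis (no_types) PiE_dflt_empty_iff ex_in_conv insert_not_empty)
  have l0': "l0 \<in> Zring u" "?c l0 < D1"
    using corner_points(1)[OF u(1) l0] corner_points(2)[OF u(1) l0, of \<sigma>] nd r by (auto simp: D1_def field_simps)
  \<comment> \<open>At D1 = 1 / r^2 the factor 1 - r^2 c equals r^2 (D1 - c), so every term is a
    nonnegative square. A corner lies strictly below D1 by \<open>nd\<close>, which makes the sum
    positive and later the zero D different from D1.\<close>
  have g1: "0 < g D1"
  proof -
    have eq: "max 0 (D1 - ?c l) * (1 - r\<^sup>2 * ?c l) = r\<^sup>2 * (max 0 (D1 - ?c l))\<^sup>2" for l
    proof -
      have "1 - r\<^sup>2 * ?c l = r\<^sup>2 * (D1 - ?c l)" using D1 by (simp add: algebra_simps)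
      then show ?thesis by (auto simp: max_def power2_eq_square)
    qed
    have "0 < r\<^sup>2 * (max 0 (D1 - ?c l0))\<^sup>2" using r l0' by (auto simp: max_def)
    also have "\<dots> \<le> g D1" unfolding g_def eq
      using l0' D12 finW by (intro member_le_sum[of l0 W]) (auto simp: W_def)
    finally show ?thesis .
  qed
  have g2: "g D2 \<le> 0"
  proof -
    let ?h = "\<lambda>l. max 0 (D2 - ?c l) * (1 - r\<^sup>2 * ?c l)"
    have PW: "P \<subseteq> W" using D12 by (auto simp: P_def W_def)
    have QW: "Q \<subseteq> W - P"
    proof
      fix l assume l: "l \<in> Q"
      then have "?c l \<le> D2" "\<not> ?c l \<le> D1" using Qc[OF l] D12 D1 by linarith+
      then show "l \<in> W - P" using Q(3) l by (auto simp: W_def P_def)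
    qed
    have "g D2 = sum ?h P + (sum ?h Q + sum ?h (W - P - Q))"
      unfolding g_def using sum.subset_diff[OF PW finW, of ?h] sum.subset_diff[OF QW finite_Diff[OF finW], of ?h] by simp
    also have "sum ?h P \<le> (\<Sum>l\<in>P. D2)"
    proof (intro sum_mono)
      fix l assume "l \<in> P"
      then have "r\<^sup>2 * ?c l \<le> 1" using D1 r by (auto simp: P_def D1_def field_simps)
      then have "?h l \<le> D2 * 1" using D12 c0[of l] r by (intro mult_mono) auto
      then show "?h l \<le> D2" by simp
    qed
    also have "sum ?h Q \<le> (\<Sum>l\<in>Q. - D2 / 2)"
    proof (intro sum_mono)
      fix l assume l: "l \<in> Q"
      have "r\<^sup>2 * (2 * D1) \<le> r\<^sup>2 * ?c l" using Qc[OF l] by (intro mult_left_mono) auto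
      then have "1 \<le> r\<^sup>2 * ?c l - 1" using D1 by simp
      then have "D2 / 2 * 1 \<le> max 0 (D2 - ?c l) * (r\<^sup>2 * ?c l - 1)"
        using Qc[OF l] D12 by (intro mult_mono) auto
      then show "?h l \<le> - D2 / 2" by (simp add: algebra_simps)
    qed
    also have "sum ?h (W - P - Q) \<le> 0"
    proof (intro sum_nonpos)
      fix l assume "l \<in> W - P - Q"
      then have "D1 \<le> ?c l" by (auto simp: W_def P_def)
      then have "r\<^sup>2 * D1 \<le> r\<^sup>2 * ?c l" by (intro mult_left_mono) auto
      then show "?h l \<le> 0" using D1 by (intro mult_nonneg_nonpos) auto
    qed
    finally have "g D2 \<le> real (card P) * D2 + (real (card Q) * (- D2 / 2) + 0)" by simp
    also have "\<dots> \<le> 0" using Q(2) D12 by (simp add: algebra_simps)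
    finally show ?thesis .
  qed
  have "continuous_on {D1..D2} g" unfolding g_def by (intro continuous_intros)
  then obtain D where D: "D1 \<le> D" "D \<le> D2" "g D = 0"
    using IVT2'[of g D2 0 D1] g1 g2 D12 by auto
  have "D \<noteq> D1" using D g1 by auto
  then have D': "D1 < D" using D by simp
  define G where "G = {l \<in> Zring u. ?c l < D}"
  have GW: "G \<subseteq> W" using D by (auto simp: G_def W_def)
  have finG: "finite G" using GW finW by (rule finite_subset)
  have gG: "(\<Sum>l\<in>G. (D - ?c l) * (1 - r\<^sup>2 * ?c l)) = 0"
  proof -
    have "g D = (\<Sum>l\<in>G. (D - ?c l) * (1 - r\<^sup>2 * ?c l))"
      unfolding g_def by (rule sum.mono_neutral_cong_right) (use finW GW in \<open>auto simp: G_def W_def\<close>)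
    then show ?thesis using D by simp
  qed
  define S where "S = (\<Sum>l\<in>G. D - ?c l)"
  have l0G: "l0 \<in> G" using l0' D' by (simp add: G_def)
  have "0 < D - ?c l0" using l0' D' by simp
  also have "\<dots> \<le> S" unfolding S_def using finG l0G by (intro member_le_sum) (auto simp: G_def)
  finally have S: "0 < S" .
  define A where "A = r\<^sup>2 / S"
  have A: "0 < A" using S r by (simp add: A_def)
  define q where "q l = A * (D - ?c l)" for l
  have q1: "(\<Sum>l\<in>G. q l) = r\<^sup>2" using S by (simp add: q_def A_def S_def flip: sum_distrib_left sum_divide_distrib)
  have q2: "(\<Sum>l\<in>G. q l * ?c l) = 1"
  proof -
    have "0 = A * (\<Sum>l\<in>G. (D - ?c l) * (1 - r\<^sup>2 * ?c l))" using gG by simp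
    also have "\<dots> = (\<Sum>l\<in>G. q l - r\<^sup>2 * (q l * ?c l))"
      unfolding q_def sum_distrib_left by (intro sum.cong) (auto simp: algebra_simps)
    also have "\<dots> = r\<^sup>2 - r\<^sup>2 * (\<Sum>l\<in>G. q l * ?c l)"
      unfolding q1[symmetric] by (simp add: sum_subtractf sum_distrib_left)
    finally show ?thesis using r by simp
  qed
  \<comment> \<open>On the support one factor q equals A (D - c), so the objective collapses to the
    two constraints, both of which hold with equality.\<close>
  have q3: "(\<Sum>l\<in>G. (q l)\<^sup>2) = A * (D * r\<^sup>2 - 1)"
  proof -
    have "(\<Sum>l\<in>G. (q l)\<^sup>2) = (\<Sum>l\<in>G. A * (D * q l - q l * ?c l))"
      by (intro sum.cong) (auto simp: q_def power2_eq_square algebra_simps)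
    also have "\<dots> = A * (D * (\<Sum>l\<in>G. q l) - (\<Sum>l\<in>G. q l * ?c l))"
      by (simp add: sum_subtractf sum_distrib_left right_diff_distrib)
    finally show ?thesis by (simp add: q1 q2)
  qed
  have \<theta>': "(\<lambda>l. (\<theta> l)\<^sup>2 * ?c l) summable_on Zring u" "(\<Sum>\<^sub>\<infinity>l\<in>Zring u. (\<theta> l)\<^sup>2 * ?c l) \<le> 1"
    "(\<lambda>l. (\<theta> l)\<^sup>2) summable_on Zring u" "r\<^sup>2 \<le> (\<Sum>\<^sub>\<infinity>l\<in>Zring u. (\<theta> l)\<^sup>2)"
    using \<theta> by (auto simp: Theta_ring_def)
  have s1: "(\<lambda>l. D * (\<theta> l)\<^sup>2) summable_on Zring u" using \<theta>'(3) by (rule summable_on_cmult_right)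
  have s2: "(\<lambda>l. - ((\<theta> l)\<^sup>2 * ?c l)) summable_on Zring u" using \<theta>'(1) by (simp add: summable_on_uminus)
  have "D * r\<^sup>2 - 1 \<le> D * (\<Sum>\<^sub>\<infinity>l\<in>Zring u. (\<theta> l)\<^sup>2) - (\<Sum>\<^sub>\<infinity>l\<in>Zring u. (\<theta> l)\<^sup>2 * ?c l)"
    using \<theta>' D' D1 by (intro diff_mono mult_left_mono) auto
  also have "\<dots> = (\<Sum>\<^sub>\<infinity>l\<in>Zring u. D * (\<theta> l)\<^sup>2 - (\<theta> l)\<^sup>2 * ?c l)"
    using infsum_add[OF s1 s2] by (simp add: infsum_cmult_right' infsum_uminus)
  also have "\<dots> \<le> (\<Sum>\<^sub>\<infinity>l\<in>G. (\<theta> l)\<^sup>2 * (D - ?c l))"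
  proof (rule infsum_mono_neutral)
    show "(\<lambda>l. D * (\<theta> l)\<^sup>2 - (\<theta> l)\<^sup>2 * ?c l) summable_on Zring u" using summable_on_add[OF s1 s2] by simp
    fix l assume "l \<in> Zring u - G"
    then have "D \<le> ?c l" by (auto simp: G_def)
    then show "D * (\<theta> l)\<^sup>2 - (\<theta> l)\<^sup>2 * ?c l \<le> 0" by (simp add: mult.commute[of "(\<theta> l)\<^sup>2"] mult_right_mono)
  qed (use finG in \<open>auto simp: algebra_simps G_def\<close>)
  also have "\<dots> = (\<Sum>l\<in>G. (\<theta> l)\<^sup>2 * (D - ?c l))" using finG by (rule infsum_finite)
  finally have key: "D * r\<^sup>2 - 1 \<le> (\<Sum>l\<in>G. (\<theta> l)\<^sup>2 * (D - ?c l))" .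
  \<comment> \<open>Weak duality: \<open>key\<close> tests the constraints on theta against D - c,
    and the inequality theta^4 >= 2 theta^2 q - q^2 carries this over to the objective.\<close>
  have "A * (D * r\<^sup>2 - 1) \<le> 2 * (A * (\<Sum>l\<in>G. (\<theta> l)\<^sup>2 * (D - ?c l))) - A * (D * r\<^sup>2 - 1)"
    using mult_left_mono[OF key, of A] A by simp
  also have "\<dots> = (\<Sum>l\<in>G. 2 * ((\<theta> l)\<^sup>2 * q l) - (q l)\<^sup>2)"
    unfolding q3[symmetric] by (simp add: sum_subtractf sum_distrib_left q_def mult_ac)
  also have "\<dots> \<le> (\<Sum>l\<in>G. \<theta> l ^ 4)"
  proof (intro sum_mono)
    fix l
    have "0 \<le> ((\<theta> l)\<^sup>2 - q l)\<^sup>2" by simp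
    also have "\<dots> = \<theta> l ^ 4 - 2 * ((\<theta> l)\<^sup>2 * q l) + (q l)\<^sup>2"
      by (simp add: power2_eq_square power4_eq_xxxx algebra_simps)
    finally show "2 * ((\<theta> l)\<^sup>2 * q l) - (q l)\<^sup>2 \<le> \<theta> l ^ 4" by simp
  qed
  also have "\<dots> \<le> (\<Sum>\<^sub>\<infinity>l\<in>Zring u. \<theta> l ^ 4)"
    using Theta_ring_fourth_summable[OF \<theta>] finG by (intro finite_sum_le_infsum) (auto simp: G_def)
  finally have q4: "(\<Sum>l\<in>G. (q l)\<^sup>2) \<le> (\<Sum>\<^sub>\<infinity>l\<in>Zring u. \<theta> l ^ 4)" unfolding q3 .
  show thesis
    using that[OF A D'[unfolded D1_def]] q1 q2 q4 unfolding G_def q_def by blast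
qed


text \<open>Excludes the degenerate case without room for a water level. If r^2 times the minimal
  cost reached 1, all of theta would have to sit on the 2^k corners, and Cauchy-Schwarz would give
  r^4 <= 2^k V, too small for the energy.\<close>

lemma energy_below_corner_bound:
  assumes u: "finite u" and \<sigma>: "0 < \<sigma>" and r: "0 < r" and k: "0 < card u"
    and \<theta>: "\<theta> \<in> Theta_ring \<sigma> u r" and V: "(\<Sum>\<^sub>\<infinity>l\<in>Zring u. \<theta> l ^ 4) \<le> V"
    and small: "2 ^ card u * V * (cmin \<sigma> (card u))\<^sup>2 < 1"
  shows "r\<^sup>2 * cmin \<sigma> (card u) < 1"
proof (rule ccontr)
  let ?c = "csq \<sigma>" and ?cm = "cmin \<sigma> (card u)" and ?C = "PiE_dflt u (0::int) (\<lambda>_. {-1, 1})"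
  assume "\<not> ?thesis"
  then have nd: "1 \<le> ?cm * r\<^sup>2" by (simp add: mult.commute)
  have c0: "0 < ?cm" using k by (simp add: cmin_def)
  have \<theta>': "(\<lambda>l. (\<theta> l)\<^sup>2 * ?c l) summable_on Zring u" "(\<Sum>\<^sub>\<infinity>l\<in>Zring u. (\<theta> l)\<^sup>2 * ?c l) \<le> 1"
    "(\<lambda>l. (\<theta> l)\<^sup>2) summable_on Zring u" "r\<^sup>2 \<le> (\<Sum>\<^sub>\<infinity>l\<in>Zring u. (\<theta> l)\<^sup>2)"
    using \<theta> by (auto simp: Theta_ring_def)
  have s1: "(\<lambda>l. - (?cm * (\<theta> l)\<^sup>2)) summable_on Zring u"
    using summable_on_cmult_right[OF \<theta>'(3), of ?cm] by (simp add: summable_on_uminus)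
  have s: "(\<lambda>l. (\<theta> l)\<^sup>2 * (?c l - ?cm)) summable_on Zring u"
    using summable_on_add[OF \<theta>'(1) s1] by (simp add: algebra_simps)
  \<comment> \<open>The cost in excess of \<open>cmin\<close> is at most 1 - \<open>cmin\<close> r^2
    <= 0 in total, so a point of strictly larger cost carries no mass.\<close>
  have z: "\<theta> l = 0" if l: "l \<in> Zring u" "l \<notin> ?C" for l
  proof -
    have "?cm < ?c l" using cmin_le_csq(2)[OF u \<sigma> l(1)] l(2) by force
    have "(\<Sum>l\<in>{l}. (\<theta> l)\<^sup>2 * (?c l - ?cm)) \<le> (\<Sum>\<^sub>\<infinity>l\<in>Zring u. (\<theta> l)\<^sup>2 * (?c l - ?cm))"
      using l s cmin_le_csq(1)[OF u \<sigma>] by (intro finite_sum_le_infsum) auto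
    also have "\<dots> = (\<Sum>\<^sub>\<infinity>l\<in>Zring u. (\<theta> l)\<^sup>2 * ?c l + - (?cm * (\<theta> l)\<^sup>2))"
      by (intro infsum_cong) (simp add: algebra_simps)
    also have "\<dots> = (\<Sum>\<^sub>\<infinity>l\<in>Zring u. (\<theta> l)\<^sup>2 * ?c l) + - (?cm * (\<Sum>\<^sub>\<infinity>l\<in>Zring u. (\<theta> l)\<^sup>2))"
      using infsum_add[OF \<theta>'(1) s1] by (simp add: infsum_cmult_right' infsum_uminus)
    also have "\<dots> \<le> 1 - ?cm * r\<^sup>2" using \<theta>'(2) mult_left_mono[OF \<theta>'(4) less_imp_le[OF c0]] by linarith
    also have "\<dots> \<le> 0" using nd by simp
    finally show ?thesis using \<open>?cm < ?c l\<close> by (simp add: mult_le_0_iff)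
  qed
  have CZ: "?C \<subseteq> Zring u" using corner_points(1)[OF u] by auto
  note C = card_corners[OF u]
  have "r\<^sup>2 \<le> (\<Sum>l\<in>?C. (\<theta> l)\<^sup>2)"
  proof -
    have "(\<Sum>\<^sub>\<infinity>l\<in>Zring u. (\<theta> l)\<^sup>2) = (\<Sum>\<^sub>\<infinity>l\<in>?C. (\<theta> l)\<^sup>2)"
      using z CZ by (intro infsum_cong_neutral) auto
    then show ?thesis using \<theta>'(4) C by simp
  qed
  then have "(r\<^sup>2)\<^sup>2 \<le> (\<Sum>l\<in>?C. (\<theta> l)\<^sup>2)\<^sup>2" by (intro power_mono) auto
  also have "\<dots> \<le> (\<Sum>l\<in>?C. 1\<^sup>2) * (\<Sum>l\<in>?C. ((\<theta> l)\<^sup>2)\<^sup>2)"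
    using Cauchy_Schwarz_ineq_sum[of "\<lambda>_. 1" "\<lambda>l. (\<theta> l)\<^sup>2" ?C] by simp
  also have "\<dots> = 2 ^ card u * (\<Sum>l\<in>?C. \<theta> l ^ 4)" using C by (simp add: power_mult[symmetric])
  also have "(\<Sum>l\<in>?C. \<theta> l ^ 4) \<le> (\<Sum>\<^sub>\<infinity>l\<in>Zring u. \<theta> l ^ 4)"
    using Theta_ring_fourth_summable[OF \<theta>] C CZ by (intro finite_sum_le_infsum) auto
  also have "\<dots> \<le> V" by (rule V)
  finally have r4: "(r\<^sup>2)\<^sup>2 \<le> 2 ^ card u * V" by simp
  have "1 \<le> (?cm * r\<^sup>2)\<^sup>2" using nd by simp
  also have "\<dots> = (r\<^sup>2)\<^sup>2 * ?cm\<^sup>2" by (simp add: power_mult_distrib)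
  also have "\<dots> \<le> 2 ^ card u * V * ?cm\<^sup>2" using r4 by (intro mult_right_mono) auto
  finally show False using small by simp
qed

text \<open>If the top of the profile were above the threshold y, few lattice points could carry mass,
  so D would be small, contradicting D > 1 / r^2 with r^2 the total mass.\<close>
lemma water_filling_top:
  fixes D A y V Jr :: real
  assumes u: "finite u" "u \<noteq> {}" and \<sigma>: "0 < \<sigma>"
    and A: "0 < A" and r: "0 < r" and D: "1 / r\<^sup>2 < D" and l0: "cmin \<sigma> (card u) < D"
  defines "G \<equiv> {l \<in> Zring u. csq \<sigma> l < D}"
  assumes mass: "(\<Sum>l\<in>G. A * (D - csq \<sigma> l)) = r\<^sup>2" and V: "(\<Sum>l\<in>G. (A * (D - csq \<sigma> l))\<^sup>2) \<le> V"
    and y: "0 < y" "y < A * (D - cmin \<sigma> (card u))"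
    and J: "4 * V / y\<^sup>2 + 2 \<le> Jr"
  defines "Dm \<equiv> 2 * (4 * pi\<^sup>2 * (Jr\<^sup>2 + V / y\<^sup>2)) powr \<sigma>"
  shows "1 < Dm * exp (ln (V / y\<^sup>2) / ln 2 * ln (2 * (Dm powr (1 / (2 * \<sigma>)) + 1) + 1)) * sqrt V"
proof -
  let ?c = "csq \<sigma>" and ?cm = "cmin \<sigma> (card u)" and ?C = "PiE_dflt u (0::int) (\<lambda>_. {-1, 1})"
  let ?q = "\<lambda>l. A * (D - ?c l)"
  have k: "0 < card u" using u by (simp add: card_gt_0_iff)
  have D0: "0 < D" using less_trans[OF _ D] r by simp
  have finG: "finite G" by (rule finite_subset[OF _ card_Zring_le(1)[OF u(1) \<sigma> D0]]) (auto simp: G_def)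
  define m where "m = A * (D - ?cm)"
  have m: "y < m" "0 < m" using y by (auto simp: m_def)
  note C = card_corners[OF u(1)] and CP = corner_points[OF u(1)]
  have CG: "?C \<subseteq> G" using CP l0 by (auto simp: G_def)
  \<comment> \<open>The profile takes its maximum m at all 2^k corners. Hence 2^k m^2 <= V, and m >
    y bounds k by the binary logarithm of V / y^2.\<close>
  have "2 ^ card u * m\<^sup>2 = (\<Sum>l\<in>?C. (?q l)\<^sup>2)"
    using C CP(2)[of _ \<sigma>] by (simp add: m_def)
  also have "\<dots> \<le> (\<Sum>l\<in>G. (?q l)\<^sup>2)" using finG CG by (intro sum_mono2) auto
  finally have Vm: "2 ^ card u * m\<^sup>2 \<le> V" using V by simp
  have my: "y\<^sup>2 < m\<^sup>2" using m y by (intro power_strict_mono) auto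
  have V0: "0 < V" using less_le_trans[OF _ Vm, of 0] m by simp
  have kV: "2 ^ card u \<le> V / y\<^sup>2"
  proof -
    have "2 ^ card u * y\<^sup>2 \<le> 2 ^ card u * m\<^sup>2" using my by (intro mult_left_mono) auto
    then have "2 ^ card u * y\<^sup>2 \<le> V" using Vm by (rule order_trans)
    then show ?thesis using y by (simp add: pos_le_divide_eq)
  qed
  have klog: "real (card u) \<le> ln (V / y\<^sup>2) / ln 2"
  proof -
    have "real (card u) * ln 2 = ln (2 ^ card u)" by (simp add: ln_realpow)
    also have "\<dots> \<le> ln (V / y\<^sup>2)" using kV by (intro ln_mono) (auto intro: order_less_le_trans[OF _ kV])
    finally show ?thesis by (simp add: pos_le_divide_eq)
  qed
  have kk: "real (card u) \<le> V / y\<^sup>2"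
    using kV of_nat_less_two_power[of "card u", where 'a = real] by linarith
  \<comment> \<open>More than 4 V / y^2 points with q >= m / 2 > y / 2 would push the sum of squares
    beyond V. The + 1 makes the inequality strict even when the ceiling is exact.\<close>
  define J where "J = nat \<lceil>4 * V / y\<^sup>2\<rceil> + 1"
  have J': "4 * V / y\<^sup>2 < real J" "real J \<le> Jr" "1 \<le> J"
  proof -
    have "0 \<le> 4 * V / y\<^sup>2" using V0 y by simp
    then show "4 * V / y\<^sup>2 < real J" "real J \<le> Jr" unfolding J_def using J by linarith+
  qed (simp add: J_def)
  obtain j where j: "j \<in> u" using u by auto
  let ?p = "line_pt u j"
  \<comment> \<open>\<open>csq\<close> increases along the ray, so if its J-th point were below D /
    2, all J points would have q >= m / 2. The resulting bound on D is free of r.\<close>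
  have DJ: "D < 2 * ?c (?p J)"
  proof (rule ccontr)
    assume "\<not> ?thesis"
    then have DJ: "?c (?p J) \<le> D / 2" by simp
    have half: "m / 2 \<le> ?q (?p i)" "?p i \<in> G" if i: "i \<in> {1..J}" for i
    proof -
      have "?c (?p i) \<le> ?c (?p J)"
        using i k \<sigma> by (simp add: line_pt(2)[OF u(1) j]) (intro powr_mono2 mult_left_mono add_mono power_mono, auto)
      then have le: "?c (?p i) \<le> D / 2" using DJ by simp
      then show "?p i \<in> G" using i line_pt(1)[OF u(1) j] D0 by (auto simp: G_def)
      have "m / 2 = A * (D / 2 - ?cm / 2)" by (simp add: m_def field_simps)
      also have "\<dots> \<le> ?q (?p i)"
      proof (rule mult_left_mono)
        have "0 \<le> ?cm" by (simp add: cmin_def)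
        then show "D / 2 - ?cm / 2 \<le> D - ?c (?p i)" using le by linarith
      qed (use A in simp)
      finally show "m / 2 \<le> ?q (?p i)" .
    qed
    have "real J * (m / 2)\<^sup>2 = (\<Sum>i\<in>{1..J}. (m / 2)\<^sup>2)" by simp
    also have "\<dots> \<le> (\<Sum>i\<in>{1..J}. (?q (?p i))\<^sup>2)" using half m by (intro sum_mono power_mono) auto
    also have "\<dots> = (\<Sum>l\<in>?p ` {1..J}. (?q l)\<^sup>2)"
      by (subst sum.reindex) (auto intro: inj_on_subset[OF inj_line_pt])
    also have "\<dots> \<le> (\<Sum>l\<in>G. (?q l)\<^sup>2)" using finG half by (intro sum_mono2) auto
    also have "\<dots> \<le> V" by (rule V)
    finally have "real J * m\<^sup>2 \<le> 4 * V" by (simp add: power_divide)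
    moreover have "real J * y\<^sup>2 \<le> real J * m\<^sup>2" using my by (intro mult_left_mono) auto
    moreover have "4 * V < real J * y\<^sup>2" using J'(1) y by (simp add: pos_divide_less_eq)
    ultimately show False by linarith
  qed
  have "D < Dm"
  proof -
    have "?c (?p J) \<le> (4 * pi\<^sup>2 * (Jr\<^sup>2 + V / y\<^sup>2)) powr \<sigma>"
      unfolding line_pt(2)[OF u(1) j J'(3)] using J' kk k \<sigma>
      by (intro powr_mono2 mult_left_mono add_mono power_mono) auto
    then show ?thesis using DJ by (simp add: Dm_def)
  qed
  define n where "n = ln (V / y\<^sup>2) / ln 2"
  define B where "B = 2 * (Dm powr (1 / (2 * \<sigma>)) + 1) + 1"
  have Dm0: "0 < Dm" using \<open>D < Dm\<close> D0 by simp
  have B1: "1 < B" by (simp add: B_def add_pos_nonneg)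
  have cardG: "real (card G) \<le> exp (n * ln B)"
  proof -
    have "card G \<le> card {l \<in> Zring u. ?c l \<le> D}"
      using card_Zring_le(1)[OF u(1) \<sigma> D0] by (intro card_mono) (auto simp: G_def)
    then have "real (card G) \<le> (2 * (D powr (1 / (2 * \<sigma>)) + 1) + 1) ^ card u"
      using card_Zring_le(2)[OF u(1) \<sigma> D0] by linarith
    also have "\<dots> \<le> B ^ card u"
      unfolding B_def using \<open>D < Dm\<close> D0 \<sigma> by (intro power_mono add_mono mult_left_mono powr_mono2) auto
    also have "\<dots> = exp (real (card u) * ln B)" using B1 by (simp add: exp_of_nat_mult)
    also have "\<dots> \<le> exp (n * ln B)" using mult_right_mono[OF klog, of "ln B"] B1 by (simp add: n_def)
    finally show ?thesis .
  qed
  have mV: "m \<le> sqrt V"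
  proof (rule real_le_rsqrt)
    have "1 * m\<^sup>2 \<le> 2 ^ card u * m\<^sup>2" by (intro mult_right_mono) auto
    then show "m\<^sup>2 \<le> V" using Vm by simp
  qed
  have "r\<^sup>2 = (\<Sum>l\<in>G. ?q l)" using mass by simp
  also have "\<dots> \<le> (\<Sum>l\<in>G. m)"
    using cmin_le_csq(1)[OF u(1) \<sigma>] A by (intro sum_mono) (auto simp: m_def G_def intro!: mult_left_mono)
  also have "\<dots> = real (card G) * m" by simp
  also have "\<dots> \<le> exp (n * ln B) * sqrt V" using cardG mV m by (intro mult_mono) auto
  finally have r2: "r\<^sup>2 \<le> exp (n * ln B) * sqrt V" .
  have "1 < D * r\<^sup>2" using D r by (simp add: pos_divide_less_eq)
  also have "\<dots> \<le> Dm * (exp (n * ln B) * sqrt V)" using r2 \<open>D < Dm\<close> Dm0 by (intro mult_mono) auto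
  finally show ?thesis by (simp add: n_def B_def mult.assoc)
qed

text \<open>With V = 2 c L epsilon^4 and y = \<open>\<tau>\<close> epsilon^2 the ratio V / y^2 is
  linear in L and free of epsilon. The bound of \<open>water_filling_top\<close> is then exp (O
  (log^2 L)) times sqrt V, and epsilon <= exp (- L) drives it to 0, uniformly in u and r; so the
  profile cannot rise above y.\<close>

lemma extremal_profile:
  fixes \<sigma> c \<tau> :: real
  assumes \<sigma>: "0 < \<sigma>" and c: "0 < c" and \<tau>: "0 < \<tau>"
  obtains L0 where "\<And>L \<epsilon> u r \<theta>. L0 \<le> L \<Longrightarrow> 0 < \<epsilon> \<Longrightarrow> \<epsilon> \<le> exp (- L) \<Longrightarrow> finite u \<Longrightarrow> u \<noteq> {} \<Longrightarrow>
     real (card u) * ln 2 \<le> L \<Longrightarrow> 0 < r \<Longrightarrow> \<theta> \<in> Theta_ring \<sigma> u r \<Longrightarrow>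
     (\<Sum>\<^sub>\<infinity>l\<in>Zring u. \<theta> l ^ 4) \<le> 2 * \<epsilon> ^ 4 * (c * L) \<Longrightarrow>
     \<exists>A D. 0 < A \<and> 0 < D \<and>
       (\<Sum>l\<in>{l \<in> Zring u. csq \<sigma> l < D}. A * (D - csq \<sigma> l)) = r\<^sup>2 \<and>
       (\<Sum>l\<in>{l \<in> Zring u. csq \<sigma> l < D}. A * (D - csq \<sigma> l) * csq \<sigma> l) = 1 \<and>
       (\<Sum>l\<in>{l \<in> Zring u. csq \<sigma> l < D}. (A * (D - csq \<sigma> l))\<^sup>2) \<le> (\<Sum>\<^sub>\<infinity>l\<in>Zring u. \<theta> l ^ 4) \<and>
       (\<forall>l\<in>{l \<in> Zring u. csq \<sigma> l < D}. A * (D - csq \<sigma> l) \<le> \<tau> * \<epsilon>\<^sup>2)"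
proof -
  let ?Dm = "\<lambda>L. 2 * (4 * pi\<^sup>2 * L ^ 3) powr \<sigma>"
  \<comment> \<open>exp (- 3 L) is what remains of 2^k epsilon^4 <= exp L exp (- 4 L); it beats the
    power of L that bounds \<open>cmin\<close> squared.\<close>
  have "((\<lambda>L. (4 * pi\<^sup>2 * (2 * L)) powr (2 * \<sigma>) * (2 * c * L) * exp (- 3 * L)) \<longlongrightarrow> 0) at_top"
    using c \<sigma> by real_asymp
  then have e1: "eventually (\<lambda>L. (4 * pi\<^sup>2 * (2 * L)) powr (2 * \<sigma>) * (2 * c * L) * exp (- 3 * L) < 1) at_top"
    by (rule order_tendstoD) simp
  have "((\<lambda>L. ?Dm L * exp (ln (2 * c * L / \<tau>\<^sup>2) / ln 2 * ln (2 * (?Dm L powr (1 / (2 * \<sigma>)) + 1) + 1))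
     * sqrt (2 * c * L) * exp (- 2 * L)) \<longlongrightarrow> 0) at_top"
    using c \<sigma> \<tau> by real_asymp
  then have e2: "eventually (\<lambda>L. ?Dm L * exp (ln (2 * c * L / \<tau>\<^sup>2) / ln 2 * ln (2 * (?Dm L powr (1 / (2 * \<sigma>)) + 1) + 1))
     * sqrt (2 * c * L) * exp (- 2 * L) < 1) at_top"
    by (rule order_tendstoD) simp
  \<comment> \<open>The left side is quadratic in L, so L^3 majorises it and turns the bound on D
    into a function of L alone.\<close>
  have e3: "eventually (\<lambda>L::real. (8 * c * L / \<tau>\<^sup>2 + 2)\<^sup>2 + 2 * c * L / \<tau>\<^sup>2 \<le> L ^ 3) at_top"
    using c \<tau> by real_asymp
  have e4: "eventually (\<lambda>L. 1 \<le> 2 * c * L / \<tau>\<^sup>2) at_top"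
    using c \<tau> by real_asymp
  obtain L0 where L0: "\<And>L. L0 \<le> L \<Longrightarrow> 1 \<le> L \<and> 1 \<le> 2 * c * L / \<tau>\<^sup>2 \<and>
      (4 * pi\<^sup>2 * (2 * L)) powr (2 * \<sigma>) * (2 * c * L) * exp (- 3 * L) < 1 \<and>
      ?Dm L * exp (ln (2 * c * L / \<tau>\<^sup>2) / ln 2 * ln (2 * (?Dm L powr (1 / (2 * \<sigma>)) + 1) + 1)) * sqrt (2 * c * L) * exp (- 2 * L) < 1 \<and>
      (8 * c * L / \<tau>\<^sup>2 + 2)\<^sup>2 + 2 * c * L / \<tau>\<^sup>2 \<le> L ^ 3"
    using eventually_conj[OF eventually_ge_at_top[of 1] eventually_conj[OF e4 eventually_conj[OF e1 eventually_conj[OF e2 e3]]]]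
    unfolding eventually_at_top_linorder by blast
  show thesis
  proof (rule that[of L0])
    fix L \<epsilon> r :: real and u :: "nat set" and \<theta> :: "(nat \<Rightarrow> int) \<Rightarrow> real"
    assume L: "L0 \<le> L" and \<epsilon>: "0 < \<epsilon>" "\<epsilon> \<le> exp (- L)" and u: "finite u" "u \<noteq> {}" and k: "real (card u) * ln 2 \<le> L"
      and r: "0 < r" and \<theta>: "\<theta> \<in> Theta_ring \<sigma> u r" and V: "(\<Sum>\<^sub>\<infinity>l\<in>Zring u. \<theta> l ^ 4) \<le> 2 * \<epsilon> ^ 4 * (c * L)"
    note H = L0[OF L]
    have L1: "1 \<le> L" using H by simp
    have k0: "0 < card u" using u by (simp add: card_gt_0_iff)
    have en: "\<epsilon> ^ n \<le> exp (- real n * L)" for n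
      using power_mono[OF \<epsilon>(2), of n] \<epsilon>(1) by (simp add: exp_of_nat_mult[symmetric])
    have k2: "real (card u) \<le> 2 * L"
    proof -
      have "1 / 2 \<le> ln (2::real)" using ln2_ge_two_thirds by simp
      then have "real (card u) * (1 / 2) \<le> real (card u) * ln 2" by (intro mult_left_mono) auto
      then show ?thesis using k by simp
    qed
    have "2 ^ card u * (2 * \<epsilon> ^ 4 * (c * L)) * (cmin \<sigma> (card u))\<^sup>2 \<le> exp L * (2 * exp (- 4 * L) * (c * L)) * (4 * pi\<^sup>2 * (2 * L)) powr (2 * \<sigma>)"
    proof (intro mult_mono)
      have "(2::real) ^ card u = exp (real (card u) * ln 2)" by (simp add: exp_of_nat_mult)
      then show "2 ^ card u \<le> exp L" using k by simp
      show "\<epsilon> ^ 4 \<le> exp (- 4 * L)" using en[of 4] by simp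
      have "(cmin \<sigma> (card u))\<^sup>2 = (4 * pi\<^sup>2 * real (card u)) powr (2 * \<sigma>)"
        unfolding cmin_def power2_eq_square[of "_ powr \<sigma>"] mult_2[of \<sigma>] by (rule powr_add[symmetric])
      also have "\<dots> \<le> (4 * pi\<^sup>2 * (2 * L)) powr (2 * \<sigma>)"
        using k2 \<sigma> by (intro powr_mono2 mult_left_mono) auto
      finally show "(cmin \<sigma> (card u))\<^sup>2 \<le> (4 * pi\<^sup>2 * (2 * L)) powr (2 * \<sigma>)" .
    qed (use c L1 \<epsilon> in auto)
    also have "\<dots> = (4 * pi\<^sup>2 * (2 * L)) powr (2 * \<sigma>) * (2 * c * L) * (exp L * exp (- 4 * L))" by (simp add: mult_ac)
    also have "exp L * exp (- 4 * L) = exp (- 3 * L)" by (simp add: mult_exp_exp)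
    also have "(4 * pi\<^sup>2 * (2 * L)) powr (2 * \<sigma>) * (2 * c * L) * exp (- 3 * L) < 1" using H by blast
    finally have small: "2 ^ card u * (2 * \<epsilon> ^ 4 * (c * L)) * (cmin \<sigma> (card u))\<^sup>2 < 1" .
    have nd: "r\<^sup>2 * cmin \<sigma> (card u) < 1"
      by (rule energy_below_corner_bound[OF u(1) \<sigma> r k0 \<theta> V small])
    obtain A D where AD: "0 < A" "1 / r\<^sup>2 < D"
      "(\<Sum>l\<in>{l \<in> Zring u. csq \<sigma> l < D}. A * (D - csq \<sigma> l)) = r\<^sup>2"
      "(\<Sum>l\<in>{l \<in> Zring u. csq \<sigma> l < D}. A * (D - csq \<sigma> l) * csq \<sigma> l) = 1"
      "(\<Sum>l\<in>{l \<in> Zring u. csq \<sigma> l < D}. (A * (D - csq \<sigma> l))\<^sup>2) \<le> (\<Sum>\<^sub>\<infinity>l\<in>Zring u. \<theta> l ^ 4)"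
      by (rule water_filling[OF u \<sigma> r nd \<theta>])
    have D0: "0 < D" using less_trans[OF _ AD(2)] r by simp
    have cD: "cmin \<sigma> (card u) < D"
    proof -
      have "cmin \<sigma> (card u) < 1 / r\<^sup>2" using nd r by (simp add: pos_less_divide_eq mult.commute)
      then show ?thesis using AD(2) by (rule less_trans)
    qed
    have top: "A * (D - cmin \<sigma> (card u)) \<le> \<tau> * \<epsilon>\<^sup>2"
    proof (rule ccontr)
      define y where "y = \<tau> * \<epsilon>\<^sup>2"
      define W where "W = 2 * \<epsilon> ^ 4 * (c * L)"
      assume "\<not> ?thesis"
      then have y: "0 < y" "y < A * (D - cmin \<sigma> (card u))" using \<tau> \<epsilon> by (auto simp: y_def)
      have Wy: "W / y\<^sup>2 = 2 * c * L / \<tau>\<^sup>2"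
        using \<epsilon> by (simp add: W_def y_def power_mult_distrib flip: power_mult)
      define Jr where "Jr = 8 * c * L / \<tau>\<^sup>2 + 2"
      have J: "4 * W / y\<^sup>2 + 2 \<le> Jr" using Wy by (simp add: Jr_def)
      define E where "E = 2 * (4 * pi\<^sup>2 * (Jr\<^sup>2 + W / y\<^sup>2)) powr \<sigma>"
      define E' where "E' = ?Dm L"
      define n where "n = ln (W / y\<^sup>2) / ln 2"
      have n0: "0 \<le> n" using H unfolding n_def Wy by simp
      have E0: "0 \<le> E" by (simp add: E_def)
      have EE: "E \<le> E'" unfolding E_def E'_def using H \<sigma> c L1 \<tau>
        by (intro mult_left_mono powr_mono2) (auto simp: Wy Jr_def)
      have "1 < E * exp (n * ln (2 * (E powr (1 / (2 * \<sigma>)) + 1) + 1)) * sqrt W"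
        unfolding E_def n_def
        by (rule water_filling_top[OF u \<sigma> AD(1) r AD(2) cD AD(3) _ y J])
           (use AD(5) V in \<open>simp add: W_def\<close>)
      also have "\<dots> \<le> E' * exp (n * ln (2 * (E' powr (1 / (2 * \<sigma>)) + 1) + 1)) * (sqrt (2 * c * L) * exp (- 2 * L))"
      proof (intro mult_mono)
        show "exp (n * ln (2 * (E powr (1 / (2 * \<sigma>)) + 1) + 1)) \<le> exp (n * ln (2 * (E' powr (1 / (2 * \<sigma>)) + 1) + 1))"
          using n0 EE E0 \<sigma> by (simp, intro mult_left_mono ln_mono add_mono powr_mono2) (auto simp: add_pos_nonneg)
        have "W = (2 * c * L) * (\<epsilon>\<^sup>2)\<^sup>2" by (simp add: W_def flip: power_mult)
        then have "sqrt W = sqrt (2 * c * L) * \<epsilon>\<^sup>2" by (simp only: real_sqrt_mult real_sqrt_abs abs_power2)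
        also have "\<dots> \<le> sqrt (2 * c * L) * exp (- 2 * L)" using en[of 2] c L1 by (intro mult_left_mono) auto
        finally show "sqrt W \<le> sqrt (2 * c * L) * exp (- 2 * L)" .
      qed (use E0 EE c L1 \<epsilon> in \<open>auto simp: W_def\<close>)
      also have "\<dots> < 1" using H unfolding E'_def n_def Wy by (simp only: mult.assoc)
      finally show False .
    qed
    have "A * (D - csq \<sigma> l) \<le> \<tau> * \<epsilon>\<^sup>2" if "l \<in> Zring u" for l
    proof -
      have "A * (D - csq \<sigma> l) \<le> A * (D - cmin \<sigma> (card u))"
        using cmin_le_csq(1)[OF u(1) \<sigma> that] AD(1) by (intro mult_left_mono) auto
      then show ?thesis using top by simp
    qed
    then show "\<exists>A D. 0 < A \<and> 0 < D \<and>
       (\<Sum>l\<in>{l \<in> Zring u. csq \<sigma> l < D}. A * (D - csq \<sigma> l)) = r\<^sup>2 \<and>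
       (\<Sum>l\<in>{l \<in> Zring u. csq \<sigma> l < D}. A * (D - csq \<sigma> l) * csq \<sigma> l) = 1 \<and>
       (\<Sum>l\<in>{l \<in> Zring u. csq \<sigma> l < D}. (A * (D - csq \<sigma> l))\<^sup>2) \<le> (\<Sum>\<^sub>\<infinity>l\<in>Zring u. \<theta> l ^ 4) \<and>
       (\<forall>l\<in>{l \<in> Zring u. csq \<sigma> l < D}. A * (D - csq \<sigma> l) \<le> \<tau> * \<epsilon>\<^sup>2)"
      using AD D0 by (intro exI[of _ A] exI[of _ D]) auto
  qed
qed

section \<open>The lower bound\<close>


text \<open>Renumbering coordinates preserves \<open>csq\<close>, a sum over coordinates raised to a
  power, so the profile computed on \<open>{..<k}\<close> transfers to every component of the
  level.\<close>

lemma Zring_relabel: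
  assumes "finite u" "card u = k"
  obtains \<pi> where "bij_betw \<pi> (Zring {..<k}) (Zring u)" "\<And>l. l \<in> Zring {..<k} \<Longrightarrow> csq \<sigma> (\<pi> l) = csq \<sigma> l"
proof -
  obtain g where g: "bij_betw g u {..<k}"
    using ex_bij_betw_finite_nat[OF assms(1)] assms(2) by (auto simp: lessThan_atLeast0)
  define g' where "g' = inv_into u g"
  have g': "bij_betw g' {..<k} u" unfolding g'_def by (rule bij_betw_inv_into[OF g])
  have inv: "g' (g x) = x" if "x \<in> u" for x using bij_betw_inv_into_left[OF g that] by (simp add: g'_def)
  have inv': "g (g' i) = i" if "i < k" for i using bij_betw_inv_into_right[OF g, of i] that by (simp add: g'_def)
  have gk: "g x < k" if "x \<in> u" for x using bij_betwE[OF g] that by auto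
  have gu: "g' i \<in> u" if "i < k" for i using bij_betwE[OF g'] that by auto
  define \<pi> where "\<pi> l = (\<lambda>x. if x \<in> u then l (g x) else 0)" for l :: "nat \<Rightarrow> int"
  define \<pi>' where "\<pi>' l = (\<lambda>i. if i < k then l (g' i) else 0)" for l :: "nat \<Rightarrow> int"
  have z: "\<pi> l \<in> Zring u" if "l \<in> Zring {..<k}" for l
    using that gk by (auto simp: Zring_def \<pi>_def)
  have z': "\<pi>' l \<in> Zring {..<k}" if "l \<in> Zring u" for l
    using that gu by (auto simp: Zring_def \<pi>'_def)
  have "bij_betw \<pi> (Zring {..<k}) (Zring u)"
  proof (rule bij_betw_byWitness[where f' = \<pi>'])
    show "\<forall>l\<in>Zring {..<k}. \<pi>' (\<pi> l) = l"
      using gu inv' by (auto simp: \<pi>_def \<pi>'_def Zring_def fun_eq_iff)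
    show "\<forall>l\<in>Zring u. \<pi> (\<pi>' l) = l"
      using gk inv by (auto simp: \<pi>_def \<pi>'_def Zring_def fun_eq_iff)
  qed (use z z' in auto)
  moreover have "csq \<sigma> (\<pi> l) = csq \<sigma> l" if "l \<in> Zring {..<k}" for l
  proof -
    have "(\<Sum>x\<in>u. (2 * pi * real_of_int (\<pi> l x))\<^sup>2) = (\<Sum>x\<in>u. (2 * pi * real_of_int (l (g x)))\<^sup>2)"
      by (intro sum.cong) (auto simp: \<pi>_def)
    also have "\<dots> = (\<Sum>i\<in>{..<k}. (2 * pi * real_of_int (l i))\<^sup>2)"
      by (rule sum.reindex_bij_betw[OF g])
    finally show ?thesis by (simp add: csq_Zring[OF z[OF that]] csq_Zring[OF that])
  qed
  ultimately show thesis by (rule that)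
qed

text \<open>No minimiser is assumed to exist: any competitor below the threshold suffices, since the
  water-filling profile is compared with it directly.\<close>

lemma a_sq_less:
  assumes "a_eps \<sigma> \<epsilon> u r / ereal (sqrt L) < ereal C" "0 < L" "0 < C" "0 < \<epsilon>"
  obtains \<theta> where "\<theta> \<in> Theta_ring \<sigma> u r" "(\<Sum>\<^sub>\<infinity>l\<in>Zring u. \<theta> l ^ 4) \<le> 2 * \<epsilon> ^ 4 * (C\<^sup>2 * L)"
proof -
  have a: "a_eps \<sigma> \<epsilon> u r < ereal (C * sqrt L)"
    using assms by (subst (asm) ereal_divide_less_iff) auto
  have "a_sq \<sigma> \<epsilon> u r < ereal (C\<^sup>2 * L)"
  proof (cases "a_sq \<sigma> \<epsilon> u r")
    case (real x)
    then have "sqrt x < C * sqrt L" using a by (simp add: a_eps_def)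
    also have "C * sqrt L = sqrt (C\<^sup>2 * L)" using assms by (simp add: real_sqrt_mult)
    finally show ?thesis using real by simp
  qed (use a in \<open>auto simp: a_eps_def\<close>)
  then obtain \<theta> where \<theta>: "\<theta> \<in> Theta_ring \<sigma> u r" "(\<Sum>\<^sub>\<infinity>l\<in>Zring u. \<theta> l ^ 4) / (2 * \<epsilon> ^ 4) < C\<^sup>2 * L"
    by (auto simp: a_sq_def INF_less_iff)
  then have "(\<Sum>\<^sub>\<infinity>l\<in>Zring u. \<theta> l ^ 4) \<le> 2 * \<epsilon> ^ 4 * (C\<^sup>2 * L)"
    using assms(4) by (simp add: pos_divide_less_eq mult.commute less_imp_le)
  with \<theta>(1) show thesis by (rule that)
qed

text \<open>Below the middle the binomials increase in k. The lower bound d makes L large uniformly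
  in k, the upper bound ties L to epsilon through s, and 2^k bounds the dimension by L.\<close>

lemma binomial_size:
  assumes "1 \<le> k" "k \<le> s" "2 * s \<le> d"
  shows "d \<le> d choose k" "d choose k \<le> d choose s" "2 ^ k \<le> d choose k"
proof -
  show "d \<le> d choose k" using binomial_mono[of 1 k d] assms by simp
  show "d choose k \<le> d choose s" using binomial_mono[of k s d] assms by simp
  have "(2::real) \<le> real d / real k" using assms by (simp add: pos_le_divide_eq)
  then have "(2::real) ^ k \<le> (real d / real k) ^ k" by (intro power_mono) auto
  also have "\<dots> \<le> real (d choose k)" using assms by (intro binomial_ge_n_over_k_pow_k) auto
  finally have "real (2 ^ k) \<le> real (d choose k)" by simp
  then show "2 ^ k \<le> d choose k" by (simp only: of_nat_le_iff)
qed

text \<open>\<open>h0\<close> and \<open>h1\<close> are exponent budgets per unit of L. With T <= 2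
  C^2 L the cut-off costs \<open>\<rho>\<close>^2 C^2 / 2, respectively (1 -
  \<open>\<rho>\<close>)^2 C^2 / 2, and moment errors cost 8 \<open>st\<close> C^2;
  \<open>\<omega>\<close> absorbs constants. The budgets are the growth exponents 1 and 1 -
  \<open>\<beta>\<close> of the numbers of inactive and active components.\<close>

lemma risk_ge_eighth_at_level:
  fixes \<beta> \<sigma> C \<rho> st \<omega> :: real
  assumes \<sigma>: "0 < \<sigma>" and \<beta>: "0 < \<beta>" "\<beta> < 1" and st: "0 < st" "st < \<rho>" "\<rho> + st < 1"
    and C: "0 < C" and \<omega>: "0 < \<omega>"
    and h0: "\<rho>\<^sup>2 * C\<^sup>2 / 2 + 8 * st * C\<^sup>2 + \<omega> \<le> 1"
    and h1: "(1 - \<rho>)\<^sup>2 * C\<^sup>2 / 2 + 8 * st * C\<^sup>2 + \<omega> \<le> 1 - \<beta>"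
  obtains L1 where "\<And>\<epsilon> d s k r del \<eta>0 \<theta>0. 0 < \<epsilon> \<Longrightarrow> k \<in> {1..s} \<Longrightarrow> 2 * s \<le> d \<Longrightarrow> L1 \<le> ln (real d) \<Longrightarrow>
    ln (real (d choose s)) \<le> ln (1 / \<epsilon>) \<Longrightarrow> del \<le> 1 / 2 \<Longrightarrow> 0 < r k \<Longrightarrow>
    \<eta>0 \<in> Hclass \<beta> del d s \<Longrightarrow> \<theta>0 \<in> Theta_sd \<sigma> s d r \<Longrightarrow>
    a_eps \<sigma> \<epsilon> {..<k} (r k) / ereal (sqrt (ln (real (d choose k)))) < ereal C \<Longrightarrow>
    ennreal (1 / 8) \<le> minimax_risk \<sigma> \<beta> del \<epsilon> d s r"
proof -
  obtain t0 where t0: "0 < t0"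
    "\<And>F :: (nat \<Rightarrow> int) set. \<And>t. finite F \<Longrightarrow> (\<And>l. l \<in> F \<Longrightarrow> 0 \<le> t l \<and> t l < t0) \<Longrightarrow> \<exists>h.
       exp (- (\<rho>\<^sup>2 * (\<Sum>l\<in>F. (t l)\<^sup>2) / 4) - 4 * st * (\<Sum>l\<in>F. (t l)\<^sup>2) - 2 / st) / 4
         \<le> measure (PiM F (\<lambda>_. std_normal)) {y \<in> space (PiM F (\<lambda>_. std_normal)). h \<le> (\<Prod>l\<in>F. cosh_lr (t l) (y l))} \<and>
       exp (- ((1 - \<rho>)\<^sup>2 * (\<Sum>l\<in>F. (t l)\<^sup>2) / 4) - 4 * st * (\<Sum>l\<in>F. (t l)\<^sup>2) - 2 / st) / 4
         \<le> (\<integral>y. (\<Prod>l\<in>F. cosh_lr (t l) (y l)) * of_bool ((\<Prod>l\<in>F. cosh_lr (t l) (y l)) \<le> h) \<partial>PiM F (\<lambda>_. std_normal))"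
    by (rule prod_cosh_lr_cutoff[OF st, where 'i = "nat \<Rightarrow> int"]) blast
  obtain L0 where L0: "\<And>L \<epsilon> u r \<theta>. L0 \<le> L \<Longrightarrow> 0 < \<epsilon> \<Longrightarrow> \<epsilon> \<le> exp (- L) \<Longrightarrow> finite u \<Longrightarrow> u \<noteq> {} \<Longrightarrow>
     real (card u) * ln 2 \<le> L \<Longrightarrow> 0 < r \<Longrightarrow> \<theta> \<in> Theta_ring \<sigma> u r \<Longrightarrow>
     (\<Sum>\<^sub>\<infinity>l\<in>Zring u. \<theta> l ^ 4) \<le> 2 * \<epsilon> ^ 4 * (C\<^sup>2 * L) \<Longrightarrow>
     \<exists>A D. 0 < A \<and> 0 < D \<and>
       (\<Sum>l\<in>{l \<in> Zring u. csq \<sigma> l < D}. A * (D - csq \<sigma> l)) = r\<^sup>2 \<and>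
       (\<Sum>l\<in>{l \<in> Zring u. csq \<sigma> l < D}. A * (D - csq \<sigma> l) * csq \<sigma> l) = 1 \<and>
       (\<Sum>l\<in>{l \<in> Zring u. csq \<sigma> l < D}. (A * (D - csq \<sigma> l))\<^sup>2) \<le> (\<Sum>\<^sub>\<infinity>l\<in>Zring u. \<theta> l ^ 4) \<and>
       (\<forall>l\<in>{l \<in> Zring u. csq \<sigma> l < D}. A * (D - csq \<sigma> l) \<le> t0 / 2 * \<epsilon>\<^sup>2)"
    by (rule extremal_profile[OF \<sigma> zero_less_power[OF C, of 2] half_gt_zero[OF t0(1)]]) blast
  \<comment> \<open>The third entry makes \<open>\<omega>\<close> L absorb 2 / \<open>st\<close> +
    ln 8. The last gives 4 N^(1 - \<open>\<beta>\<close>) <= N, so at least half of the components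
    are inactive even if m is twice its nominal size.\<close>
  define L1 where "L1 = max (max 1 L0) (max ((2 / st + ln 8) / \<omega>) (ln 4 / \<beta>))"
  show thesis
  proof (rule that[of L1])
    fix \<epsilon> del :: real and d s k :: nat and r :: "nat \<Rightarrow> real" and \<eta>0 \<theta>0
    assume \<epsilon>: "0 < \<epsilon>" and k: "k \<in> {1..s}" and sd: "2 * s \<le> d" and Ld: "L1 \<le> ln (real d)"
      and Ls: "ln (real (d choose s)) \<le> ln (1 / \<epsilon>)" and del: "del \<le> 1 / 2" and r: "0 < r k"
      and H: "\<eta>0 \<in> Hclass \<beta> del d s" and \<Theta>: "\<theta>0 \<in> Theta_sd \<sigma> s d r"
      and a: "a_eps \<sigma> \<epsilon> {..<k} (r k) / ereal (sqrt (ln (real (d choose k)))) < ereal C"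
    define N where "N = real (d choose k)"
    define L where "L = ln N"
    have k': "1 \<le> k" "k \<le> s" using k by auto
    note bs = binomial_size[OF k' sd]
    have d0: "0 < d" using k' sd by simp
    have N0: "0 < N" "real d \<le> N" using bs(1) d0 k' sd by (auto simp: N_def)
    have NL: "N = exp L" using N0 by (simp add: L_def)
    have "ln (real d) \<le> L" unfolding L_def using N0 d0 by (intro ln_mono) auto
    then have "L1 \<le> L" using Ld by simp
    then have L: "1 \<le> L" "L0 \<le> L" "(2 / st + ln 8) / \<omega> \<le> L" "ln 4 / \<beta> \<le> L" by (auto simp: L1_def)
    have L\<omega>: "2 / st + ln 8 \<le> \<omega> * L" using L(3) \<omega> by (simp add: pos_divide_le_eq mult.commute)
    have L\<beta>: "ln 4 \<le> \<beta> * L" using L(4) \<beta> by (simp add: pos_divide_le_eq mult.commute)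
    have "L \<le> ln (real (d choose s))" unfolding L_def N_def using bs(2) N0 by (intro ln_mono) (auto simp: N_def)
    then have "L \<le> - ln \<epsilon>" using Ls \<epsilon> by (simp add: ln_div)
    then have \<epsilon>L: "\<epsilon> \<le> exp (- L)" using \<epsilon> ln_le_cancel_iff[of \<epsilon> "exp (- L)"] by simp
    have kL: "real (card {..<k}) * ln 2 \<le> L"
    proof -
      have "real k * ln 2 = ln (real (2 ^ k))" by (simp add: ln_realpow)
      also have "\<dots> \<le> L" unfolding L_def N_def using of_nat_mono[OF bs(3), where 'a = real] by (intro ln_mono) auto
      finally show ?thesis by simp
    qed
    obtain \<theta> where \<theta>: "\<theta> \<in> Theta_ring \<sigma> {..<k} (r k)" "(\<Sum>\<^sub>\<infinity>l\<in>Zring {..<k}. \<theta> l ^ 4) \<le> 2 * \<epsilon> ^ 4 * (C\<^sup>2 * L)"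
      using a_sq_less[OF a[folded N_def L_def] _ C \<epsilon>] L(1) by (auto simp: L_def)
    have une: "{..<k} \<noteq> {}" using k' by (simp add: lessThan_empty_iff bot_nat_def)
    obtain A D where AD: "0 < A" "0 < D"
       "(\<Sum>l\<in>{l \<in> Zring {..<k}. csq \<sigma> l < D}. A * (D - csq \<sigma> l)) = (r k)\<^sup>2"
       "(\<Sum>l\<in>{l \<in> Zring {..<k}. csq \<sigma> l < D}. A * (D - csq \<sigma> l) * csq \<sigma> l) = 1"
       "(\<Sum>l\<in>{l \<in> Zring {..<k}. csq \<sigma> l < D}. (A * (D - csq \<sigma> l))\<^sup>2) \<le> (\<Sum>\<^sub>\<infinity>l\<in>Zring {..<k}. \<theta> l ^ 4)"
       "\<And>l. l \<in> {l \<in> Zring {..<k}. csq \<sigma> l < D} \<Longrightarrow> A * (D - csq \<sigma> l) \<le> t0 / 2 * \<epsilon>\<^sup>2"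
      using L0[OF L(2) \<epsilon> \<epsilon>L finite_lessThan une kL r \<theta>] by blast
    define F where "F u = {l \<in> Zring u. csq \<sigma> l < D}" for u
    define t where "t l = A * (D - csq \<sigma> l) / \<epsilon>\<^sup>2" for l
    have te: "\<epsilon>\<^sup>2 * t l = A * (D - csq \<sigma> l)" for l using \<epsilon> by (simp add: t_def)
    note AD = AD[folded F_def]
    have finF0: "finite (F {..<k})"
      unfolding F_def by (rule finite_subset[OF _ card_Zring_le(1)[OF finite_lessThan \<sigma> AD(2)]]) auto
    have t: "0 \<le> t l \<and> t l < t0" if "l \<in> F {..<k}" for l
    proof
      show "0 \<le> t l" using that AD(1) by (simp add: t_def F_def)
      have "t l \<le> t0 / 2" using AD(6)[OF that] \<epsilon> by (simp add: t_def pos_divide_le_eq)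
      then show "t l < t0" using t0(1) by simp
    qed
    define T where "T = (\<Sum>l\<in>F {..<k}. (t l)\<^sup>2)"
    have T: "0 \<le> T" "T \<le> 2 * C\<^sup>2 * L"
    proof -
      show "0 \<le> T" unfolding T_def by (intro sum_nonneg) auto
      have "\<epsilon> ^ 4 * T = (\<Sum>l\<in>F {..<k}. (A * (D - csq \<sigma> l))\<^sup>2)"
        unfolding T_def te[symmetric] by (simp add: sum_distrib_left power_mult_distrib flip: power_mult)
      also have "\<dots> \<le> \<epsilon> ^ 4 * (2 * C\<^sup>2 * L)" using AD(5) \<theta>(2) by (simp add: mult_ac)
      finally show "T \<le> 2 * C\<^sup>2 * L" using \<epsilon> by simp
    qed
    obtain h where h:
       "exp (- (\<rho>\<^sup>2 * T / 4) - 4 * st * T - 2 / st) / 4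
         \<le> measure (PiM (F {..<k}) (\<lambda>_. std_normal)) {y \<in> space (PiM (F {..<k}) (\<lambda>_. std_normal)). h \<le> (\<Prod>l\<in>F {..<k}. cosh_lr (t l) (y l))}"
       "exp (- ((1 - \<rho>)\<^sup>2 * T / 4) - 4 * st * T - 2 / st) / 4
         \<le> (\<integral>y. (\<Prod>l\<in>F {..<k}. cosh_lr (t l) (y l)) * of_bool ((\<Prod>l\<in>F {..<k}. cosh_lr (t l) (y l)) \<le> h) \<partial>PiM (F {..<k}) (\<lambda>_. std_normal))"
      using t0(2)[where F = "F {..<k}" and t = t, OF finF0 t] unfolding T_def by blast
    define m where "m = card {u \<in> Usets d k. \<eta>0 u}"
    define n where "n = exp ((1 - \<beta>) * L)"
    have n: "N powr (1 - \<beta>) = n" using N0 by (simp add: n_def powr_def L_def)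
    have "\<bar>real m - N powr (1 - \<beta>)\<bar> \<le> del * N powr (1 - \<beta>)"
      using H k unfolding Hclass_def m_def N_def by blast
    then have "\<bar>real m - n\<bar> \<le> del * n" unfolding n .
    also have "\<dots> \<le> 1 / 2 * n" using del by (intro mult_right_mono) (auto simp: n_def)
    finally have mn: "\<bar>real m - n\<bar> \<le> 1 / 2 * n" .
    have "0 < n" by (simp add: n_def)
    with mn have m: "n / 2 \<le> real m" "real m \<le> 2 * n" by linarith+
    have "4 * n \<le> N"
    proof -
      have "4 * n = exp (ln 4 + (1 - \<beta>) * L)" by (simp add: n_def exp_add)
      also have "\<dots> \<le> exp L" using L\<beta> by (simp add: algebra_simps)
      finally show ?thesis by (simp add: NL)
    qed
    then have mN: "N / 2 \<le> real ((d choose k) - m)" using m unfolding N_def by linarith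
    \<comment> \<open>ln 8 collects the factor 1 / 4 of the cut-off estimate and the factor 1 / 2 in
      the count of components.\<close>
    have big: "1 \<le> exp (- (x * T) - 4 * st * T - 2 / st) / 4 * y"
      if x: "0 \<le> x" "x * (2 * C\<^sup>2) + 8 * st * C\<^sup>2 + \<omega> \<le> z" and y: "exp (z * L) / 2 \<le> y" for x y z
    proof -
      have "(x + 4 * st) * T \<le> (x + 4 * st) * (2 * C\<^sup>2 * L)" using T x st by (intro mult_left_mono) auto
      moreover have "(x * (2 * C\<^sup>2) + 8 * st * C\<^sup>2 + \<omega>) * L \<le> z * L" using x L by (intro mult_right_mono) auto
      ultimately have "ln 8 \<le> - (x * T) - 4 * st * T - 2 / st + z * L" using L\<omega> by (simp add: algebra_simps)
      then have "exp (ln 8) \<le> exp (- (x * T) - 4 * st * T - 2 / st + z * L)" by (simp only: exp_le_cancel_iff)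
      then have "1 \<le> exp (- (x * T) - 4 * st * T - 2 / st) / 4 * (exp (z * L) / 2)" by (simp add: exp_add)
      also have "\<dots> \<le> exp (- (x * T) - 4 * st * T - 2 / st) / 4 * y" using y by (intro mult_left_mono) auto
      finally show ?thesis .
    qed
    have "\<exists>\<pi>. bij_betw \<pi> (F {..<k}) (F u) \<and> (\<forall>l\<in>F {..<k}. csq \<sigma> (\<pi> l) = csq \<sigma> l)" if u: "u \<in> Usets d k" for u
    proof -
      have "finite u" "card u = k" using u by (auto simp: Usets_def intro: finite_subset)
      then obtain \<pi> where \<pi>: "bij_betw \<pi> (Zring {..<k}) (Zring u)" "\<And>l. l \<in> Zring {..<k} \<Longrightarrow> csq \<sigma> (\<pi> l) = csq \<sigma> l"
        by (rule Zring_relabel[where \<sigma> = \<sigma>]) blast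
      have "\<pi> ` F {..<k} = F u"
      proof
        show "\<pi> ` F {..<k} \<subseteq> F u" using \<pi> bij_betwE[OF \<pi>(1)] by (auto simp: F_def)
        show "F u \<subseteq> \<pi> ` F {..<k}"
        proof
          fix l assume l: "l \<in> F u"
          then have "l \<in> \<pi> ` Zring {..<k}" using \<pi>(1) by (simp add: bij_betw_def F_def)
          then obtain l' where "l' \<in> Zring {..<k}" "l = \<pi> l'" by blast
          then show "l \<in> \<pi> ` F {..<k}" using l \<pi>(2)[of l'] by (auto simp: F_def)
        qed
      qed
      moreover have "inj_on \<pi> (F {..<k})"
        using \<pi>(1) by (auto simp: bij_betw_def F_def intro: inj_on_subset)
      ultimately show ?thesis using \<pi>(2) by (intro exI[of _ \<pi>]) (auto simp: bij_betw_def F_def)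
    qed
    then obtain \<pi> where \<pi>: "\<And>u. u \<in> Usets d k \<Longrightarrow> bij_betw (\<pi> u) (F {..<k}) (F u)"
      "\<And>u l. u \<in> Usets d k \<Longrightarrow> l \<in> F {..<k} \<Longrightarrow> csq \<sigma> (\<pi> u l) = csq \<sigma> l"
      by metis
    have sumF: "(\<Sum>l\<in>F u. g (csq \<sigma> l)) = (\<Sum>l\<in>F {..<k}. g (csq \<sigma> l))" if u: "u \<in> Usets d k" for u and g :: "real \<Rightarrow> real"
      unfolding sum.reindex_bij_betw[OF \<pi>(1)[OF u], symmetric] using \<pi>(2)[OF u] by (intro sum.cong) auto
    show "ennreal (1 / 8) \<le> minimax_risk \<sigma> \<beta> del \<epsilon> d s r"
    proof (rule minimax_risk_ge_eighth[OF \<epsilon> k H \<Theta>, where F = F and ?F0.0 = "F {..<k}" and \<pi> = \<pi> and t = t and ?t0.0 = t and h = h])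
      show "(\<Sum>l\<in>F u. \<epsilon>\<^sup>2 * t l * csq \<sigma> l) \<le> 1" if "u \<in> Usets d k" for u
        unfolding te using sumF[OF that, of "\<lambda>c. A * (D - c) * c"] AD(4) by simp
      show "(r k)\<^sup>2 \<le> (\<Sum>l\<in>F u. \<epsilon>\<^sup>2 * t l)" if "u \<in> Usets d k" for u
        unfolding te using sumF[OF that, of "\<lambda>c. A * (D - c)"] AD(3) by simp
      show "F u \<subseteq> Zring u" for u by (auto simp: F_def)
      show "t (\<pi> u l) = t l" if "u \<in> Usets d k" "l \<in> F {..<k}" for u l
        using \<pi>(2)[OF that] by (simp add: t_def)
      show "1 \<le> exp (- (\<rho>\<^sup>2 * T / 4) - 4 * st * T - 2 / st) / 4 * real ((d choose k) - card {u \<in> Usets d k. \<eta>0 u})"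
      proof -
        have "\<rho>\<^sup>2 / 4 * (2 * C\<^sup>2) = \<rho>\<^sup>2 * C\<^sup>2 / 2" by simp
        then have "\<rho>\<^sup>2 / 4 * (2 * C\<^sup>2) + 8 * st * C\<^sup>2 + \<omega> \<le> 1" using h0 by (simp only:)
        moreover have "exp (1 * L) / 2 \<le> real ((d choose k) - m)" using mN by (simp only: NL mult_1_left)
        ultimately show ?thesis using big[of "\<rho>\<^sup>2 / 4" 1] unfolding m_def times_divide_eq_left by fastforce
      qed
      show "1 \<le> exp (- ((1 - \<rho>)\<^sup>2 * T / 4) - 4 * st * T - 2 / st) / 4 * real (card {u \<in> Usets d k. \<eta>0 u})"
      proof -
        have "(1 - \<rho>)\<^sup>2 / 4 * (2 * C\<^sup>2) = (1 - \<rho>)\<^sup>2 * C\<^sup>2 / 2" by simp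
        then have "(1 - \<rho>)\<^sup>2 / 4 * (2 * C\<^sup>2) + 8 * st * C\<^sup>2 + \<omega> \<le> 1 - \<beta>" using h1 by (simp only:)
        from big[OF _ this, of "real m"] m(1) show ?thesis by (simp add: n_def m_def)
      qed
    qed (use h finF0 \<pi>(1) t in auto)
  qed
qed

theorem theorem4:
  fixes \<beta> \<sigma> :: real
    and d s :: "real \<Rightarrow> nat"
    and r :: "real \<Rightarrow> nat \<Rightarrow> real"
    and del :: "real \<Rightarrow> real"
  assumes beta: "0 < \<beta>" "\<beta> < 1"
    and sigma: "0 < \<sigma>"
    and d_inf: "filterlim d at_top (at_right 0)"
    and s_inf: "filterlim s at_top (at_right 0)"
    and s_od: "((\<lambda>\<epsilon>. real (s \<epsilon>) / real (d \<epsilon>)) \<longlongrightarrow> 0) (at_right 0)"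
    and loglog: "((\<lambda>\<epsilon>. ln (ln (real (d \<epsilon>))) / real (s \<epsilon>)) \<longlongrightarrow> 0) (at_right 0)"
    and logbinom: "((\<lambda>\<epsilon>. ln (real (d \<epsilon> choose s \<epsilon>)) / ln (1 / \<epsilon>)) \<longlongrightarrow> 0) (at_right 0)"
    and r_pos: "\<And>\<epsilon> k. 0 < \<epsilon> \<Longrightarrow> 1 \<le> k \<Longrightarrow> k \<le> s \<epsilon> \<Longrightarrow> 0 < r \<epsilon> k"
    and cond: "Limsup (at_right 0) (\<lambda>\<epsilon>. Min ((\<lambda>k. a_eps \<sigma> \<epsilon> {..<k} (r \<epsilon> k)
                   / ereal (sqrt (ln (real (d \<epsilon> choose k))))) ` {1..s \<epsilon>}))
               < ereal (sqrt 2 * (1 + sqrt (1 - \<beta>)))"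
    and del_lim: "(del \<longlongrightarrow> 0) (at_right 0)"
    and H_nonempty: "eventually (\<lambda>\<epsilon>. Hclass \<beta> (del \<epsilon>) (d \<epsilon>) (s \<epsilon>) \<noteq> {}) (at_right 0)"
    and Theta_nonempty: "eventually (\<lambda>\<epsilon>. Theta_sd \<sigma> (s \<epsilon>) (d \<epsilon>) (r \<epsilon>) \<noteq> {}) (at_right 0)"
  shows "Liminf (at_right 0) (\<lambda>\<epsilon>. minimax_risk \<sigma> \<beta> (del \<epsilon>) \<epsilon> (d \<epsilon>) (s \<epsilon>) (r \<epsilon>)) > 0"
proof -
  define \<gamma> where "\<gamma> = sqrt (1 - \<beta>)"
  have \<gamma>: "0 < \<gamma>" "\<gamma>\<^sup>2 = 1 - \<beta>" using beta by (auto simp: \<gamma>_def)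
  define C0 where "C0 = sqrt 2 * (1 + \<gamma>)"
  have C0: "0 < C0" using \<gamma> by (simp add: C0_def add_pos_pos)
  define f where "f \<epsilon> k = a_eps \<sigma> \<epsilon> {..<k} (r \<epsilon> k) / ereal (sqrt (ln (real (d \<epsilon> choose k))))" for \<epsilon> k
  have "Limsup (at_right 0) (\<lambda>\<epsilon>. Min (f \<epsilon> ` {1..s \<epsilon>})) < ereal C0"
    using cond by (simp add: f_def[abs_def] C0_def \<gamma>_def)
  then obtain C1 where C1: "Limsup (at_right 0) (\<lambda>\<epsilon>. Min (f \<epsilon> ` {1..s \<epsilon>})) < ereal C1" "ereal C1 < ereal C0"
    using ereal_dense2 by blast
  \<comment> \<open>The maximum with C0 / 2 ensures positivity, which the density argument alone
    does not give for C1.\<close>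
  define C where "C = max C1 (C0 / 2)"
  have C: "0 < C" "C < C0" "C1 \<le> C" using C1(2) C0 by (auto simp: C_def)
  have ev_min: "eventually (\<lambda>\<epsilon>. Min (f \<epsilon> ` {1..s \<epsilon>}) < ereal C) (at_right 0)"
    using Limsup_lessD[OF C1(1)] by (rule eventually_mono) (use C(3) in \<open>auto intro: less_le_trans\<close>)
  define x where "x = (C / C0)\<^sup>2"
  have x: "0 \<le> x" "x < 1" using C C0 by (auto simp: x_def power_less_one_iff abs_less_iff)
  \<comment> \<open>With this choice both exponents are the same fraction x < 1 of their budgets 1
    and 1 - \<open>\<beta>\<close>.\<close>
  define \<rho> where "\<rho> = 1 / (1 + \<gamma>)"
  have \<rho>: "0 < \<rho>" "\<rho> < 1" using \<gamma> by (auto simp: \<rho>_def)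
  have \<rho>C: "\<rho>\<^sup>2 * C\<^sup>2 / 2 = x"
    using \<gamma> by (simp add: \<rho>_def x_def C0_def power_mult_distrib power_divide)
  have "1 - \<rho> = \<gamma> * \<rho>" using \<gamma> by (simp add: \<rho>_def field_simps)
  then have \<rho>C': "(1 - \<rho>)\<^sup>2 * C\<^sup>2 / 2 = (1 - \<beta>) * x"
    using \<rho>C \<gamma>(2) by (simp add: power_mult_distrib flip: \<rho>C)
  \<comment> \<open>Half of the smaller slack (1 - \<open>\<beta>\<close>) (1 - x); the other half
    is reserved for the moment errors through the choice of \<open>st\<close>.\<close>
  define \<omega> where "\<omega> = (1 - \<beta>) * (1 - x) / 2"
  have \<omega>: "0 < \<omega>" using beta x by (simp add: \<omega>_def)
  define st where "st = min (\<omega> / (8 * C\<^sup>2)) (min (\<rho> / 2) ((1 - \<rho>) / 2))"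
  have "0 < st" using \<omega> C \<rho> by (simp add: st_def)
  have s\<rho>: "st \<le> \<rho> / 2" "st \<le> (1 - \<rho>) / 2" unfolding st_def by linarith+
  have "2 * st \<le> \<rho>" "2 * st \<le> 1 - \<rho>" using s\<rho> by simp_all
  then have st: "0 < st" "st < \<rho>" "\<rho> + st < 1" using \<rho> \<open>0 < st\<close> by linarith+
  have "st \<le> \<omega> / (8 * C\<^sup>2)" by (simp add: st_def)
  then have stC: "8 * st * C\<^sup>2 \<le> \<omega>" using C by (simp add: pos_le_divide_eq mult_ac)
  have h1: "(1 - \<rho>)\<^sup>2 * C\<^sup>2 / 2 + 8 * st * C\<^sup>2 + \<omega> \<le> 1 - \<beta>"
    unfolding \<rho>C' using stC by (simp add: \<omega>_def field_simps)
  have "(1 - \<beta>) * (1 - x) \<le> 1 * (1 - x)" using beta x by (intro mult_right_mono) auto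
  then have h0: "\<rho>\<^sup>2 * C\<^sup>2 / 2 + 8 * st * C\<^sup>2 + \<omega> \<le> 1"
    unfolding \<rho>C using stC by (simp add: \<omega>_def)
  obtain L1 where L1: "\<And>\<epsilon> d s k r del \<eta>0 \<theta>0. 0 < \<epsilon> \<Longrightarrow> k \<in> {1..s} \<Longrightarrow> 2 * s \<le> d \<Longrightarrow> L1 \<le> ln (real d) \<Longrightarrow>
    ln (real (d choose s)) \<le> ln (1 / \<epsilon>) \<Longrightarrow> del \<le> 1 / 2 \<Longrightarrow> 0 < r k \<Longrightarrow>
    \<eta>0 \<in> Hclass \<beta> del d s \<Longrightarrow> \<theta>0 \<in> Theta_sd \<sigma> s d r \<Longrightarrow>
    a_eps \<sigma> \<epsilon> {..<k} (r k) / ereal (sqrt (ln (real (d choose k)))) < ereal C \<Longrightarrow>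
    ennreal (1 / 8) \<le> minimax_risk \<sigma> \<beta> del \<epsilon> d s r"
    by (rule risk_ge_eighth_at_level[OF sigma beta st C(1) \<omega> h0 h1]) blast
  have ev_d: "eventually (\<lambda>\<epsilon>. nat \<lceil>exp L1\<rceil> + 1 \<le> d \<epsilon>) (at_right 0)"
    using d_inf by (simp add: filterlim_at_top)
  have ev_s: "eventually (\<lambda>\<epsilon>. 1 \<le> s \<epsilon>) (at_right 0)"
    using s_inf by (simp add: filterlim_at_top)
  have ev_sd: "eventually (\<lambda>\<epsilon>. real (s \<epsilon>) / real (d \<epsilon>) < 1 / 2) (at_right 0)"
    using s_od by (rule order_tendstoD) simp
  have ev_lb: "eventually (\<lambda>\<epsilon>. ln (real (d \<epsilon> choose s \<epsilon>)) / ln (1 / \<epsilon>) < 1) (at_right 0)"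
    using logbinom by (rule order_tendstoD) simp
  have ev_del: "eventually (\<lambda>\<epsilon>. del \<epsilon> < 1 / 2) (at_right 0)"
    using del_lim by (rule order_tendstoD) simp
  have ev_\<epsilon>: "eventually (\<lambda>\<epsilon>::real. 0 < \<epsilon> \<and> \<epsilon> < 1) (at_right 0)"
    by (auto simp: eventually_at_right_field intro!: exI[of _ 1])
  have "eventually (\<lambda>\<epsilon>. ennreal (1 / 8) \<le> minimax_risk \<sigma> \<beta> (del \<epsilon>) \<epsilon> (d \<epsilon>) (s \<epsilon>) (r \<epsilon>)) (at_right 0)"
    using ev_min ev_d ev_s ev_sd ev_lb ev_del ev_\<epsilon> H_nonempty Theta_nonempty
  proof eventually_elim
    case (elim \<epsilon>)
    have \<epsilon>: "0 < \<epsilon>" "\<epsilon> < 1" using elim by auto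
    \<comment> \<open>The minimising k may change with epsilon, hence the need for a threshold L1
      uniform in k.\<close>
    have "Min (f \<epsilon> ` {1..s \<epsilon>}) \<in> f \<epsilon> ` {1..s \<epsilon>}" using elim by (intro Min_in) auto
    then obtain k where "k \<in> {1..s \<epsilon>}" "Min (f \<epsilon> ` {1..s \<epsilon>}) = f \<epsilon> k" by blast
    then have k: "k \<in> {1..s \<epsilon>}" "f \<epsilon> k < ereal C" using elim(1) by simp_all
    obtain \<eta>0 \<theta>0 where "\<eta>0 \<in> Hclass \<beta> (del \<epsilon>) (d \<epsilon>) (s \<epsilon>)" "\<theta>0 \<in> Theta_sd \<sigma> (s \<epsilon>) (d \<epsilon>) (r \<epsilon>)"
      using elim by blast
    moreover have "2 * s \<epsilon> \<le> d \<epsilon>"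
    proof -
      have "real (2 * s \<epsilon>) \<le> real (d \<epsilon>)" using elim by (simp add: pos_divide_less_eq)
      then show ?thesis by (simp only: of_nat_le_iff)
    qed
    moreover have "L1 \<le> ln (real (d \<epsilon>))"
    proof -
      have "exp L1 \<le> real (d \<epsilon>)" using elim by linarith
      then have "ln (exp L1) \<le> ln (real (d \<epsilon>))" by (intro ln_mono) (auto intro: less_le_trans[OF exp_gt_zero])
      then show ?thesis by simp
    qed
    moreover have "ln (real (d \<epsilon> choose s \<epsilon>)) \<le> ln (1 / \<epsilon>)"
    proof -
      have "0 < ln (1 / \<epsilon>)" using \<epsilon> by (intro ln_gt_zero) auto
      then show ?thesis using elim by (simp add: pos_divide_less_eq)
    qed
    ultimately show ?case
      using k \<epsilon>(1) r_pos[of \<epsilon> k] elim by (intro L1[of \<epsilon> k]) (auto simp: f_def)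
  qed
  then have "ennreal (1 / 8) \<le> Liminf (at_right 0) (\<lambda>\<epsilon>. minimax_risk \<sigma> \<beta> (del \<epsilon>) \<epsilon> (d \<epsilon>) (s \<epsilon>) (r \<epsilon>))"
    by (rule Liminf_bounded)
  moreover have "0 < ennreal (1 / 8)" by simp
  ultimately show ?thesis by (rule less_le_trans[rotated])
qed

end
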